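(* Let $f \in L^2(ds) \cap L^1\left(\frac{ds}{1+\sqrt{s}}\right)$. Let $\{f_n\}$ be a sequence of step functions which approximates $f$ both in $L^2(ds)$ and in $L^1\left(\frac{ds}{1+\sqrt{s}}\right)$, i.e. $$\int_0^\infty |f_n(s)-f(s)|^2\,ds + \int_0^\infty |f_n(s)-f(s)|\,\frac{ds}{1+\sqrt{s}} \longrightarrow 0 \quad (n\to\infty).$$ Then there exists a random variable (an $\mathcal{F}_\infty$-measurable functional on $\Omega$), denoted by $\int_0^\infty f(s)\,dX_s$, such that $$\int_0^\infty f_n(s)\,dX_s \longrightarrow \int_0^\infty f(s)\,dX_s \quad (n\to\infty) \quad \text{locally in } \mathscr{W}\text{-measure}.$$ The limit random variable does not depend, up to $\mathscr{W}$-null sets, on the choice of the approximating sequence $\{f_n\}$.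
   Context: Path space. $\Omega = C([0,\infty)\to\mathbb{R})$, $X=(X_s)_{s\ge 0}$ is the coordinate process on $\Omega$, and $\mathcal{F}_\infty=\sigma(X_s:s\ge 0)$. Measures. $\Pi^{(u)}$ ($u>0$) is the law on $C([0,u]\to\mathbb{R})$ of the Brownian bridge from $0$ to $0$ of length $u$. $R^+$ is the law on $(\Omega,\mathcal{F}_\infty)$ of the 3-dimensional Bessel process starting from $0$, $R^-$ is the law of $(-X_t)$ under $R^+$, and $R=\frac{R^++R^-}{2}$ (law of the symmetrized 3-dimensional Bessel process). For $u>0$, $X^{(u)}=(X_t:0\le t\le u)$ and $Y=(Y_t:t\ge0)$, the concatenation $X^{(u)}\bullet Y$ is the path with $(X^{(u)}\bullet Y)_t = X_t$ if $0\le t<u$; $=Y_{t-u}$ if $t\ge u$ and $X_u=Y_0$; $=X_u$ if $t\ge u$ and $X_u\ne Y_0$. $\Pi^{(u)}\bullet R$ is the law on $(\Omega,\mathcal{F}_\infty)$ of $X^{(u)}\bullet Y$ under the product measure $\Pi^{(u)}(dX^{(u)})\otimes R(dY)$. The $\sigma$-finite measure $\mathscr{W}$ on $(\Omega,\mathcal{F}_\infty)$ is $$\mathscr{W}=\int_0^\infty \frac{du}{\sqrt{2\pi u}}\,\left(\Pi^{(u)}\bullet R\right).$$ Functions. $L^2(ds)$ denotes $L^2([0,\infty),ds)$ with real-valued functions, and $L^1\left(\frac{ds}{1+\sqrt{s}}\right)=\{f:\int_0^\infty|f(s)|\frac{ds}{1+\sqrt{s}}<\infty\}$. A step function is a function $f=\sum_{k=1}^n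 c_k 1_{[t_{k-1},t_k)}$ with $n\in\mathbb{N}$, $c_k\in\mathbb{R}$, $0=t_0<t_1<\cdots<t_n<\infty$; for it, $\int_0^\infty f(s)\,dX_s:=\sum_{k=1}^n c_k(X_{t_k}-X_{t_{k-1}})$. Convergence. Measurable functionals $Z_n$ converge to a measurable functional $Z$ locally in $\mathscr{W}$-measure if for every $\varepsilon>0$ and every $A\in\mathcal{F}_\infty$ with $\mathscr{W}(A)<\infty$, $\mathscr{W}(A\cap\{|Z_n-Z|\ge\varepsilon\})\to0$ as $n\to\infty$. *)

theory Defs
  imports "HOL-Probability.Probability"
begin

text \<open>
  The continuous paths on an index set \<open>I\<close> (extensional functions, so that a path is
  determined by its values on \<open>I\<close>), with the sigma-algebra generated by the coordinate
  maps. \<open>path_space {0..}\<close> is \<open>(\<Omega>, \<F>\<^sub>\<infinity>)\<close>. Only the measurable space matters, not the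
  measure that it carries.
\<close>
definition path_space :: "real set \<Rightarrow> (real \<Rightarrow> real) measure" where
  "path_space I = restrict_space (\<Pi>\<^sub>M s\<in>I. borel) {\<omega>. continuous_on I \<omega>}"

abbreviation "path_space_inf \<equiv> path_space {0..}"

lemma space_path_space: "space (path_space I) = {\<omega> \<in> extensional I. continuous_on I \<omega>}"
  by (auto simp: path_space_def space_restrict_space space_PiM PiE_def)

lemma measurable_path_space_component:
  "s \<in> I \<Longrightarrow> (\<lambda>\<omega>. \<omega> s) \<in> borel_measurable (path_space I)"
  unfolding path_space_def by (intro measurable_restrict_space1) simp

lemma measurable_path_spaceI:
  assumes "\<And>x. x \<in> space M \<Longrightarrow> continuous_on I (F x)"
    and "\<And>s. s \<in> I \<Longrightarrow> (\<lambda>x. F x s) \<in> borel_measurable M"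
  shows "(\<lambda>x. \<lambda>s\<in>I. F x s) \<in> M \<rightarrow>\<^sub>M path_space I"
  unfolding path_space_def
  by (rule measurable_restrict_space2) (use assms in \<open>auto intro!: measurable_restrict\<close>)


section \<open>The laws\<close>

text \<open>Standard Wiener measure, from which the other laws are built.\<close>
definition wiener_measure :: "(real \<Rightarrow> real) measure \<Rightarrow> bool" where
  "wiener_measure B \<longleftrightarrow>
     prob_space B \<and> sets B = sets path_space_inf \<and>
     (AE \<omega> in B. \<omega> 0 = 0) \<and>
     (\<forall>s t. 0 \<le> s \<and> s < t \<longrightarrow>
        distributed B lborel (\<lambda>\<omega>. \<omega> t - \<omega> s) (normal_density 0 (sqrt (t - s)))) \<and>
     (\<forall>n (t :: nat \<Rightarrow> real). 0 \<le> t 0 \<and> (\<forall>k<n. t k < t (Suc k)) \<longrightarrow>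
        prob_space.indep_vars B (\<lambda>_. borel) (\<lambda>k \<omega>. \<omega> (t (Suc k)) - \<omega> (t k)) {..<n})"

text \<open>The Brownian bridge from 0 to 0 of length \<open>u\<close> is \<open>B\<^sub>t - (t/u) B\<^sub>u\<close>, for \<open>0 \<le> t \<le> u\<close>.\<close>
definition bridge_law :: "(real \<Rightarrow> real) measure \<Rightarrow> real \<Rightarrow> (real \<Rightarrow> real) measure" where
  "bridge_law B u = distr B (path_space {0..u}) (\<lambda>\<omega>. \<lambda>t\<in>{0..u}. \<omega> t - t / u * \<omega> u)"

text \<open>The 3-dimensional Bessel process from 0 is the Euclidean norm of 3-dimensional Brownian
  motion.\<close>
definition bessel3_law :: "(real \<Rightarrow> real) measure \<Rightarrow> (real \<Rightarrow> real) measure" where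
  "bessel3_law B = distr (B \<Otimes>\<^sub>M B \<Otimes>\<^sub>M B) path_space_inf
     (\<lambda>(x, y, z). \<lambda>t\<in>{0..}. sqrt ((x t)\<^sup>2 + (y t)\<^sup>2 + (z t)\<^sup>2))"

definition neg_bessel3_law :: "(real \<Rightarrow> real) measure \<Rightarrow> (real \<Rightarrow> real) measure" where
  "neg_bessel3_law B = distr (bessel3_law B) path_space_inf (\<lambda>\<omega>. \<lambda>t\<in>{0..}. - \<omega> t)"

definition sym_bessel3_law :: "(real \<Rightarrow> real) measure \<Rightarrow> (real \<Rightarrow> real) measure" where
  "sym_bessel3_law B = measure_of (space path_space_inf) (sets path_space_inf)
     (\<lambda>A. (emeasure (bessel3_law B) A + emeasure (neg_bessel3_law B) A) / 2)"

definition path_concat :: "real \<Rightarrow> (real \<Rightarrow> real) \<Rightarrow> (real \<Rightarrow> real) \<Rightarrow> real \<Rightarrow> real" where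
  "path_concat u x y =
     (\<lambda>t\<in>{0..}. if t < u then x t else if x u = y 0 then y (t - u) else x u)"

definition bridge_bessel_law :: "(real \<Rightarrow> real) measure \<Rightarrow> real \<Rightarrow> (real \<Rightarrow> real) measure" where
  "bridge_bessel_law B u =
     distr (bridge_law B u \<Otimes>\<^sub>M sym_bessel3_law B) path_space_inf (\<lambda>(x, y). path_concat u x y)"

lemma measurable_bridge:
  assumes "sets B = sets path_space_inf" "0 < u"
  shows "(\<lambda>\<omega>. \<lambda>t\<in>{0..u}. \<omega> t - t / u * \<omega> u) \<in> B \<rightarrow>\<^sub>M path_space {0..u}"
proof (rule measurable_path_spaceI)
  show "continuous_on {0..u} (\<lambda>t. \<omega> t - t / u * \<omega> u)" if "\<omega> \<in> space B" for \<omega>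
  proof -
    have "continuous_on {0..u} \<omega>"
      using that sets_eq_imp_space_eq[OF assms(1)] by (auto simp: space_path_space elim: continuous_on_subset)
    then show ?thesis using assms(2) by (intro continuous_intros) auto
  qed
  show "(\<lambda>\<omega>. \<omega> t - t / u * \<omega> u) \<in> borel_measurable B" if "t \<in> {0..u}" for t
    using that assms measurable_path_space_component[of _ "{0..}"]
    by (intro borel_measurable_diff borel_measurable_times)
      (auto simp: measurable_cong_sets[OF assms(1) refl])
qed

lemma measurable_bessel3:
  assumes "sets B = sets path_space_inf"
  shows "(\<lambda>(x, y, z). \<lambda>t\<in>{0..}. sqrt ((x t)\<^sup>2 + (y t)\<^sup>2 + (z t)\<^sup>2))
    \<in> B \<Otimes>\<^sub>M B \<Otimes>\<^sub>M B \<rightarrow>\<^sub>M path_space_inf"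
proof -
  define F where "F p t = sqrt ((fst p t)\<^sup>2 + (fst (snd p) t)\<^sup>2 + (snd (snd p) t)\<^sup>2)"
    for p :: "(real \<Rightarrow> real) \<times> (real \<Rightarrow> real) \<times> (real \<Rightarrow> real)" and t
  have "continuous_on {0..} (F p)" if "p \<in> space (B \<Otimes>\<^sub>M B \<Otimes>\<^sub>M B)" for p
  proof -
    have "continuous_on {0..} (fst p)" "continuous_on {0..} (fst (snd p))"
        "continuous_on {0..} (snd (snd p))"
      using that unfolding space_pair_measure sets_eq_imp_space_eq[OF assms] space_path_space
      by (simp_all add: mem_Times_iff)
    then show ?thesis
      unfolding F_def by (intro continuous_on_real_sqrt continuous_on_add continuous_on_power)
  qed
  moreover have "(\<lambda>p. F p t) \<in> borel_measurable (B \<Otimes>\<^sub>M B \<Otimes>\<^sub>M B)" if "t \<in> {0..}" for t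
  proof -
    have [measurable]: "(\<lambda>\<omega>. \<omega> t) \<in> borel_measurable B"
      using that measurable_path_space_component[of t "{0..}"]
      by (simp add: measurable_cong_sets[OF assms refl])
    show ?thesis unfolding F_def by measurable
  qed
  ultimately have "(\<lambda>p. \<lambda>t\<in>{0..}. F p t) \<in> B \<Otimes>\<^sub>M B \<Otimes>\<^sub>M B \<rightarrow>\<^sub>M path_space_inf"
    by (rule measurable_path_spaceI)
  then show ?thesis by (simp add: F_def case_prod_beta')
qed

lemma measurable_neg_path:
  "(\<lambda>\<omega>. \<lambda>t\<in>{0..}. - \<omega> t) \<in> path_space_inf \<rightarrow>\<^sub>M path_space_inf"
proof (rule measurable_path_spaceI)
  show "continuous_on {0..} (\<lambda>t. - x t)" if "x \<in> space path_space_inf" for x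
    using that by (auto simp: space_path_space intro: continuous_on_minus)
  show "(\<lambda>x. - x t) \<in> borel_measurable path_space_inf" if "t \<in> {0..}" for t
    using measurable_path_space_component[OF that] by (rule borel_measurable_uminus)
qed

lemma emeasure_sym_bessel3_law:
  assumes "A \<in> sets path_space_inf"
  shows "emeasure (sym_bessel3_law B) A =
    (emeasure (bessel3_law B) A + emeasure (neg_bessel3_law B) A) / 2"
  unfolding sym_bessel3_law_def
proof (rule emeasure_measure_of_sigma)
  show "countably_additive (sets path_space_inf)
      (\<lambda>A. (emeasure (bessel3_law B) A + emeasure (neg_bessel3_law B) A) / 2)"
  proof (rule countably_additiveI)
    fix F :: "nat \<Rightarrow> (real \<Rightarrow> real) set"
    assume "range F \<subseteq> sets path_space_inf" "disjoint_family F"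
    then show "(\<Sum>i. (emeasure (bessel3_law B) (F i) + emeasure (neg_bessel3_law B) (F i)) / 2) =
      (emeasure (bessel3_law B) (\<Union>i. F i) + emeasure (neg_bessel3_law B) (\<Union>i. F i)) / 2"
      by (simp add: divide_ennreal_def suminf_add[symmetric] suminf_emeasure
          bessel3_law_def neg_bessel3_law_def)
  qed
qed (use assms in \<open>auto simp: positive_def sets.sigma_algebra_axioms\<close>)

lemma continuous_path_concat:
  fixes x y :: "real \<Rightarrow> real"
  assumes "0 < u" "continuous_on {0..u} x" "continuous_on {0..} y"
  shows "continuous_on {0..} (\<lambda>t. if t < u then x t else if x u = y 0 then y (t - u) else x u)"
proof -
  have y: "continuous_on {u..} (\<lambda>t. y (t - u))"
    by (rule continuous_on_compose2[OF assms(3)]) (auto intro: continuous_on_diff)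
  have "continuous_on ({0..u} \<union> {u..})
      (\<lambda>t. if t \<le> u then x t else if x u = y 0 then y (t - u) else x u)"
    using assms(2) y by (intro continuous_on_If) (cases "x u = y 0"; auto)+
  moreover have "{0..u} \<union> {u..} = {0..}" using assms(1) by auto
  moreover have "(if t \<le> u then x t else if x u = y 0 then y (t - u) else x u) =
      (if t < u then x t else if x u = y 0 then y (t - u) else x u)" for t
    by auto
  ultimately show ?thesis by simp
qed

lemma measurable_path_concat:
  assumes "0 < u"
  shows "(\<lambda>(x, y). path_concat u x y) \<in> path_space {0..u} \<Otimes>\<^sub>M path_space_inf \<rightarrow>\<^sub>M path_space_inf"
  unfolding path_concat_def case_prod_beta
proof (rule measurable_path_spaceI)
  fix t :: real assume t: "t \<in> {0..}"
  have [measurable]: "(\<lambda>\<omega>. \<omega> s) \<in> borel_measurable (path_space {0..u})" if "s \<in> {0..u}" for s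
    using that by (rule measurable_path_space_component)
  have [measurable]: "(\<lambda>\<omega>. \<omega> s) \<in> borel_measurable path_space_inf" if "s \<in> {0..}" for s
    using that by (rule measurable_path_space_component)
  show "(\<lambda>p. if t < u then fst p t else if fst p u = snd p 0 then snd p (t - u) else fst p u)
      \<in> borel_measurable (path_space {0..u} \<Otimes>\<^sub>M path_space_inf)"
    using t assms by (cases "t < u") auto
qed (use assms in \<open>auto simp: space_pair_measure space_path_space intro!: continuous_path_concat\<close>)

definition script_W :: "(real \<Rightarrow> real) measure \<Rightarrow> (real \<Rightarrow> real) measure" where
  "script_W B = measure_of (space path_space_inf) (sets path_space_inf)
     (\<lambda>A. \<integral>\<^sup>+u\<in>{0<..}. ennreal (1 / sqrt (2 * pi * u)) * emeasure (bridge_bessel_law B u) A \<partial>lborel)"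


section \<open>Step functions and their integrals\<close>

text \<open>Functions on \<open>[0,\<infinity>)\<close> are modelled by functions on the reals whose values at negative
  arguments are ignored.\<close>
definition step_rep :: "(real \<Rightarrow> real) \<Rightarrow> nat \<Rightarrow> (nat \<Rightarrow> real) \<Rightarrow> (nat \<Rightarrow> real) \<Rightarrow> bool" where
  "step_rep f m c t \<longleftrightarrow>
     t 0 = 0 \<and> (\<forall>k\<in>{1..m}. t (k - 1) < t k) \<and>
     (\<forall>s\<ge>0. f s = (\<Sum>k=1..m. c k * indicator {t (k - 1)..<t k} s))"

definition step_function :: "(real \<Rightarrow> real) \<Rightarrow> bool" where
  "step_function f \<longleftrightarrow> (\<exists>m c t. step_rep f m c t)"

text \<open>The value does not depend on the representation, see \<open>step_integral_eq\<close>.\<close>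
definition step_integral :: "(real \<Rightarrow> real) \<Rightarrow> (real \<Rightarrow> real) \<Rightarrow> real" where
  "step_integral f \<omega> =
     (THE v. \<exists>m c t. step_rep f m c t \<and> v = (\<Sum>k=1..m. c k * (\<omega> (t k) - \<omega> (t (k - 1)))))"

lemma step_rep_less:
  assumes "step_rep f m c t" "i < j" "j \<le> m"
  shows "t i < t j"
  using assms(2,3)
proof (induction j)
  case (Suc j)
  have "t j < t (Suc j)"
    using assms(1) Suc.prems unfolding step_rep_def by (metis atLeastAtMost_iff diff_Suc_1 le_add1 plus_1_eq_Suc)
  then show ?case using Suc by (cases "i = j") auto
qed simp

lemma step_rep_le:
  assumes "step_rep f m c t" "i \<le> j" "j \<le> m"
  shows "t i \<le> t j"
  using step_rep_less[OF assms(1), of i j] assms by (cases "i = j") auto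

lemma step_rep_value:
  assumes "step_rep f m c t" "k \<in> {1..m}" "t (k - 1) \<le> s" "s < t k"
  shows "f s = c k"
proof -
  have "k - 1 \<le> m" using assms(2) by auto
  then have "0 \<le> s"
    using step_rep_le[OF assms(1), of 0 "k - 1"] assms(1,3) unfolding step_rep_def by auto
  moreover have "s \<notin> {t (j - 1)..<t j}" if "j \<in> {1..m}" "j \<noteq> k" for j
  proof (cases "j < k")
    case True
    then have "j \<le> k - 1" by simp
    then show ?thesis using step_rep_le[OF assms(1), of j "k - 1"] \<open>k - 1 \<le> m\<close> assms(3) by auto
  next
    case False
    with that have "k \<le> j - 1" "j - 1 \<le> m" by auto
    then show ?thesis using step_rep_le[OF assms(1), of k "j - 1"] assms(4) by auto
  qed
  then have "(\<Sum>j=1..m. c j * indicator {t (j - 1)..<t j} s) = (\<Sum>j\<in>{k}. c j * indicator {t (j - 1)..<t j} s)"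
    using assms(2) by (intro sum.mono_neutral_right) auto
  moreover have "\<dots> = c k" using assms(3,4) by (subst sum.insert) (auto simp: indicator_def)
  ultimately show ?thesis using assms(1) unfolding step_rep_def by metis
qed

lemma step_rep_value_beyond:
  assumes "step_rep f m c t" "t m \<le> s"
  shows "f s = 0"
proof -
  have "0 \<le> s" using step_rep_le[OF assms(1), of 0 m] assms unfolding step_rep_def by auto
  moreover have "s \<notin> {t (j - 1)..<t j}" if "j \<in> {1..m}" for j
    using step_rep_le[OF assms(1), of j m] assms that by auto
  ultimately show ?thesis using assms(1) unfolding step_rep_def by (auto intro!: sum.neutral)
qed

lemma step_rep_integral_unique:
  fixes \<omega> :: "real \<Rightarrow> real"
  assumes "step_rep f m c t" "step_rep f m' c' t'"
  shows "(\<Sum>k=1..m. c k * (\<omega> (t k) - \<omega> (t (k - 1)))) =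
         (\<Sum>k=1..m'. c' k * (\<omega> (t' k) - \<omega> (t' (k - 1))))"
proof -
  define g where "g s = (if s < 0 then 0 else f s)" for s
  define J where "J s = Lim (at_left s) g - g s" for s
  have *: "(\<Sum>k=1..m. c k * (\<omega> (t k) - \<omega> (t (k - 1)))) = (\<Sum>s | J s \<noteq> 0. J s * \<omega> s)"
    if rep: "step_rep f m c t" for m c t
  proof -
    define d where "d k = (if k \<in> {1..m} then c k else 0)" for k
    have t0: "t 0 = 0" using rep by (simp add: step_rep_def)
    have left: "Lim (at_left s) g = a" if "r < s" "\<And>x. r < x \<Longrightarrow> x < s \<Longrightarrow> g x = a" for r s a
    proof (rule tendsto_Lim)
      have "eventually (\<lambda>x. g x = a) (at_left s)"
        using that by (auto simp: eventually_at_left_field)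
      then show "(g \<longlongrightarrow> a) (at_left s)" by (simp add: tendsto_eventually)
    qed (simp add: trivial_limit_at_left_real)
    have g_in: "g s = c k" if "k \<in> {1..m}" "t (k - 1) \<le> s" "s < t k" for k s
    proof -
      have "k - 1 \<le> m" using that(1) by auto
      then show ?thesis
        using step_rep_value[OF rep that] step_rep_le[OF rep, of 0 "k - 1"] t0 that(2)
        by (auto simp: g_def)
    qed
    have g_beyond: "g s = 0" if "t m \<le> s" for s
      using step_rep_value_beyond[OF rep that] by (auto simp: g_def)
    have cover: "s < 0 \<or> t m \<le> s \<or> (\<exists>k\<in>{1..m}. t (k - 1) \<le> s \<and> s < t k)" for s
    proof (rule ccontr)
      assume a: "\<not> ?thesis"
      have "t k \<le> s" if "k \<le> m" for k
        using that
      proof (induction k)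
        case (Suc k)
        then show ?case using a by (force dest!: bspec[of _ _ "Suc k"])
      qed (use a t0 in simp)
      then show False using a by auto
    qed
    have J_at: "J (t k) = d k - d (Suc k)" if "k \<le> m" for k
    proof -
      have "Lim (at_left (t k)) g = d k"
      proof (cases "k = 0")
        case True
        then show ?thesis using left[of "-1" "t k" 0] t0 by (auto simp: g_def d_def)
      next
        case False
        then show ?thesis
          using left[of "t (k - 1)" "t k" "c k"] step_rep_less[OF rep, of "k - 1" k] that g_in[of k]
          by (auto simp: d_def)
      qed
      moreover have "g (t k) = d (Suc k)"
        using g_in[of "Suc k" "t k"] g_beyond[of "t k"] step_rep_less[OF rep, of k "Suc k"] that
        by (cases "k = m") (auto simp: d_def)
      ultimately show ?thesis by (simp add: J_def)
    qed
    have J_off: "J s = 0" if s: "s \<notin> t ` {0..m}" for s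
    proof -
      consider "s < 0" | "t m < s" | k where "k \<in> {1..m}" "t (k - 1) < s" "s < t k"
      proof -
        have ne: "t k \<noteq> s" if "k \<le> m" for k using s that by auto
        consider "s < 0" | "t m \<le> s" | k where "k \<in> {1..m}" "t (k - 1) \<le> s" "s < t k"
          using cover[of s] by blast
        then show ?thesis
        proof cases
          case 2
          then show ?thesis using ne[of m] that(2) by simp
        next
          case (3 k)
          then show ?thesis using ne[of "k - 1"] that(3)[of k] by fastforce
        qed (rule that(1))
      qed
      then show ?thesis
      proof cases
        case 1
        then show ?thesis using left[of "s - 1" s 0] by (auto simp: J_def g_def)
      next
        case 2
        then show ?thesis using left[of "t m" s 0] g_beyond by (auto simp: J_def)
      next
        case (3 k)
        then show ?thesis using left[of "t (k - 1)" s "c k"] g_in[of k] by (auto simp: J_def)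
      qed
    qed
    have inj: "inj_on t {0..m}"
      using step_rep_less[OF rep] by (intro linorder_inj_onI) force+
    have "(\<Sum>s | J s \<noteq> 0. J s * \<omega> s) = (\<Sum>s\<in>t ` {0..m}. J s * \<omega> s)"
      using J_off by (intro sum.mono_neutral_left) auto
    also have "\<dots> = (\<Sum>k=0..m. (d k - d (Suc k)) * \<omega> (t k))"
      using inj J_at by (simp add: sum.reindex)
    also have "\<dots> = (\<Sum>k=0..m. d k * \<omega> (t k)) - (\<Sum>k=0..m. d (Suc k) * \<omega> (t k))"
      by (simp add: left_diff_distrib sum_subtractf)
    also have "(\<Sum>k=0..m. d k * \<omega> (t k)) = (\<Sum>k=1..m. c k * \<omega> (t k))"
      by (simp add: sum.atLeast_Suc_atMost d_def)
    also have "(\<Sum>k=0..m. d (Suc k) * \<omega> (t k)) = (\<Sum>k=1..Suc m. d k * \<omega> (t (k - 1)))"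
      using sum.shift_bounds_cl_Suc_ivl[of "\<lambda>k. d k * \<omega> (t (k - 1))" 0 m] by simp
    also have "\<dots> = (\<Sum>k=1..m. c k * \<omega> (t (k - 1)))"
      by (simp add: d_def)
    finally show ?thesis by (simp add: right_diff_distrib sum_subtractf)
  qed
  show ?thesis using *[OF assms(1)] *[OF assms(2)] by simp
qed

lemma step_integral_eq:
  "step_rep f m c t \<Longrightarrow> step_integral f \<omega> = (\<Sum>k=1..m. c k * (\<omega> (t k) - \<omega> (t (k - 1))))"
  unfolding step_integral_def
proof (rule the_equality)
  assume rep: "step_rep f m c t"
  then show "\<exists>m' c' t'. step_rep f m' c' t' \<and>
      (\<Sum>k=1..m. c k * (\<omega> (t k) - \<omega> (t (k - 1)))) =
      (\<Sum>k=1..m'. c' k * (\<omega> (t' k) - \<omega> (t' (k - 1))))"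
    by blast
  fix v
  assume "\<exists>m' c' t'. step_rep f m' c' t' \<and> v = (\<Sum>k=1..m'. c' k * (\<omega> (t' k) - \<omega> (t' (k - 1))))"
  then show "v = (\<Sum>k=1..m. c k * (\<omega> (t k) - \<omega> (t (k - 1))))"
    using step_rep_integral_unique[OF _ rep] by blast
qed


section \<open>Modes of convergence\<close>

definition approximates :: "(nat \<Rightarrow> real \<Rightarrow> real) \<Rightarrow> (real \<Rightarrow> real) \<Rightarrow> bool" where
  "approximates fn f \<longleftrightarrow>
     (\<lambda>n. (\<integral>\<^sup>+s. ennreal (\<bar>fn n s - f s\<bar>\<^sup>2) \<partial>lebesgue_on {0..}) +
          (\<integral>\<^sup>+s. ennreal (\<bar>fn n s - f s\<bar> / (1 + sqrt s)) \<partial>lebesgue_on {0..})) \<longlonglongrightarrow> 0"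

definition converges_locally_in_measure ::
    "'a measure \<Rightarrow> (nat \<Rightarrow> 'a \<Rightarrow> real) \<Rightarrow> ('a \<Rightarrow> real) \<Rightarrow> bool" where
  "converges_locally_in_measure M Zn Z \<longleftrightarrow>
     (\<forall>n. Zn n \<in> borel_measurable M) \<and> Z \<in> borel_measurable M \<and>
     (\<forall>\<epsilon>>0. \<forall>A\<in>sets M. emeasure M A < \<infinity> \<longrightarrow>
        (\<lambda>n. emeasure M (A \<inter> {x \<in> space M. \<bar>Zn n x - Z x\<bar> \<ge> \<epsilon>})) \<longlonglongrightarrow> 0)"

end

theory Submission
  imports Defs
begin


text \<open>Under the slice of \<open>script_W B\<close> at \<open>u\<close> the path is a Brownian
  bridge on [0,u] followed by an independent symmetrized Bessel process, so a step integral is a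
  bridge part plus a Bessel part and its first moment can be bounded slice by slice
  (\<open>glue_step_bound\<close>). For the bridge B_t - (t/u) B_u, integrating a step function g
  gives a Wiener integral minus (K/u) B_u, where K is the integral of g over [0,u]; both terms are
  of the order of the L2 norm of g, the second by Cauchy-Schwarz. The Bessel process is the norm of
  three-dimensional Brownian motion, hence a submartingale. In its Doob decomposition the martingale
  part is again controlled by the L2 norm, and the drift is increasing with mean a constant times
  sqrt t - sqrt s over [s,t], by Brownian scaling. Both bounds are instances of
  \<open>transform_integral_bound\<close>.

  For fixed u the drift costs about the integral of |g(s)| / sqrt(s - u) over s > u, which the
  weighted L1 norm does not control. Integrating over u in (0,T] removes the singularity, because
  sqrt s minus the root of the positive part of s - T is at most (T + sqrt T) / (1 + sqrt s). Let
  M_T be the mixture of the slices with respect to du on (0,T]. Then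
  \<open>step_integral_mixture_bound\<close> bounds the M_T-mean of |I(g)|, with I(g) the step
  integral, by C_T (sqrt x + x), where x is the squared L2 norm plus the weighted L1 norm of g.

  Existence: the integrals I(f_n) are therefore Cauchy in L1(M_T) for every T. Along indices where
  the approximation is fast they converge M_T-almost everywhere, and the pointwise limit Z does not
  mention T; Fatou gives I(f_n) -> Z in each L1(M_T). If A has finite measure, the part of A with
  gluing time outside [r,1/r] has small measure for small r, while inside the density 1 / sqrt(2 pi
  u) is bounded and Markov's inequality applies. This is \<open>L1_imp_locally_in_measure\<close>.

  Uniqueness: two approximating sequences have integrals whose difference tends to 0 in every
  L1(M_T), so their limits agree almost everywhere on each set of finite measure. To conclude,
  countably many such sets must exhaust the space. The sets \<open>escaping N\<close>, where |x(n)|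
  >= n^(1/7) for all n >= N, do this. Their measure is finite because a bridge of length u is rarely
  that large within distance 1 of its end point; they exhaust the space because the
  three-dimensional Bessel process escapes to infinity fast enough for Borel-Cantelli.\<close>

section \<open>Independence of two variables with different value spaces\<close>

text \<open>Unlike \<open>prob_space.indep_var\<close>, this allows the two variables to have different types.\<close>
definition indep_pair ::
    "'a measure \<Rightarrow> 'b measure \<Rightarrow> ('a \<Rightarrow> 'b) \<Rightarrow> 'c measure \<Rightarrow> ('a \<Rightarrow> 'c) \<Rightarrow> bool" where
  "indep_pair M S X T Y \<longleftrightarrow> X \<in> M \<rightarrow>\<^sub>M S \<and> Y \<in> M \<rightarrow>\<^sub>M T \<and>
     distr M S X \<Otimes>\<^sub>M distr M T Y = distr M (S \<Otimes>\<^sub>M T) (\<lambda>x. (X x, Y x))"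

lemma indep_pair_compose:
  assumes "prob_space M" and ind: "indep_pair M S X T Y"
    and [measurable]: "f \<in> S \<rightarrow>\<^sub>M S'" "g \<in> T \<rightarrow>\<^sub>M T'"
  shows "indep_pair M S' (\<lambda>\<omega>. f (X \<omega>)) T' (\<lambda>\<omega>. g (Y \<omega>))"
proof -
  interpret prob_space M by fact
  have [measurable]: "X \<in> M \<rightarrow>\<^sub>M S" "Y \<in> M \<rightarrow>\<^sub>M T"
    and eq: "distr M S X \<Otimes>\<^sub>M distr M T Y = distr M (S \<Otimes>\<^sub>M T) (\<lambda>x. (X x, Y x))"
    using ind by (auto simp: indep_pair_def)
  interpret Y: prob_space "distr M T Y" by (rule prob_space_distr) simp
  interpret gY: prob_space "distr (distr M T Y) T' g" by (rule Y.prob_space_distr) simp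
  have "distr M S' (\<lambda>\<omega>. f (X \<omega>)) \<Otimes>\<^sub>M distr M T' (\<lambda>\<omega>. g (Y \<omega>)) =
      distr (distr M S X) S' f \<Otimes>\<^sub>M distr (distr M T Y) T' g"
    by (simp add: distr_distr comp_def)
  also have "\<dots> = distr (distr M S X \<Otimes>\<^sub>M distr M T Y) (S' \<Otimes>\<^sub>M T') (\<lambda>(x, y). (f x, g y))"
    by (rule pair_measure_distr) (simp_all add: gY.sigma_finite_measure_axioms)
  also have "\<dots> = distr M (S' \<Otimes>\<^sub>M T') (\<lambda>\<omega>. (f (X \<omega>), g (Y \<omega>)))"
    unfolding eq by (subst distr_distr) (simp_all add: comp_def)
  finally show ?thesis by (simp add: indep_pair_def)
qed

text \<open>Decoupling by Fubini: the joint law is a product, so the second variable may be replaced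
  by an independent copy, written as a second integral over \<open>M\<close>. This plays the part of
  conditioning on the first variable.\<close>

lemma (in prob_space) indep_pair_nn_integral_pair:
  assumes "indep_pair M S X T Y" and h: "h \<in> borel_measurable (S \<Otimes>\<^sub>M T)"
  shows "(\<integral>\<^sup>+\<omega>. h (X \<omega>, Y \<omega>) \<partial>M) = (\<integral>\<^sup>+\<omega>. \<integral>\<^sup>+\<omega>'. h (X \<omega>, Y \<omega>') \<partial>M \<partial>M)"
proof -
  have [measurable]: "X \<in> M \<rightarrow>\<^sub>M S" "Y \<in> M \<rightarrow>\<^sub>M T"
    and eq: "distr M S X \<Otimes>\<^sub>M distr M T Y = distr M (S \<Otimes>\<^sub>M T) (\<lambda>x. (X x, Y x))"
    using assms(1) by (auto simp: indep_pair_def)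
  interpret Y: prob_space "distr M T Y" by (rule prob_space_distr) simp
  note h[measurable]
  have "(\<integral>\<^sup>+\<omega>. h (X \<omega>, Y \<omega>) \<partial>M) = (\<integral>\<^sup>+p. h p \<partial>(distr M S X \<Otimes>\<^sub>M distr M T Y))"
    unfolding eq by (simp add: nn_integral_distr)
  also have "\<dots> = (\<integral>\<^sup>+x. \<integral>\<^sup>+y. h (x, y) \<partial>distr M T Y \<partial>distr M S X)"
    by (rule Y.nn_integral_fst[symmetric]) (simp cong: measurable_cong_sets)
  also have "\<dots> = (\<integral>\<^sup>+\<omega>. \<integral>\<^sup>+y. h (X \<omega>, y) \<partial>distr M T Y \<partial>M)"
    by (subst nn_integral_distr) auto
  also have "\<dots> = (\<integral>\<^sup>+\<omega>. \<integral>\<^sup>+\<omega>'. h (X \<omega>, Y \<omega>') \<partial>M \<partial>M)"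
  proof (rule nn_integral_cong)
    fix \<omega> assume [simp]: "\<omega> \<in> space M"
    have [measurable]: "X \<omega> \<in> space S" using measurable_space[of X M S] by simp
    show "(\<integral>\<^sup>+y. h (X \<omega>, y) \<partial>distr M T Y) = (\<integral>\<^sup>+\<omega>'. h (X \<omega>, Y \<omega>') \<partial>M)"
      by (rule nn_integral_distr) measurable
  qed
  finally show ?thesis .
qed

lemma (in prob_space) indep_pair_integral_pair:
  fixes h :: "_ \<Rightarrow> real"
  assumes "indep_pair M S X T Y" and h: "h \<in> borel_measurable (S \<Otimes>\<^sub>M T)"
    and int: "integrable M (\<lambda>\<omega>. h (X \<omega>, Y \<omega>))"
  shows "(\<integral>\<omega>. h (X \<omega>, Y \<omega>) \<partial>M) = (\<integral>\<omega>. \<integral>\<omega>'. h (X \<omega>, Y \<omega>') \<partial>M \<partial>M)"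
proof -
  have [measurable]: "X \<in> M \<rightarrow>\<^sub>M S" "Y \<in> M \<rightarrow>\<^sub>M T"
    and eq: "distr M S X \<Otimes>\<^sub>M distr M T Y = distr M (S \<Otimes>\<^sub>M T) (\<lambda>x. (X x, Y x))"
    using assms(1) by (auto simp: indep_pair_def)
  interpret X: prob_space "distr M S X" by (rule prob_space_distr) simp
  interpret Y: prob_space "distr M T Y" by (rule prob_space_distr) simp
  interpret XY: pair_prob_space "distr M S X" "distr M T Y" ..
  note h[measurable]
  have "(\<integral>\<omega>. h (X \<omega>, Y \<omega>) \<partial>M) = (\<integral>p. h p \<partial>(distr M S X \<Otimes>\<^sub>M distr M T Y))"
    unfolding eq by (simp add: integral_distr)
  also have "\<dots> = (\<integral>x. \<integral>y. h (x, y) \<partial>distr M T Y \<partial>distr M S X)"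
    using int by (intro XY.integral_fst'[symmetric]) (simp add: eq integrable_distr_eq)
  also have "\<dots> = (\<integral>\<omega>. \<integral>y. h (X \<omega>, y) \<partial>distr M T Y \<partial>M)"
    by (subst integral_distr) auto
  also have "\<dots> = (\<integral>\<omega>. \<integral>\<omega>'. h (X \<omega>, Y \<omega>') \<partial>M \<partial>M)"
  proof (rule Bochner_Integration.integral_cong)
    fix \<omega> assume [simp]: "\<omega> \<in> space M"
    have [measurable]: "X \<omega> \<in> space S" using measurable_space[of X M S] by simp
    show "(\<integral>y. h (X \<omega>, y) \<partial>distr M T Y) = (\<integral>\<omega>'. h (X \<omega>, Y \<omega>') \<partial>M)"
      by (rule integral_distr) measurable
  qed simp
  finally show ?thesis .
qed

lemma emeasure_distr_pair_measure:
  assumes "sigma_finite_measure M2"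
    and [measurable]: "h \<in> M1 \<Otimes>\<^sub>M M2 \<rightarrow>\<^sub>M N" "E \<in> sets N"
  shows "emeasure (distr (M1 \<Otimes>\<^sub>M M2) N h) E = (\<integral>\<^sup>+a. \<integral>\<^sup>+b. indicator E (h (a, b)) \<partial>M2 \<partial>M1)"
proof -
  interpret M2: sigma_finite_measure M2 by fact
  have "emeasure (distr (M1 \<Otimes>\<^sub>M M2) N h) E = (\<integral>\<^sup>+x. indicator E x \<partial>distr (M1 \<Otimes>\<^sub>M M2) N h)" by simp
  also have "\<dots> = (\<integral>\<^sup>+p. indicator E (h p) \<partial>(M1 \<Otimes>\<^sub>M M2))" by (rule nn_integral_distr) simp_all
  also have "\<dots> = (\<integral>\<^sup>+a. \<integral>\<^sup>+b. indicator E (h (a, b)) \<partial>M2 \<partial>M1)"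
    by (rule M2.nn_integral_fst[symmetric]) simp
  finally show ?thesis .
qed

text \<open>Carries independence of scalar Brownian increments over to three-dimensional ones. It
  suffices to compare the two measures on rectangles: with the first coordinate fixed, independence
  in \<open>M2\<close> splits the inner integral into \<open>F\<close> times \<open>G\<close>, and
  independence in \<open>M1\<close> then splits the outer one.\<close>

lemma indep_pair_pair_measure:
  assumes "prob_space M1" "prob_space M2"
    and i1: "indep_pair M1 S1 X1 T1 Y1" and i2: "indep_pair M2 S2 X2 T2 Y2"
  shows "indep_pair (M1 \<Otimes>\<^sub>M M2) (S1 \<Otimes>\<^sub>M S2) (\<lambda>\<omega>. (X1 (fst \<omega>), X2 (snd \<omega>)))
     (T1 \<Otimes>\<^sub>M T2) (\<lambda>\<omega>. (Y1 (fst \<omega>), Y2 (snd \<omega>)))"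
proof -
  interpret M1: prob_space M1 by fact
  interpret M2: prob_space M2 by fact
  interpret P: pair_prob_space M1 M2 ..
  have [measurable]: "X1 \<in> M1 \<rightarrow>\<^sub>M S1" "Y1 \<in> M1 \<rightarrow>\<^sub>M T1" "X2 \<in> M2 \<rightarrow>\<^sub>M S2" "Y2 \<in> M2 \<rightarrow>\<^sub>M T2"
    using i1 i2 by (auto simp: indep_pair_def)
  let ?P = "M1 \<Otimes>\<^sub>M M2"
  let ?X = "\<lambda>\<omega>. (X1 (fst \<omega>), X2 (snd \<omega>))" and ?Y = "\<lambda>\<omega>. (Y1 (fst \<omega>), Y2 (snd \<omega>))"
  interpret X: prob_space "distr ?P (S1 \<Otimes>\<^sub>M S2) ?X" by (rule P.prob_space_distr) simp
  interpret Y: prob_space "distr ?P (T1 \<Otimes>\<^sub>M T2) ?Y" by (rule P.prob_space_distr) simp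
  have "distr ?P (S1 \<Otimes>\<^sub>M S2) ?X \<Otimes>\<^sub>M distr ?P (T1 \<Otimes>\<^sub>M T2) ?Y =
      distr ?P ((S1 \<Otimes>\<^sub>M S2) \<Otimes>\<^sub>M (T1 \<Otimes>\<^sub>M T2)) (\<lambda>x. (?X x, ?Y x))"
  proof (rule pair_measure_eqI)
    fix A C assume "A \<in> sets (distr ?P (S1 \<Otimes>\<^sub>M S2) ?X)" "C \<in> sets (distr ?P (T1 \<Otimes>\<^sub>M T2) ?Y)"
    then have [measurable]: "A \<in> sets (S1 \<Otimes>\<^sub>M S2)" "C \<in> sets (T1 \<Otimes>\<^sub>M T2)" by auto
    define F where "F x = (\<integral>\<^sup>+b. indicator A (x, X2 b) \<partial>M2 :: ennreal)" for x
    define G where "G y = (\<integral>\<^sup>+b. indicator C (y, Y2 b) \<partial>M2 :: ennreal)" for y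
    have [measurable]: "F \<in> borel_measurable S1" "G \<in> borel_measurable T1"
      unfolding F_def G_def by measurable
    have A: "emeasure (distr ?P (S1 \<Otimes>\<^sub>M S2) ?X) A = (\<integral>\<^sup>+a. F (X1 a) \<partial>M1)"
      unfolding F_def by (subst emeasure_distr_pair_measure[OF M2.sigma_finite_measure_axioms]) simp_all
    have C: "emeasure (distr ?P (T1 \<Otimes>\<^sub>M T2) ?Y) C = (\<integral>\<^sup>+a. G (Y1 a) \<partial>M1)"
      unfolding G_def by (subst emeasure_distr_pair_measure[OF M2.sigma_finite_measure_axioms]) simp_all
    have "emeasure (distr ?P ((S1 \<Otimes>\<^sub>M S2) \<Otimes>\<^sub>M (T1 \<Otimes>\<^sub>M T2)) (\<lambda>x. (?X x, ?Y x))) (A \<times> C) =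
        (\<integral>\<^sup>+a. \<integral>\<^sup>+b. indicator A (X1 a, X2 b) * indicator C (Y1 a, Y2 b) \<partial>M2 \<partial>M1)"
      by (subst emeasure_distr_pair_measure[OF M2.sigma_finite_measure_axioms]) (simp_all add: indicator_times)
    also have "\<dots> = (\<integral>\<^sup>+a. F (X1 a) * G (Y1 a) \<partial>M1)"
    proof (rule nn_integral_cong)
      fix a assume [simp]: "a \<in> space M1"
      have [measurable]: "X1 a \<in> space S1" "Y1 a \<in> space T1"
        using measurable_space[of X1 M1 S1] measurable_space[of Y1 M1 T1] by simp_all
      have "(\<integral>\<^sup>+b. indicator A (X1 a, X2 b) * indicator C (Y1 a, Y2 b) \<partial>M2) =
         (\<integral>\<^sup>+b. \<integral>\<^sup>+b'. indicator A (X1 a, X2 b) * indicator C (Y1 a, Y2 b') \<partial>M2 \<partial>M2 :: ennreal)"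
        using M2.indep_pair_nn_integral_pair[OF i2,
            of "\<lambda>p. indicator A (X1 a, fst p) * indicator C (Y1 a, snd p)"] by simp
      also have "\<dots> = F (X1 a) * G (Y1 a)"
        unfolding F_def G_def by (simp add: nn_integral_cmult nn_integral_multc)
      finally show "(\<integral>\<^sup>+b. indicator A (X1 a, X2 b) * indicator C (Y1 a, Y2 b) \<partial>M2) = F (X1 a) * G (Y1 a)" .
    qed
    also have "\<dots> = (\<integral>\<^sup>+a. \<integral>\<^sup>+a'. F (X1 a) * G (Y1 a') \<partial>M1 \<partial>M1)"
      using M1.indep_pair_nn_integral_pair[OF i1, of "\<lambda>p. F (fst p) * G (snd p)"] by simp
    also have "\<dots> = (\<integral>\<^sup>+a. F (X1 a) \<partial>M1) * (\<integral>\<^sup>+a. G (Y1 a) \<partial>M1)"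
      by (simp add: nn_integral_cmult nn_integral_multc)
    finally show "emeasure (distr ?P (S1 \<Otimes>\<^sub>M S2) ?X) A * emeasure (distr ?P (T1 \<Otimes>\<^sub>M T2) ?Y) C =
        emeasure (distr ?P ((S1 \<Otimes>\<^sub>M S2) \<Otimes>\<^sub>M (T1 \<Otimes>\<^sub>M T2)) (\<lambda>x. (?X x, ?Y x))) (A \<times> C)"
      using A C by simp
  qed (auto intro: X.sigma_finite_measure_axioms Y.sigma_finite_measure_axioms)
  then show ?thesis
    unfolding indep_pair_def by simp
qed


section \<open>First moments of transforms of Lipschitz functions of random walks\<close>

lemma (in prob_space) expectation_power2_le:
  fixes f :: "'a \<Rightarrow> real"
  assumes "f \<in> borel_measurable M" "integrable M (\<lambda>\<omega>. (f \<omega>)\<^sup>2)"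
  shows "integrable M f" "(expectation f)\<^sup>2 \<le> expectation (\<lambda>\<omega>. (f \<omega>)\<^sup>2)"
proof -
  show 1: "integrable M f" using assms by (rule square_integrable_imp_integrable)
  have "0 \<le> variance f" by (rule variance_positive)
  then show "(expectation f)\<^sup>2 \<le> expectation (\<lambda>\<omega>. (f \<omega>)\<^sup>2)"
    using variance_eq[OF 1 assms(2)] by simp
qed

text \<open>Doob decomposition of the submartingale \<open>V (X k)\<close>. The transform of the
  martingale part is bounded in L2, since its summands are orthogonal; the drift is nonnegative, so
  the transform of the drift is bounded in absolute value by the one with coefficients |c k|, whose
  mean is a sum of differences of the means of \<open>V (X k)\<close>. Used with \<open>V\<close>
  the identity for Brownian motion and \<open>V\<close> the norm for the Bessel process.\<close>

lemma (in prob_space) transform_integral_bound: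
  fixes \<xi> :: "nat \<Rightarrow> 'a \<Rightarrow> 'e::euclidean_space" and V :: "'e \<Rightarrow> real" and c :: "nat \<Rightarrow> real"
  defines "X \<equiv> \<lambda>k \<omega>. \<Sum>i<k. \<xi> i \<omega>"
  assumes indep: "\<And>k. k < n \<Longrightarrow>
      indep_pair M (\<Pi>\<^sub>M i\<in>{..<k}. borel) (\<lambda>\<omega>. \<lambda>i\<in>{..<k}. \<xi> i \<omega>) borel (\<xi> k)"
    and sq: "\<And>k. k < n \<Longrightarrow> integrable M (\<lambda>\<omega>. (norm (\<xi> k \<omega>))\<^sup>2)"
    and lip: "\<And>x y. \<bar>V x - V y\<bar> \<le> norm (x - y)"
    and drift: "\<And>k x. k < n \<Longrightarrow> 0 \<le> expectation (\<lambda>\<omega>. V (x + \<xi> k \<omega>) - V x)"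
  shows "integrable M (\<lambda>\<omega>. \<Sum>k<n. c k * (V (X (Suc k) \<omega>) - V (X k \<omega>)))"
    and "expectation (\<lambda>\<omega>. \<bar>\<Sum>k<n. c k * (V (X (Suc k) \<omega>) - V (X k \<omega>))\<bar>) \<le>
       2 * sqrt (\<Sum>k<n. (c k)\<^sup>2 * expectation (\<lambda>\<omega>. (norm (\<xi> k \<omega>))\<^sup>2)) +
       (\<Sum>k<n. \<bar>c k\<bar> * (expectation (\<lambda>\<omega>. V (X (Suc k) \<omega>)) - expectation (\<lambda>\<omega>. V (X k \<omega>))))"
proof -
  have rv: "\<xi> k \<in> borel_measurable M" if "k < n" for k
    using indep[OF that] unfolding indep_pair_def by blast
  have "continuous_on UNIV V"
    using lip by (intro lipschitz_on_continuous_on[of 1]) (auto simp: lipschitz_on_def dist_norm)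
  then have V[measurable]: "V \<in> borel_measurable borel"
    by (rule borel_measurable_continuous_onI)
  have X: "X k \<in> borel_measurable M" if "k \<le> n" for k
    unfolding X_def using that by (intro borel_measurable_sum rv) auto
  define e where "e k = expectation (\<lambda>\<omega>. norm (\<xi> k \<omega>))" for k
  \<comment> \<open>\<open>D k x\<close> is the mean increment of \<open>V\<close> when step
    \<open>k\<close> starts at \<open>x\<close>; subtracting it at the current position makes
    \<open>d k\<close> a martingale difference.\<close>
  define D where "D k x = expectation (\<lambda>\<omega>. V (x + \<xi> k \<omega>) - V x)" for k x
  define d where "d k \<omega> = V (X (Suc k) \<omega>) - V (X k \<omega>) - D k (X k \<omega>)" for k \<omega>
  have norm_int: "integrable M (\<lambda>\<omega>. norm (\<xi> k \<omega>))" if "k < n" for k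
    by (rule expectation_power2_le(1)) (use rv[OF that] sq[OF that] in simp_all)
  have e2: "(e k)\<^sup>2 \<le> expectation (\<lambda>\<omega>. (norm (\<xi> k \<omega>))\<^sup>2)" if "k < n" for k
    unfolding e_def by (rule expectation_power2_le(2)) (use rv[OF that] sq[OF that] in simp_all)
  have inner_int: "integrable M (\<lambda>\<omega>. V (x + \<xi> k \<omega>) - V x)" if "k < n" for k x
  proof (rule Bochner_Integration.integrable_bound[OF norm_int[OF that]])
    show "AE \<omega> in M. norm (V (x + \<xi> k \<omega>) - V x) \<le> norm (norm (\<xi> k \<omega>))"
      using lip[of "x + \<xi> k _" x] by auto
  qed (use rv[OF that] in measurable)
  have D_bound: "\<bar>D k x\<bar> \<le> e k" if "k < n" for k x
  proof -
    have "\<bar>D k x\<bar> \<le> expectation (\<lambda>\<omega>. \<bar>V (x + \<xi> k \<omega>) - V x\<bar>)"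
      unfolding D_def by (rule integral_abs_bound)
    also have "\<dots> \<le> e k" unfolding e_def
      using norm_int[OF that] inner_int[OF that] lip[of "x + \<xi> k _" x] by (intro integral_mono) auto
    finally show ?thesis .
  qed
  have D_meas: "D k \<in> borel_measurable borel" if "k < n" for k
    unfolding D_def using rv[OF that] by measurable
  have X_Suc: "X (Suc k) \<omega> = X k \<omega> + \<xi> k \<omega>" for k \<omega> by (simp add: X_def)
  have d_meas: "d k \<in> borel_measurable M" if "k < n" for k
    unfolding d_def using that X[of k] X[of "Suc k"] D_meas[OF that] by simp
  have d_bound: "\<bar>d k \<omega>\<bar> \<le> norm (\<xi> k \<omega>) + e k" if "k < n" for k \<omega>
    using lip[of "X (Suc k) \<omega>" "X k \<omega>"] D_bound[OF that, of "X k \<omega>"] by (simp add: d_def X_Suc)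
  have d_sq_bound: "(d k \<omega>)\<^sup>2 \<le> 2 * (norm (\<xi> k \<omega>))\<^sup>2 + 2 * (e k)\<^sup>2" if "k < n" for k \<omega>
  proof -
    have "(d k \<omega>)\<^sup>2 \<le> (norm (\<xi> k \<omega>) + e k)\<^sup>2"
      using d_bound[OF that, of \<omega>] by (metis abs_ge_zero power2_abs power_mono)
    also have "\<dots> \<le> 2 * (norm (\<xi> k \<omega>))\<^sup>2 + 2 * (e k)\<^sup>2"
      using sum_squares_bound[of "norm (\<xi> k \<omega>)" "e k"] by (simp add: power2_sum)
    finally show ?thesis .
  qed
  have d_sq: "integrable M (\<lambda>\<omega>. (d k \<omega>)\<^sup>2)" if "k < n" for k
  proof (rule Bochner_Integration.integrable_bound)
    show "integrable M (\<lambda>\<omega>. 2 * (norm (\<xi> k \<omega>))\<^sup>2 + 2 * (e k)\<^sup>2)" using sq[OF that] by simp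
    show "AE \<omega> in M. norm ((d k \<omega>)\<^sup>2) \<le> norm (2 * (norm (\<xi> k \<omega>))\<^sup>2 + 2 * (e k)\<^sup>2)"
      using d_sq_bound[OF that] by auto
  qed (use d_meas[OF that] in measurable)
  \<comment> \<open>The factor 4 comes from (a + b)^2 <= 2 a^2 + 2 b^2 and Jensen's inequality for
    the mean \<open>e k\<close>.\<close>
  have d_var: "expectation (\<lambda>\<omega>. (d k \<omega>)\<^sup>2) \<le> 4 * expectation (\<lambda>\<omega>. (norm (\<xi> k \<omega>))\<^sup>2)" if "k < n" for k
  proof -
    have "expectation (\<lambda>\<omega>. (d k \<omega>)\<^sup>2) \<le> expectation (\<lambda>\<omega>. 2 * (norm (\<xi> k \<omega>))\<^sup>2 + 2 * (e k)\<^sup>2)"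
      using sq[OF that] d_sq[OF that] d_sq_bound[OF that] by (intro integral_mono) auto
    also have "\<dots> = 2 * expectation (\<lambda>\<omega>. (norm (\<xi> k \<omega>))\<^sup>2) + 2 * (e k)\<^sup>2"
      using sq[OF that] by (simp add: prob_space)
    finally show ?thesis using e2[OF that] by simp
  qed
  have d_int: "integrable M (d k)" if "k < n" for k
    using d_meas[OF that] d_sq[OF that] by (rule expectation_power2_le)
  \<comment> \<open>The martingale property: \<open>d k\<close> is orthogonal to every function
    \<open>s\<close> of the earlier increments. After decoupling, the inner integral for a frozen
    past is \<open>D k\<close> minus itself.\<close>
  have zero: "expectation (\<lambda>\<omega>. s (\<lambda>i\<in>{..<k}. \<xi> i \<omega>) * d k \<omega>) = 0"
    if k: "k < n" and s: "s \<in> borel_measurable (\<Pi>\<^sub>M i\<in>{..<k}. borel)"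
      and int: "integrable M (\<lambda>\<omega>. s (\<lambda>i\<in>{..<k}. \<xi> i \<omega>) * d k \<omega>)" for k s
  proof -
    define x where "x p = (\<Sum>i<k. p i)" for p :: "nat \<Rightarrow> 'e"
    have [measurable]: "x \<in> borel_measurable (\<Pi>\<^sub>M i\<in>{..<k}. borel)" unfolding x_def by measurable
    have x: "x (\<lambda>i\<in>{..<k}. \<xi> i \<omega>) = X k \<omega>" for \<omega> by (simp add: x_def X_def)
    define h where "h q = s (fst q) * (V (x (fst q) + snd q) - V (x (fst q)) - D k (x (fst q)))" for q
    have h: "h (\<lambda>i\<in>{..<k}. \<xi> i \<omega>, \<xi> k \<omega>') =
        s (\<lambda>i\<in>{..<k}. \<xi> i \<omega>) * (V (X k \<omega> + \<xi> k \<omega>') - V (X k \<omega>) - D k (X k \<omega>))" for \<omega> \<omega>'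
      by (simp add: h_def x)
    have meas: "h \<in> borel_measurable ((\<Pi>\<^sub>M i\<in>{..<k}. borel) \<Otimes>\<^sub>M borel)"
      unfolding h_def using s D_meas[OF k] by measurable
    have hd: "h (\<lambda>i\<in>{..<k}. \<xi> i \<omega>, \<xi> k \<omega>) = s (\<lambda>i\<in>{..<k}. \<xi> i \<omega>) * d k \<omega>" for \<omega>
      by (simp add: h d_def X_Suc)
    have "expectation (\<lambda>\<omega>. s (\<lambda>i\<in>{..<k}. \<xi> i \<omega>) * d k \<omega>) =
        (\<integral>\<omega>. \<integral>\<omega>'. h (\<lambda>i\<in>{..<k}. \<xi> i \<omega>, \<xi> k \<omega>') \<partial>M \<partial>M)"
      using indep_pair_integral_pair[OF indep[OF k] meas] int by (simp add: hd)
    also have "\<dots> = (\<integral>\<omega>. s (\<lambda>i\<in>{..<k}. \<xi> i \<omega>) * 0 \<partial>M)"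
      unfolding h using inner_int[OF k] 
      by (intro Bochner_Integration.integral_cong refl) (simp add: prob_space D_def[symmetric])
    finally show ?thesis by simp
  qed
  define S where "S m \<omega> = (\<Sum>k<m. c k * d k \<omega>)" for m \<omega>
  have S_meas: "S m \<in> borel_measurable M" if "m \<le> n" for m
    unfolding S_def using that by (intro borel_measurable_sum borel_measurable_times d_meas) auto
  have S_sq: "integrable M (\<lambda>\<omega>. (S m \<omega>)\<^sup>2) \<and>
      expectation (\<lambda>\<omega>. (S m \<omega>)\<^sup>2) \<le> 4 * (\<Sum>k<m. (c k)\<^sup>2 * expectation (\<lambda>\<omega>. (norm (\<xi> k \<omega>))\<^sup>2))"
    if "m \<le> n" for m
    using that
  proof (induction m)
    case (Suc m)
    then have m: "m < n" and IH: "integrable M (\<lambda>\<omega>. (S m \<omega>)\<^sup>2)"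
      "expectation (\<lambda>\<omega>. (S m \<omega>)\<^sup>2) \<le> 4 * (\<Sum>k<m. (c k)\<^sup>2 * expectation (\<lambda>\<omega>. (norm (\<xi> k \<omega>))\<^sup>2))"
      by auto
    have cross: "integrable M (\<lambda>\<omega>. S m \<omega> * d m \<omega>)"
    proof (rule Bochner_Integration.integrable_bound)
      show "integrable M (\<lambda>\<omega>. (S m \<omega>)\<^sup>2 + (d m \<omega>)\<^sup>2)" using IH d_sq[OF m] by simp
      show "AE \<omega> in M. norm (S m \<omega> * d m \<omega>) \<le> norm ((S m \<omega>)\<^sup>2 + (d m \<omega>)\<^sup>2)"
      proof (rule AE_I2)
        fix \<omega>
        have "2 * (\<bar>S m \<omega>\<bar> * \<bar>d m \<omega>\<bar>) \<le> (S m \<omega>)\<^sup>2 + (d m \<omega>)\<^sup>2"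
          using sum_squares_bound[of "\<bar>S m \<omega>\<bar>" "\<bar>d m \<omega>\<bar>"] by (simp add: mult.assoc)
        moreover have "0 \<le> \<bar>S m \<omega>\<bar> * \<bar>d m \<omega>\<bar>" by simp
        ultimately have "\<bar>S m \<omega>\<bar> * \<bar>d m \<omega>\<bar> \<le> (S m \<omega>)\<^sup>2 + (d m \<omega>)\<^sup>2" by linarith
        then show "norm (S m \<omega> * d m \<omega>) \<le> norm ((S m \<omega>)\<^sup>2 + (d m \<omega>)\<^sup>2)"
          by (simp add: abs_mult)
      qed
    qed (use d_meas[OF m] S_meas m in auto)
    \<comment> \<open>\<open>S m\<close> has to be exhibited as a function of the first
      \<open>m\<close> increments alone before \<open>zero\<close> can remove the cross
      term.\<close>
    define s where "s p = (\<Sum>k<m. c k * (V (\<Sum>i<Suc k. p i) - V (\<Sum>i<k. p i) - D k (\<Sum>i<k. p i)))"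
      for p :: "nat \<Rightarrow> 'e"
    have s: "s (\<lambda>i\<in>{..<m}. \<xi> i \<omega>) = S m \<omega>" for \<omega>
      unfolding s_def S_def d_def X_def
      by (intro sum.cong refl arg_cong2[where f = "(*)"] arg_cong2[where f = "(-)"] arg_cong[where f = V]
          arg_cong[where f = "D _"]) auto
    have "expectation (\<lambda>\<omega>. S m \<omega> * d m \<omega>) = 0"
      unfolding s[symmetric]
    proof (rule zero[OF m])
      show "s \<in> borel_measurable (\<Pi>\<^sub>M i\<in>{..<m}. borel)"
        unfolding s_def
      proof (intro borel_measurable_sum borel_measurable_times borel_measurable_const borel_measurable_diff)
        fix k assume "k \<in> {..<m}"
        then have k: "k < m" "k < n" using m by auto
        have [measurable]: "(\<lambda>p. \<Sum>i<Suc k. p i) \<in> borel_measurable (\<Pi>\<^sub>M i\<in>{..<m}. borel :: 'e measure)"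
            "(\<lambda>p. \<Sum>i<k. p i) \<in> borel_measurable (\<Pi>\<^sub>M i\<in>{..<m}. borel :: 'e measure)"
          using k by (auto intro!: borel_measurable_sum measurable_component_singleton)
        note D_meas[OF k(2), measurable]
        show "(\<lambda>p. V (\<Sum>i<Suc k. p i)) \<in> borel_measurable (\<Pi>\<^sub>M i\<in>{..<m}. borel)"
          "(\<lambda>p. V (\<Sum>i<k. p i)) \<in> borel_measurable (\<Pi>\<^sub>M i\<in>{..<m}. borel)"
          "(\<lambda>p. D k (\<Sum>i<k. p i)) \<in> borel_measurable (\<Pi>\<^sub>M i\<in>{..<m}. borel)"
          by (rule measurable_compose[OF _ V] measurable_compose[OF _ D_meas[OF k(2)]], measurable)+
      qed
      show "integrable M (\<lambda>\<omega>. s (\<lambda>i\<in>{..<m}. \<xi> i \<omega>) * d m \<omega>)" using cross by (simp only: s)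
    qed
    moreover have "(S (Suc m) \<omega>)\<^sup>2 = (S m \<omega>)\<^sup>2 + 2 * c m * (S m \<omega> * d m \<omega>) + (c m)\<^sup>2 * (d m \<omega>)\<^sup>2" for \<omega>
      by (simp add: S_def power2_sum power_mult_distrib algebra_simps)
    moreover have "(c m)\<^sup>2 * expectation (\<lambda>\<omega>. (d m \<omega>)\<^sup>2) \<le> (c m)\<^sup>2 * (4 * expectation (\<lambda>\<omega>. (norm (\<xi> m \<omega>))\<^sup>2))"
      by (intro mult_left_mono d_var[OF m]) simp
    ultimately show ?case using IH cross d_sq[OF m] by simp
  qed (simp add: S_def)
  define Ds where "Ds \<omega> = (\<Sum>k<n. c k * D k (X k \<omega>))" for \<omega>
  have DX_meas: "(\<lambda>\<omega>. D k (X k \<omega>)) \<in> borel_measurable M" if "k < n" for k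
    using X[of k] D_meas[OF that] that by simp
  have DX_int: "integrable M (\<lambda>\<omega>. D k (X k \<omega>))" if "k < n" for k
    using DX_meas[OF that] D_bound[OF that]
    by (intro integrable_const_bound[where B = "e k"]) auto
  have V0: "integrable M (\<lambda>\<omega>. V (X k \<omega>))" if "k \<le> n" for k
  proof (rule Bochner_Integration.integrable_bound)
    show "integrable M (\<lambda>\<omega>. \<bar>V 0\<bar> + (\<Sum>i<k. norm (\<xi> i \<omega>)))"
      using norm_int that by (intro Bochner_Integration.integrable_add Bochner_Integration.integrable_sum) auto
    show "AE \<omega> in M. norm (V (X k \<omega>)) \<le> norm (\<bar>V 0\<bar> + (\<Sum>i<k. norm (\<xi> i \<omega>)))"
    proof (rule AE_I2)
      fix \<omega>
      have "\<bar>V (X k \<omega>)\<bar> \<le> \<bar>V 0\<bar> + norm (X k \<omega>)" using lip[of "X k \<omega>" 0] by simp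
      also have "\<dots> \<le> \<bar>V 0\<bar> + (\<Sum>i<k. norm (\<xi> i \<omega>))" unfolding X_def by (simp add: norm_sum)
      finally show "norm (V (X k \<omega>)) \<le> norm (\<bar>V 0\<bar> + (\<Sum>i<k. norm (\<xi> i \<omega>)))" by simp
    qed
  qed (use X[OF that] in measurable)
  have ED: "expectation (\<lambda>\<omega>. D k (X k \<omega>)) = expectation (\<lambda>\<omega>. V (X (Suc k) \<omega>)) - expectation (\<lambda>\<omega>. V (X k \<omega>))"
    if "k < n" for k
  proof -
    have "expectation (d k) = 0" using zero[OF that, of "\<lambda>_. 1"] d_int[OF that] by simp
    moreover have "expectation (d k) = expectation (\<lambda>\<omega>. V (X (Suc k) \<omega>)) - expectation (\<lambda>\<omega>. V (X k \<omega>))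
       - expectation (\<lambda>\<omega>. D k (X k \<omega>))"
      unfolding d_def using V0[of k] V0[of "Suc k"] DX_int[OF that] that by simp
    ultimately show ?thesis by simp
  qed
  have split: "(\<Sum>k<n. c k * (V (X (Suc k) \<omega>) - V (X k \<omega>))) = S n \<omega> + Ds \<omega>" for \<omega>
    by (simp add: S_def Ds_def d_def sum.distrib[symmetric] algebra_simps)
  have S_int: "integrable M (S n)"
    by (rule expectation_power2_le(1)) (use S_meas[of n] S_sq[of n] in simp_all)
  have Ds_int: "integrable M Ds"
    unfolding Ds_def using DX_int by (intro Bochner_Integration.integrable_sum integrable_mult_right) auto
  show "integrable M (\<lambda>\<omega>. \<Sum>k<n. c k * (V (X (Suc k) \<omega>) - V (X k \<omega>)))"
    unfolding split using S_int Ds_int by simp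
  have "expectation (\<lambda>\<omega>. \<bar>S n \<omega> + Ds \<omega>\<bar>) \<le> expectation (\<lambda>\<omega>. \<bar>S n \<omega>\<bar> + \<bar>Ds \<omega>\<bar>)"
    using S_int Ds_int by (intro integral_mono) auto
  also have "\<dots> = expectation (\<lambda>\<omega>. \<bar>S n \<omega>\<bar>) + expectation (\<lambda>\<omega>. \<bar>Ds \<omega>\<bar>)"
    using S_int Ds_int by simp
  also have "expectation (\<lambda>\<omega>. \<bar>S n \<omega>\<bar>) \<le> sqrt (expectation (\<lambda>\<omega>. (S n \<omega>)\<^sup>2))"
    using expectation_power2_le(2)[of "\<lambda>\<omega>. \<bar>S n \<omega>\<bar>"] S_meas S_sq[of n] by (intro real_le_rsqrt) auto
  also have "\<dots> \<le> sqrt (4 * (\<Sum>k<n. (c k)\<^sup>2 * expectation (\<lambda>\<omega>. (norm (\<xi> k \<omega>))\<^sup>2)))"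
    using S_sq[of n] by simp
  also have "\<dots> = 2 * sqrt (\<Sum>k<n. (c k)\<^sup>2 * expectation (\<lambda>\<omega>. (norm (\<xi> k \<omega>))\<^sup>2))"
    by (simp add: real_sqrt_mult)
  \<comment> \<open>Nonnegativity of the drift is what allows the absolute value to be moved onto
    the coefficients, so that no second moment of the drift enters.\<close>
  also have "expectation (\<lambda>\<omega>. \<bar>Ds \<omega>\<bar>) \<le> expectation (\<lambda>\<omega>. \<Sum>k<n. \<bar>c k\<bar> * D k (X k \<omega>))"
  proof (intro integral_mono)
    show "integrable M (\<lambda>\<omega>. \<Sum>k<n. \<bar>c k\<bar> * D k (X k \<omega>))"
      using DX_int by (intro Bochner_Integration.integrable_sum integrable_mult_right) auto
    show "\<bar>Ds \<omega>\<bar> \<le> (\<Sum>k<n. \<bar>c k\<bar> * D k (X k \<omega>))" for \<omega>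
      unfolding Ds_def using drift
      by (intro order_trans[OF sum_abs] sum_mono) (auto simp: abs_mult D_def)
  qed (use Ds_int in auto)
  also have "\<dots> = (\<Sum>k<n. \<bar>c k\<bar> * (expectation (\<lambda>\<omega>. V (X (Suc k) \<omega>)) - expectation (\<lambda>\<omega>. V (X k \<omega>))))"
    using DX_int ED by simp
  finally show "expectation (\<lambda>\<omega>. \<bar>\<Sum>k<n. c k * (V (X (Suc k) \<omega>) - V (X k \<omega>))\<bar>) \<le>
       2 * sqrt (\<Sum>k<n. (c k)\<^sup>2 * expectation (\<lambda>\<omega>. (norm (\<xi> k \<omega>))\<^sup>2)) +
       (\<Sum>k<n. \<bar>c k\<bar> * (expectation (\<lambda>\<omega>. V (X (Suc k) \<omega>)) - expectation (\<lambda>\<omega>. V (X k \<omega>))))"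
    unfolding split by simp
qed


section \<open>Partitions and step functions\<close>

text \<open>Cutting a grid at the gluing time, by min(t,u) or max(t - u, 0), makes nodes coincide,
  while independence of Brownian increments is available for strictly increasing times. The new grid
  serves all \<phi> and F at once, so the same replacement can be made in the path sum, in the sum
  of squares and in the drift sum.\<close>

lemma drop_trivial_increments:
  fixes \<tau> c :: "nat \<Rightarrow> real"
  assumes "\<And>k. k < n \<Longrightarrow> \<tau> k \<le> \<tau> (Suc k)"
  obtains n' \<tau>' c' where "\<tau>' 0 = \<tau> 0" "\<tau>' n' = \<tau> n" "\<And>k. k < n' \<Longrightarrow> \<tau>' k < \<tau>' (Suc k)"
    "\<And>\<phi> F :: real \<Rightarrow> real. (\<Sum>k<n. \<phi> (c k) * (F (\<tau> (Suc k)) - F (\<tau> k))) =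
       (\<Sum>k<n'. \<phi> (c' k) * (F (\<tau>' (Suc k)) - F (\<tau>' k)))"
proof -
  have "\<exists>n' \<tau>' c'. \<tau>' 0 = \<tau> 0 \<and> \<tau>' n' = \<tau> n \<and> (\<forall>k<n'. \<tau>' k < \<tau>' (Suc k)) \<and>
      (\<forall>\<phi> F :: real \<Rightarrow> real. (\<Sum>k<n. \<phi> (c k) * (F (\<tau> (Suc k)) - F (\<tau> k))) =
       (\<Sum>k<n'. \<phi> (c' k) * (F (\<tau>' (Suc k)) - F (\<tau>' k))))"
    using assms
  proof (induction n)
    case 0
    show ?case by (rule exI[of _ 0], rule exI[of _ \<tau>], rule exI[of _ c]) simp
  next
    case (Suc n)
    then obtain n' \<tau>' c' where IH: "\<tau>' 0 = \<tau> 0" "\<tau>' n' = \<tau> n" "\<forall>k<n'. \<tau>' k < \<tau>' (Suc k)"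
      "\<forall>\<phi> F :: real \<Rightarrow> real. (\<Sum>k<n. \<phi> (c k) * (F (\<tau> (Suc k)) - F (\<tau> k))) =
         (\<Sum>k<n'. \<phi> (c' k) * (F (\<tau>' (Suc k)) - F (\<tau>' k)))"
      by auto
    show ?case
    proof (cases "\<tau> (Suc n) = \<tau> n")
      case True
      show ?thesis
        by (rule exI[of _ n'], rule exI[of _ \<tau>'], rule exI[of _ c']) (use IH True in auto)
    next
      case False
      then have less: "\<tau> n < \<tau> (Suc n)" using Suc.prems[of n] by simp
      define \<tau>2 where "\<tau>2 = \<tau>'(Suc n' := \<tau> (Suc n))"
      define c2 where "c2 = c'(n' := c n)"
      have "(\<Sum>k<n'. \<phi> (c2 k) * (F (\<tau>2 (Suc k)) - F (\<tau>2 k))) =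
         (\<Sum>k<n'. \<phi> (c' k) * (F (\<tau>' (Suc k)) - F (\<tau>' k)))" for \<phi> F :: "real \<Rightarrow> real"
        by (intro sum.cong) (auto simp: \<tau>2_def c2_def)
      then show ?thesis
        by (intro exI[of _ "Suc n'"] exI[of _ \<tau>2] exI[of _ c2])
          (use IH less in \<open>auto simp: \<tau>2_def c2_def less_Suc_eq\<close>)
    qed
  qed
  then show ?thesis using that by blast
qed

lemma monotone_time_nonneg:
  fixes \<tau> :: "nat \<Rightarrow> real"
  assumes "0 \<le> \<tau> 0" "\<And>k. k < n \<Longrightarrow> \<tau> k \<le> \<tau> (Suc k)" "k \<le> n"
  shows "0 \<le> \<tau> k"
  using assms(3)
proof (induction k)
  case (Suc k)
  then show ?case using assms(2)[of k] by simp
qed (use assms in simp)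

lemma sum_sq_le_time_change:
  fixes t \<tau> c :: "nat \<Rightarrow> real"
  assumes "\<And>k. k < n \<Longrightarrow> \<tau> (Suc k) - \<tau> k \<le> t (Suc k) - t k"
  shows "(\<Sum>k<n. (c k)\<^sup>2 * (\<tau> (Suc k) - \<tau> k)) \<le> (\<Sum>k<n. (c k)\<^sup>2 * (t (Suc k) - t k))"
  using assms by (intro sum_mono mult_left_mono) auto

text \<open>Shifting the variable turns the integral over \<open>u\<close> into that of
  \<open>sqrt x - sqrt (x - T)\<^sup>+\<close> over \<open>[a, b]\<close>, so no antiderivative is needed.\<close>
lemma integral_sqrt_increment_le:
  fixes a b T :: real
  assumes ab: "0 \<le> a" "a \<le> b" and T: "0 \<le> T"
  shows "integral {0..T} (\<lambda>u. sqrt (max (b - u) 0) - sqrt (max (a - u) 0)) \<le>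
     (T + sqrt T) * integral {a..b} (\<lambda>x. 1 / (1 + sqrt x))"
proof -
  define \<phi> :: "real \<Rightarrow> real" where "\<phi> x = sqrt (max x 0)" for x
  have cont: "continuous_on S \<phi>" for S unfolding \<phi>_def by (intro continuous_intros)
  have int: "\<phi> integrable_on {p..q}" for p q by (rule integrable_continuous_real[OF cont])
  have cont': "continuous_on S (\<lambda>x. \<phi> (x - T))" "continuous_on S (\<lambda>u. \<phi> (q - u))" for S q
    unfolding \<phi>_def by (intro continuous_intros)+
  have refl: "integral {0..T} (\<lambda>u. \<phi> (q - u)) = integral {q - T..q} \<phi>" for q
  proof -
    have "(\<phi> has_integral integral {q - T..q} \<phi>) {q - T..q}" using int by (rule integrable_integral)
    then have "((\<lambda>x. \<phi> (x + q)) has_integral integral {q - T..q} \<phi>) {-T..0}"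
      using has_integral_shift_real_ivl[of \<phi> _ "q - T" q q] by simp
    then have "((\<lambda>x. \<phi> (- x + q)) has_integral integral {q - T..q} \<phi>) {0..T}"
      using has_integral_reflect_real[where f = "\<lambda>x. \<phi> (x + q)" and a = "-T" and b = 0] by simp
    then show ?thesis by (simp add: integral_unique)
  qed
  have shift: "integral {a - T..b - T} \<phi> = integral {a..b} (\<lambda>x. \<phi> (x - T))"
    using integral_shift_real_ivl[where a = "a - T" and b = "b - T" and c = "-T" and f = \<phi>] by simp
  have "integral {0..T} (\<lambda>u. \<phi> (b - u) - \<phi> (a - u)) = integral {b - T..b} \<phi> - integral {a - T..a} \<phi>"
    by (subst Henstock_Kurzweil_Integration.integral_diff)
      (auto intro!: integrable_continuous_real cont' simp: refl)
  also have "\<dots> = integral {a..b} \<phi> - integral {a - T..b - T} \<phi>"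
    using Henstock_Kurzweil_Integration.integral_combine[of "a - T" a b \<phi>]
      Henstock_Kurzweil_Integration.integral_combine[of "a - T" "b - T" b \<phi>] int T ab by simp
  also have "\<dots> = integral {a..b} (\<lambda>x. \<phi> x - \<phi> (x - T))"
    unfolding shift
    by (subst Henstock_Kurzweil_Integration.integral_diff) (auto intro!: integrable_continuous_real cont cont')
  also have "\<dots> \<le> integral {a..b} (\<lambda>x. (T + sqrt T) * (1 / (1 + sqrt x)))"
  proof (rule integral_le)
    show "(\<lambda>x. \<phi> x - \<phi> (x - T)) integrable_on {a..b}"
      by (intro integrable_continuous_real continuous_on_diff cont cont')
    show "(\<lambda>x. (T + sqrt T) * (1 / (1 + sqrt x))) integrable_on {a..b}"
    proof (intro integrable_continuous_real continuous_intros ballI)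
      fix x assume "x \<in> {a..b}"
      then have "0 \<le> sqrt x" using ab by simp
      then show "1 + sqrt x \<noteq> 0" by linarith
    qed
    fix x assume "x \<in> {a..b}"
    then have x: "0 \<le> x" using ab by simp
    then have pos: "0 < 1 + sqrt x" using real_sqrt_ge_zero[of x] by linarith
    \<comment> \<open>Of the factor 1 + sqrt x, the 1 contributes at most sqrt T and the sqrt x at
      most T. Beyond T, with p, q, r the roots of x, x - T and T, this reads p - q <= r and (p - q)
      p <= (p - q) (p + q) = r^2.\<close>
    have "(\<phi> x - \<phi> (x - T)) * (1 + sqrt x) \<le> T + sqrt T"
    proof (cases "x \<le> T")
      case True
      then have "\<phi> x - \<phi> (x - T) = sqrt x" using x by (simp add: \<phi>_def)
      moreover have "sqrt x * (1 + sqrt x) \<le> sqrt T + T"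
        using True x by (simp add: distrib_left add_mono)
      ultimately show ?thesis by simp
    next
      case False
      define p q r where "p = sqrt x" and "q = sqrt (x - T)" and "r = sqrt T"
      have pq: "p\<^sup>2 - q\<^sup>2 = r\<^sup>2" "0 \<le> q" "q \<le> p" "0 \<le> r" "r \<le> p" "T = r\<^sup>2"
        using False x T by (auto simp: p_def q_def r_def)
      have "\<phi> x - \<phi> (x - T) = p - q" using False x by (simp add: \<phi>_def p_def q_def)
      moreover have "(p - q) * (1 + p) \<le> r\<^sup>2 + r"
      proof -
        have "p - q \<le> r"
        proof (rule power2_le_imp_le)
          have "(p - q)\<^sup>2 \<le> (p - q) * (p + q)" using pq by (simp add: power2_eq_square mult_left_mono)
          also have "\<dots> = r\<^sup>2" using pq(1) by (simp add: power2_eq_square algebra_simps)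
          finally show "(p - q)\<^sup>2 \<le> r\<^sup>2" .
        qed (use pq in simp)
        moreover have "(p - q) * p \<le> (p - q) * (p + q)" using pq by (intro mult_left_mono) auto
        moreover have "(p - q) * (p + q) = r\<^sup>2" using pq(1) by (simp add: power2_eq_square algebra_simps)
        ultimately show ?thesis by (simp add: distrib_left)
      qed
      ultimately have "(\<phi> x - \<phi> (x - T)) * (1 + p) \<le> r\<^sup>2 + r" by simp
      then show ?thesis using T by (simp add: p_def r_def)
    qed
    then show "\<phi> x - \<phi> (x - T) \<le> (T + sqrt T) * (1 / (1 + sqrt x))"
      using pos by (simp add: pos_le_divide_eq)
  qed
  also have "\<dots> = (T + sqrt T) * integral {a..b} (\<lambda>x. 1 / (1 + sqrt x))"
    by (rule integral_mult_right)
  finally show ?thesis by (simp add: \<phi>_def)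
qed

section \<open>Common refinements, differences and norms of step functions\<close>

lemma step_rep_cover:
  assumes rep: "step_rep f m c t" and s: "0 \<le> s" "s < t m"
  obtains k where "k \<in> {1..m}" "t (k - 1) \<le> s" "s < t k"
proof -
  define k where "k = (LEAST k. s < t k)"
  have k: "s < t k" unfolding k_def using s(2) by (rule LeastI)
  have "k \<le> m" unfolding k_def using s(2) by (rule Least_le)
  moreover have "k \<noteq> 0"
  proof
    assume "k = 0"
    with k s(1) rep show False by (simp add: step_rep_def)
  qed
  moreover have "t (k - 1) \<le> s"
    using not_less_Least[of "k - 1" "\<lambda>k. s < t k"] \<open>k \<noteq> 0\<close> by (fold k_def) (simp add: not_less)
  ultimately show ?thesis using k by (intro that[of k]) auto
qed

text \<open>No old node lies strictly between two consecutive new ones, so \<open>f\<close> is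
  constant on each new interval and its value can be read off at the left end point. That choice of
  coefficients depends on \<open>f\<close> and \<open>p\<close> only.\<close>

lemma step_rep_refine:
  assumes rep: "step_rep f m c t" and p0: "p 0 = 0" and p: "\<And>k. k \<in> {1..M} \<Longrightarrow> p (k - 1) < p k"
    and sub: "t ` {..m} \<subseteq> p ` {..M}"
  shows "step_rep f M (\<lambda>k. f (p (k - 1))) p"
proof -
  define h where "h s = (\<Sum>k=1..M. f (p (k - 1)) * indicator {p (k - 1)..<p k} s)" for s
  have hrep: "step_rep h M (\<lambda>k. f (p (k - 1))) p"
    using p0 p by (simp add: step_rep_def h_def)
  have "f s = h s" if s: "0 \<le> s" for s
  proof (cases "p M \<le> s")
    case True
    obtain i where "i \<le> M" "t m = p i" using sub by blast
    then have "t m \<le> s" using step_rep_le[OF hrep, of i M] True by simp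
    then show ?thesis using step_rep_value_beyond[OF hrep True] step_rep_value_beyond[OF rep] by simp
  next
    case False
    then obtain k where k: "k \<in> {1..M}" "p (k - 1) \<le> s" "s < p k"
      using step_rep_cover[OF hrep s] by auto
    have hs: "h s = f (p (k - 1))" by (rule step_rep_value[OF hrep k])
    \<comment> \<open>An old node beyond \<open>p (k - 1)\<close> is itself a new node, hence is at
      least the next one, \<open>p k\<close>.\<close>
    have above: "p k \<le> t j" if "j \<le> m" "p (k - 1) < t j" for j
    proof -
      have "t j \<in> p ` {..M}" using sub that(1) by auto
      then obtain i where i: "i \<le> M" "t j = p i" by auto
      have "\<not> i \<le> k - 1"
      proof
        assume "i \<le> k - 1"
        moreover have "k - 1 \<le> M" using k(1) by auto
        ultimately show False using step_rep_le[OF hrep, of i "k - 1"] i that(2) by linarith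
      qed
      then show ?thesis using i step_rep_le[OF hrep, of k i] k(1) by auto
    qed
    have p_pos: "0 \<le> p (k - 1)" using step_rep_le[OF hrep, of 0 "k - 1"] p0 k(1) by auto
    show ?thesis
    proof (cases "t m \<le> p (k - 1)")
      case True
      then show ?thesis using step_rep_value_beyond[OF rep] k(2) hs by simp
    next
      case False
      then obtain j where j: "j \<in> {1..m}" "t (j - 1) \<le> p (k - 1)" "p (k - 1) < t j"
        using step_rep_cover[OF rep p_pos] by auto
      then have "s < t j" using above[of j] k(3) by auto
      then show ?thesis
        using step_rep_value[OF rep j] step_rep_value[OF rep j(1), of s] j(2) k(2) hs by simp
    qed
  qed
  then show ?thesis using p0 p by (simp add: step_rep_def h_def)
qed

text \<open>The sorted union of the two sets of nodes refines both representations. It contains 0 as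
  its smallest element, as a representation requires.\<close>

lemma common_step_rep:
  assumes "step_function f" "step_function g"
  obtains M p where "step_rep f M (\<lambda>k. f (p (k - 1))) p" "step_rep g M (\<lambda>k. g (p (k - 1))) p"
proof -
  obtain m c t m' c' t' where f: "step_rep f m c t" and g: "step_rep g m' c' t'"
    using assms by (auto simp: step_function_def)
  define S where "S = t ` {..m} \<union> t' ` {..m'}"
  define xs where "xs = sorted_list_of_set S"
  have fin: "finite S" by (simp add: S_def)
  have xs: "set xs = S" "sorted_wrt (<) xs" using fin by (simp_all add: xs_def)
  have "0 \<in> S" using f unfolding S_def step_rep_def by force
  then have len: "0 < length xs" using xs(1) by (cases xs) auto
  have nonneg: "0 \<le> s" if "s \<in> S" for s
    using that step_rep_le[OF f, of 0] step_rep_le[OF g, of 0] f g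
    unfolding S_def step_rep_def by force
  have less: "xs ! i < xs ! j" if "i < j" "j < length xs" for i j
    using sorted_wrt_nth_less[OF xs(2) that] .
  have "xs ! 0 = 0"
  proof -
    obtain i where i: "i < length xs" "xs ! i = 0" using \<open>0 \<in> S\<close> xs(1) by (metis in_set_conv_nth)
    have "0 \<le> xs ! 0" using nonneg[of "xs ! 0"] len xs(1) nth_mem by blast
    then show ?thesis using less[of 0 i] i by (cases "i = 0") auto
  qed
  moreover have "xs ! (k - 1) < xs ! k" if "k \<in> {1..length xs - 1}" for k
    using that len by (intro less) auto
  moreover have "S \<subseteq> (!) xs ` {..length xs - 1}"
  proof
    fix s assume "s \<in> S"
    then obtain i where "i < length xs" "xs ! i = s" using xs(1) by (metis in_set_conv_nth)
    then show "s \<in> (!) xs ` {..length xs - 1}" by (intro image_eqI[of _ _ i]) auto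
  qed
  then have "t ` {..m} \<subseteq> (!) xs ` {..length xs - 1}" "t' ` {..m'} \<subseteq> (!) xs ` {..length xs - 1}"
    by (auto simp: S_def)
  ultimately show ?thesis using that step_rep_refine[OF f] step_rep_refine[OF g] by blast
qed

lemma step_function_diff:
  assumes "step_function f" "step_function g"
  shows "step_function (\<lambda>s. f s - g s)"
    and "step_integral (\<lambda>s. f s - g s) \<omega> = step_integral f \<omega> - step_integral g \<omega>"
proof -
  obtain M p where f: "step_rep f M (\<lambda>k. f (p (k - 1))) p" and g: "step_rep g M (\<lambda>k. g (p (k - 1))) p"
    by (rule common_step_rep[OF assms])
  have d: "step_rep (\<lambda>s. f s - g s) M (\<lambda>k. f (p (k - 1)) - g (p (k - 1))) p"
    using f g unfolding step_rep_def by (simp add: left_diff_distrib sum_subtractf)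
  then show "step_function (\<lambda>s. f s - g s)" by (auto simp: step_function_def)
  show "step_integral (\<lambda>s. f s - g s) \<omega> = step_integral f \<omega> - step_integral g \<omega>"
    unfolding step_integral_eq[OF d] step_integral_eq[OF f] step_integral_eq[OF g]
    by (simp add: left_diff_distrib sum_subtractf)
qed

text \<open>Indices are moved from \<open>{1..m}\<close> to \<open>{..<m}\<close>, the form in which
  random walks and telescoping sums are treated here.\<close>

lemma step_function_shifted_rep:
  assumes "step_function f"
  obtains m c t where "t 0 = 0" "\<And>k. k < m \<Longrightarrow> t k < t (Suc k)"
    "\<And>s. 0 \<le> s \<Longrightarrow> f s = (\<Sum>k<m. c k * indicator {t k..<t (Suc k)} s)"
    "\<And>\<omega>. step_integral f \<omega> = (\<Sum>k<m. c k * (\<omega> (t (Suc k)) - \<omega> (t k)))"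
    "\<And>k s. k < m \<Longrightarrow> t k \<le> s \<Longrightarrow> s < t (Suc k) \<Longrightarrow> f s = c k"
    "\<And>k. k \<le> m \<Longrightarrow> 0 \<le> t k"
proof -
  obtain m c t where rep: "step_rep f m c t" using assms by (auto simp: step_function_def)
  have shift: "(\<Sum>k=1..m. h k) = (\<Sum>k<m. h (Suc k))" for h :: "nat \<Rightarrow> real"
    using sum.atLeast1_atMost_eq[of h m] by simp
  show ?thesis
  proof (rule that[of t m "\<lambda>k. c (Suc k)"])
    show "t 0 = 0" using rep by (simp add: step_rep_def)
    show "t k < t (Suc k)" if "k < m" for k using step_rep_less[OF rep, of k "Suc k"] that by simp
    show "f s = (\<Sum>k<m. c (Suc k) * indicator {t k..<t (Suc k)} s)" if "0 \<le> s" for s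
      using rep that unfolding step_rep_def shift by simp
    show "step_integral f \<omega> = (\<Sum>k<m. c (Suc k) * (\<omega> (t (Suc k)) - \<omega> (t k)))" for \<omega>
      unfolding step_integral_eq[OF rep] shift by simp
    show "f s = c (Suc k)" if "k < m" "t k \<le> s" "s < t (Suc k)" for k s
      using step_rep_value[OF rep, of "Suc k" s] that by simp
    show "0 \<le> t k" if "k \<le> m" for k
      using step_rep_le[OF rep, of 0 k] that rep by (simp add: step_rep_def)
  qed
qed

lemma step_function_measurable:
  assumes "step_function f"
  shows "f \<in> borel_measurable (lebesgue_on {0..})"
proof -
  obtain m and c t :: "nat \<Rightarrow> real" where
    eq: "\<And>s. 0 \<le> s \<Longrightarrow> f s = (\<Sum>k<m. c k * indicator {t k..<t (Suc k)} s)"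
    using step_function_shifted_rep[OF assms] by metis
  have "(\<lambda>s. \<Sum>k<m. c k * indicator {t k..<t (Suc k)} s) \<in> borel_measurable borel" by measurable
  then have "(\<lambda>s. \<Sum>k<m. c k * indicator {t k..<t (Suc k)} s) \<in> borel_measurable (lebesgue_on {0..})"
    by (intro measurable_restrict_space1 measurable_completion) simp
  then show ?thesis by (rule measurable_cong[THEN iffD1, rotated]) (simp add: space_restrict_space eq)
qed

lemma step_integral_measurable:
  assumes "step_function f"
  shows "step_integral f \<in> borel_measurable path_space_inf"
proof -
  obtain m c t where t: "\<And>k. k \<le> m \<Longrightarrow> 0 \<le> t k"
    and eq: "\<And>\<omega>. step_integral f \<omega> = (\<Sum>k<m. c k * (\<omega> (t (Suc k)) - \<omega> (t k)))"
    using step_function_shifted_rep[OF assms] by metis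
  have "(\<lambda>\<omega>. \<omega> (t k)) \<in> borel_measurable path_space_inf" if "k \<le> m" for k
    using t[OF that] by (intro measurable_path_space_component) simp
  then have "(\<lambda>\<omega>. \<Sum>k<m. c k * (\<omega> (t (Suc k)) - \<omega> (t k))) \<in> borel_measurable path_space_inf"
    by (intro borel_measurable_sum borel_measurable_times borel_measurable_diff) auto
  then show ?thesis by (simp add: eq[abs_def] cong: measurable_cong)
qed

text \<open>Links the sums in the probabilistic bounds to the two norms of \<open>f\<close>: the
  squared L2 norm with \<psi> the square and \<open>h\<close> = 1, and the weighted L1 norm with
  \<psi> the absolute value and \<open>h\<close> the weight.\<close>

lemma nn_integral_step_function_ge:
  fixes t c :: "nat \<Rightarrow> real" and f \<psi> :: "real \<Rightarrow> real" and h H :: "real \<Rightarrow> real"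
  assumes t: "\<And>k. k \<le> m \<Longrightarrow> 0 \<le> t k" "\<And>k. k < m \<Longrightarrow> t k < t (Suc k)"
    and f: "\<And>k s. k < m \<Longrightarrow> t k \<le> s \<Longrightarrow> s < t (Suc k) \<Longrightarrow> f s = c k"
    and \<psi>: "\<And>x. 0 \<le> \<psi> x" and h: "\<And>x. 0 \<le> x \<Longrightarrow> 0 \<le> h x" "h \<in> borel_measurable borel"
    and H: "\<And>k. k < m \<Longrightarrow> h integrable_on {t k..t (Suc k)}"
  shows "ennreal (\<Sum>k<m. \<psi> (c k) * integral {t k..t (Suc k)} h) \<le>
    (\<integral>\<^sup>+s. ennreal (\<psi> (f s) * h s) \<partial>lebesgue_on {0..})"
proof -
  define I where "I k = integral {t k..t (Suc k)} h" for k
  have I0: "0 \<le> I k" if "k < m" for k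
    unfolding I_def using h t(1)[of k] that by (intro integral_nonneg H) force+
  have tmono: "t i \<le> t j" if "i \<le> j" "j \<le> m" for i j
    using that
  proof (induction j)
    case (Suc j)
    then show ?case using t(2)[of j] by (cases "i = Suc j") auto
  qed simp
  \<comment> \<open>The half-open interval of the step function and the closed one of the
    Henstock-Kurzweil integral differ by one point.\<close>
  have hk: "(\<integral>\<^sup>+s\<in>{t k..<t (Suc k)}. ennreal (h s) \<partial>lborel) = ennreal (I k)" if k: "k < m" for k
  proof (rule nn_integral_has_integral_lebesgue')
    show "0 \<le> h x" if "x \<in> {t k..<t (Suc k)}" for x using that h t(1)[of k] k by force
    have "(h has_integral I k) {t k..t (Suc k)}" unfolding I_def using H[OF k] by (rule integrable_integral)
    then show "(h has_integral I k) {t k..<t (Suc k)}"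
      by (rule has_integral_spike_set_eq[THEN iffD1, rotated 2]) (auto intro: negligible_subset[OF negligible_sing[of "t (Suc k)"]])
  qed
  have "ennreal (\<Sum>k<m. \<psi> (c k) * I k) = (\<Sum>k<m. ennreal (\<psi> (c k)) * ennreal (I k))"
    using \<psi> I0 by (subst sum_ennreal[symmetric]) (auto simp: ennreal_mult)
  also have "\<dots> = (\<integral>\<^sup>+s. (\<Sum>k<m. ennreal (\<psi> (c k)) * (ennreal (h s) * indicator {t k..<t (Suc k)} s)) \<partial>lborel)"
    using h(2) by (subst nn_integral_sum) (auto simp: hk nn_integral_cmult intro!: sum.cong)
  also have "\<dots> \<le> (\<integral>\<^sup>+s. ennreal (\<psi> (f s) * h s) * indicator {0..} s \<partial>lborel)"
  proof (rule nn_integral_mono)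
    fix s
    show "(\<Sum>k<m. ennreal (\<psi> (c k)) * (ennreal (h s) * indicator {t k..<t (Suc k)} s)) \<le>
        ennreal (\<psi> (f s) * h s) * indicator {0..} s"
    \<comment> \<open>At most one interval contains \<open>s\<close>, so the sum has at most one
      nonzero term.\<close>
    proof (cases "\<exists>j<m. t j \<le> s \<and> s < t (Suc j)")
      case True
      then obtain j where j: "j < m" "t j \<le> s" "s < t (Suc j)" by auto
      have "s \<notin> {t k..<t (Suc k)}" if "k < m" "k \<noteq> j" for k
      proof (cases "k < j")
        case True
        then show ?thesis using tmono[of "Suc k" j] j by auto
      next
        case False
        then show ?thesis using tmono[of "Suc j" k] j that by auto
      qed
      then have "(\<Sum>k<m. ennreal (\<psi> (c k)) * (ennreal (h s) * indicator {t k..<t (Suc k)} s)) =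
          (\<Sum>k\<in>{j}. ennreal (\<psi> (c k)) * (ennreal (h s) * indicator {t k..<t (Suc k)} s))"
        using j by (intro sum.mono_neutral_right) auto
      also have "\<dots> = ennreal (\<psi> (c j)) * ennreal (h s)" using j by simp
      also have "\<dots> = ennreal (\<psi> (f s) * h s) * indicator {0..} s"
        using f[OF j] t(1)[of j] j \<psi>[of "c j"] by (simp add: ennreal_mult')
      finally show ?thesis by simp
    next
      case False
      then have "(\<Sum>k<m. ennreal (\<psi> (c k)) * (ennreal (h s) * indicator {t k..<t (Suc k)} s)) = 0"
        by (intro sum.neutral) auto
      then show ?thesis by (simp only: zero_le)
    qed
  qed
  also have "\<dots> = (\<integral>\<^sup>+s. ennreal (\<psi> (f s) * h s) \<partial>lebesgue_on {0..})"
    by (subst nn_integral_restrict_space) (auto simp: nn_integral_completion)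
  finally show ?thesis by (simp add: I_def)
qed


section \<open>Brownian motion in dimensions one and three\<close>

lemma (in prob_space) distr_pair_snd:
  assumes "sigma_finite_measure N"
  shows "distr (M \<Otimes>\<^sub>M N) N snd = N"
proof (rule measure_eqI)
  interpret N: sigma_finite_measure N by fact
  fix A assume A: "A \<in> sets (distr (M \<Otimes>\<^sub>M N) N snd)"
  then have "emeasure (distr (M \<Otimes>\<^sub>M N) N snd) A = emeasure (M \<Otimes>\<^sub>M N) (space M \<times> A)"
    by (auto simp add: emeasure_distr space_pair_measure dest: sets.sets_into_space
        intro!: arg_cong2[where f = emeasure])
  then show "emeasure (distr (M \<Otimes>\<^sub>M N) N snd) A = emeasure N A"
    using A by (simp add: N.emeasure_pair_measure_Times emeasure_space_1)
qed simp

definition wiener3 :: "(real \<Rightarrow> real) measure \<Rightarrow> ((real \<Rightarrow> real) \<times> (real \<Rightarrow> real) \<times> (real \<Rightarrow> real)) measure" where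
  "wiener3 B = B \<Otimes>\<^sub>M B \<Otimes>\<^sub>M B"

definition displacement ::
    "real \<Rightarrow> real \<Rightarrow> (real \<Rightarrow> real) \<times> (real \<Rightarrow> real) \<times> (real \<Rightarrow> real) \<Rightarrow> real \<times> real \<times> real" where
  "displacement s t w = (fst w t - fst w s, fst (snd w) t - fst (snd w) s, snd (snd w) t - snd (snd w) s)"

locale wiener =
  fixes B :: "(real \<Rightarrow> real) measure"
  assumes wiener: "wiener_measure B"
begin

sublocale prob_space B
  using wiener by (simp add: wiener_measure_def)

lemma sets_B: "sets B = sets path_space_inf"
  using wiener by (simp add: wiener_measure_def)

lemma measurable_component[measurable]: "0 \<le> t \<Longrightarrow> (\<lambda>\<omega>. \<omega> t) \<in> borel_measurable B"
  using measurable_path_space_component[of t "{0..}"] by (simp add: measurable_cong_sets[OF sets_B refl])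

lemma increment_normal:
  "0 \<le> s \<Longrightarrow> s < t \<Longrightarrow> distributed B lborel (\<lambda>\<omega>. \<omega> t - \<omega> s) (normal_density 0 (sqrt (t - s)))"
  using wiener by (simp add: wiener_measure_def)

lemma increment_moment:
  assumes "0 \<le> s" "s \<le> t"
  shows "integrable B (\<lambda>\<omega>. (\<omega> t - \<omega> s) ^ n)"
    and "expectation (\<lambda>\<omega>. \<omega> t - \<omega> s) = 0"
    and "expectation (\<lambda>\<omega>. (\<omega> t - \<omega> s)\<^sup>2) = t - s"
    and "expectation (\<lambda>\<omega>. (\<omega> t - \<omega> s) ^ 4) = 3 * (t - s)\<^sup>2"
proof -
  \<comment> \<open>A degenerate increment has no normal density and is treated apart.\<close>
  consider "s = t" | "s < t" using assms by linarith
  then have "integrable B (\<lambda>\<omega>. (\<omega> t - \<omega> s) ^ n) \<and> expectation (\<lambda>\<omega>. \<omega> t - \<omega> s) = 0 \<and>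
      expectation (\<lambda>\<omega>. (\<omega> t - \<omega> s)\<^sup>2) = t - s \<and> expectation (\<lambda>\<omega>. (\<omega> t - \<omega> s) ^ 4) = 3 * (t - s)\<^sup>2"
  proof cases
    case 1
    then show ?thesis by simp
  next
    case 2
    note D = increment_normal[OF assms(1) 2]
    have pos: "0 < sqrt (t - s)" using 2 by simp
    have "integrable B (\<lambda>\<omega>. (\<omega> t - \<omega> s) ^ n)"
      using integrable_normal_moment[OF pos, of 0 n]
      by (subst distributed_integrable[OF D, symmetric]) simp_all
    moreover have "expectation (\<lambda>\<omega>. \<omega> t - \<omega> s) = 0"
      using normal_distributed_expectation[OF pos D] .
    moreover have "expectation (\<lambda>\<omega>. (\<omega> t - \<omega> s)\<^sup>2) = t - s"
      using integral_normal_moment_even[OF pos, of 0 1] 2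
      by (subst distributed_integral[OF D, symmetric]) (simp_all add: eval_nat_numeral)
    moreover have "expectation (\<lambda>\<omega>. (\<omega> t - \<omega> s) ^ 4) = 3 * (t - s)\<^sup>2"
      using integral_normal_moment_even[OF pos, of 0 2] 2
      by (subst distributed_integral[OF D, symmetric])
        (simp_all add: fact_numeral field_simps power2_eq_square)
    ultimately show ?thesis by blast
  qed
  then show "integrable B (\<lambda>\<omega>. (\<omega> t - \<omega> s) ^ n)" "expectation (\<lambda>\<omega>. \<omega> t - \<omega> s) = 0"
    "expectation (\<lambda>\<omega>. (\<omega> t - \<omega> s)\<^sup>2) = t - s" "expectation (\<lambda>\<omega>. (\<omega> t - \<omega> s) ^ 4) = 3 * (t - s)\<^sup>2"
    by auto
qed

lemma increment_integrable:
  assumes "0 \<le> s" "s \<le> t"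
  shows "integrable B (\<lambda>\<omega>. \<omega> t - \<omega> s)" "integrable B (\<lambda>\<omega>. (\<omega> t - \<omega> s)\<^sup>2)"
  using increment_moment(1)[OF assms, of 1] increment_moment(1)[OF assms, of 2] by simp_all

lemma increments_indep_pair:
  assumes t: "0 \<le> t 0" "\<And>k. k < n \<Longrightarrow> t k < t (Suc k)" and k: "k < n"
  shows "indep_pair B (\<Pi>\<^sub>M i\<in>{..<k}. borel) (\<lambda>\<omega>. \<lambda>i\<in>{..<k}. \<omega> (t (Suc i)) - \<omega> (t i))
     borel (\<lambda>\<omega>. \<omega> (t (Suc k)) - \<omega> (t k))"
proof -
  have "indep_vars (\<lambda>_. borel) (\<lambda>k \<omega>. \<omega> (t (Suc k)) - \<omega> (t k)) {..<n}"
    using wiener t unfolding wiener_measure_def by blast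
  then have "indep_var (\<Pi>\<^sub>M i\<in>{..<k}. borel) (\<lambda>\<omega>. \<lambda>i\<in>{..<k}. \<omega> (t (Suc i)) - \<omega> (t i))
     (\<Pi>\<^sub>M i\<in>{k}. borel) (\<lambda>\<omega>. \<lambda>i\<in>{k}. \<omega> (t (Suc i)) - \<omega> (t i))"
    by (rule indep_var_restrict) (use k in auto)
  then have "indep_pair B (\<Pi>\<^sub>M i\<in>{..<k}. borel) (\<lambda>\<omega>. \<lambda>i\<in>{..<k}. \<omega> (t (Suc i)) - \<omega> (t i))
     (\<Pi>\<^sub>M i\<in>{k}. borel) (\<lambda>\<omega>. \<lambda>i\<in>{k}. \<omega> (t (Suc i)) - \<omega> (t i))"
    unfolding indep_var_distribution_eq indep_pair_def .
  from indep_pair_compose[OF prob_space_axioms this measurable_ident_sets[OF refl],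
      of "\<lambda>p. p k" borel] show ?thesis
    by (simp add: measurable_component_singleton)
qed

text \<open>The transform bound with \<open>V\<close> the identity: centred increments have no
  drift, so its second term vanishes. The Ito isometry would give the constant 1 in place of 2,
  which is immaterial here.\<close>

lemma wiener_sum_bound:
  fixes \<tau> c :: "nat \<Rightarrow> real"
  assumes "0 \<le> \<tau> 0" "\<And>k. k < n \<Longrightarrow> \<tau> k \<le> \<tau> (Suc k)"
  shows "integrable B (\<lambda>\<omega>. \<Sum>k<n. c k * (\<omega> (\<tau> (Suc k)) - \<omega> (\<tau> k)))"
    and "expectation (\<lambda>\<omega>. \<bar>\<Sum>k<n. c k * (\<omega> (\<tau> (Suc k)) - \<omega> (\<tau> k))\<bar>) \<le>
       2 * sqrt (\<Sum>k<n. (c k)\<^sup>2 * (\<tau> (Suc k) - \<tau> k))"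
proof -
  obtain n' t d where t0: "t 0 = \<tau> 0" and "t n' = \<tau> n" and t: "\<And>k. k < n' \<Longrightarrow> t k < t (Suc k)" and
    eq: "\<And>\<phi> F :: real \<Rightarrow> real. (\<Sum>k<n. \<phi> (c k) * (F (\<tau> (Suc k)) - F (\<tau> k))) =
       (\<Sum>k<n'. \<phi> (d k) * (F (t (Suc k)) - F (t k)))"
    by (rule drop_trivial_increments[of n \<tau> c, OF assms(2)], assumption, rule that)
  have t0': "0 \<le> t 0" using t0 assms(1) by simp
  have pos: "0 \<le> t k" if "k \<le> n'" for k
    using that
  proof (induction k)
    case (Suc k)
    then show ?case using t[of k] by simp
  qed (use t0' in simp)
  define \<xi> where "\<xi> k \<omega> = \<omega> (t (Suc k)) - \<omega> (t k)" for k and \<omega> :: "real \<Rightarrow> real"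
  have \<xi>: "integrable B (\<xi> k)" "integrable B (\<lambda>\<omega>. (\<xi> k \<omega>)\<^sup>2)" "expectation (\<xi> k) = 0"
      "expectation (\<lambda>\<omega>. (\<xi> k \<omega>)\<^sup>2) = t (Suc k) - t k" if "k < n'" for k
    unfolding \<xi>_def using increment_integrable[of "t k" "t (Suc k)"] increment_moment[of "t k" "t (Suc k)"]
      t[OF that] pos[of k] that by auto
  have sum0: "expectation (\<lambda>\<omega>. \<Sum>i<k. \<xi> i \<omega>) = 0" if "k \<le> n'" for k
    using \<xi> that by (subst Bochner_Integration.integral_sum) auto
  have "(\<Sum>k<n. c k * (\<omega> (\<tau> (Suc k)) - \<omega> (\<tau> k))) =
      (\<Sum>k<n'. d k * ((\<Sum>i<Suc k. \<xi> i \<omega>) - (\<Sum>i<k. \<xi> i \<omega>)))" for \<omega>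
    using eq[of "\<lambda>x. x" \<omega>] by (simp add: \<xi>_def)
  note S = this
  have "(\<Sum>k<n. (c k)\<^sup>2 * (\<tau> (Suc k) - \<tau> k)) = (\<Sum>k<n'. (d k)\<^sup>2 * (t (Suc k) - t k))"
    using eq[of "\<lambda>x. x\<^sup>2" "\<lambda>x. x"] .
  also have "\<dots> = (\<Sum>k<n'. (d k)\<^sup>2 * expectation (\<lambda>\<omega>. (norm (\<xi> k \<omega>))\<^sup>2))"
    using \<xi> by (intro sum.cong) auto
  finally have Q: "(\<Sum>k<n. (c k)\<^sup>2 * (\<tau> (Suc k) - \<tau> k)) =
      (\<Sum>k<n'. (d k)\<^sup>2 * expectation (\<lambda>\<omega>. (norm (\<xi> k \<omega>))\<^sup>2))" .
  have R: "(\<Sum>k<n'. \<bar>d k\<bar> * (expectation (\<lambda>\<omega>. \<Sum>i<Suc k. \<xi> i \<omega>) - expectation (\<lambda>\<omega>. \<Sum>i<k. \<xi> i \<omega>))) = 0"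
    by (rule sum.neutral) (use sum0 in \<open>auto simp del: sum.lessThan_Suc\<close>)
  have indep: "indep_pair B (\<Pi>\<^sub>M i\<in>{..<k}. borel) (\<lambda>\<omega>. \<lambda>i\<in>{..<k}. \<xi> i \<omega>) borel (\<xi> k)" if "k < n'" for k
    unfolding \<xi>_def using t0' t that by (rule increments_indep_pair)
  note bound = transform_integral_bound[where V = "\<lambda>x. x" and \<xi> = \<xi> and n = n' and c = d, OF indep]
  show "integrable B (\<lambda>\<omega>. \<Sum>k<n. c k * (\<omega> (\<tau> (Suc k)) - \<omega> (\<tau> k)))"
    unfolding S by (rule bound(1)) (use \<xi> in auto)
  show "expectation (\<lambda>\<omega>. \<bar>\<Sum>k<n. c k * (\<omega> (\<tau> (Suc k)) - \<omega> (\<tau> k))\<bar>) \<le>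
       2 * sqrt (\<Sum>k<n. (c k)\<^sup>2 * (\<tau> (Suc k) - \<tau> k))"
    unfolding S Q using bound(2) \<xi> R by (simp del: sum.lessThan_Suc)
qed

section \<open>Three independent Brownian motions and the norm of their displacement\<close>

lemma prob_space_wiener3: "prob_space (wiener3 B)"
  unfolding wiener3_def by (intro prob_space_pair prob_space_axioms)

sublocale B3: prob_space "wiener3 B"
  by (rule prob_space_wiener3)

lemma measurable_coordinates[measurable]:
  "fst \<in> wiener3 B \<rightarrow>\<^sub>M B" "(\<lambda>w. fst (snd w)) \<in> wiener3 B \<rightarrow>\<^sub>M B" "(\<lambda>w. snd (snd w)) \<in> wiener3 B \<rightarrow>\<^sub>M B"
  unfolding wiener3_def by measurable

lemma distr_coordinates:
  "distr (wiener3 B) B fst = B" "distr (wiener3 B) B (\<lambda>w. fst (snd w)) = B"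
  "distr (wiener3 B) B (\<lambda>w. snd (snd w)) = B"
proof -
  interpret BB: prob_space "B \<Otimes>\<^sub>M B" by (intro prob_space_pair prob_space_axioms)
  show "distr (wiener3 B) B fst = B" unfolding wiener3_def by (rule BB.distr_pair_fst)
  have snd: "distr (wiener3 B) (B \<Otimes>\<^sub>M B) snd = B \<Otimes>\<^sub>M B"
    unfolding wiener3_def by (rule distr_pair_snd) (rule BB.sigma_finite_measure_axioms)
  have [measurable]: "snd \<in> wiener3 B \<rightarrow>\<^sub>M B \<Otimes>\<^sub>M B" unfolding wiener3_def by measurable
  have "distr (wiener3 B) B (\<lambda>w. fst (snd w)) = distr (distr (wiener3 B) (B \<Otimes>\<^sub>M B) snd) B fst"
    by (subst distr_distr) (auto simp: comp_def)
  then show "distr (wiener3 B) B (\<lambda>w. fst (snd w)) = B" by (simp add: snd distr_pair_fst)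
  have "distr (wiener3 B) B (\<lambda>w. snd (snd w)) = distr (distr (wiener3 B) (B \<Otimes>\<^sub>M B) snd) B snd"
    by (subst distr_distr) (auto simp: comp_def)
  then show "distr (wiener3 B) B (\<lambda>w. snd (snd w)) = B"
    by (simp add: snd distr_pair_snd[OF sigma_finite_measure_axioms])
qed

lemma integral_coordinate:
  fixes f :: "_ \<Rightarrow> real"
  assumes q: "q \<in> wiener3 B \<rightarrow>\<^sub>M B" "distr (wiener3 B) B q = B" and f: "integrable B f"
  shows "integrable (wiener3 B) (\<lambda>w. f (q w))" "(\<integral>w. f (q w) \<partial>wiener3 B) = expectation f"
proof -
  have m: "f \<in> borel_measurable B" using f by (rule borel_measurable_integrable)
  show "integrable (wiener3 B) (\<lambda>w. f (q w))"
    using f integrable_distr_eq[OF q(1), of f] m by (simp add: q(2))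
  show "(\<integral>w. f (q w) \<partial>wiener3 B) = expectation f"
    using integral_distr[OF q(1), of f] m by (simp add: q(2))
qed

lemmas integral_coordinates =
  integral_coordinate[OF measurable_coordinates(1) distr_coordinates(1)]
  integral_coordinate[OF measurable_coordinates(2) distr_coordinates(2)]
  integral_coordinate[OF measurable_coordinates(3) distr_coordinates(3)]

lemma displacement_measurable[measurable]:
  "0 \<le> s \<Longrightarrow> 0 \<le> t \<Longrightarrow> displacement s t \<in> borel_measurable (wiener3 B)"
  unfolding displacement_def[abs_def] borel_prod[symmetric] by measurable

lemma displacement_moment:
  assumes "0 \<le> s" "s \<le> t"
  shows "integrable (wiener3 B) (displacement s t)"
    and "integral\<^sup>L (wiener3 B) (displacement s t) = 0"
    and "integrable (wiener3 B) (\<lambda>w. (norm (displacement s t w))\<^sup>2)"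
    and "(\<integral>w. (norm (displacement s t w))\<^sup>2 \<partial>wiener3 B) = 3 * (t - s)"
proof -
  note I1 = integral_coordinates[OF increment_integrable(1)[OF assms]]
  note I2 = integral_coordinates[OF increment_integrable(2)[OF assms]]
  have norm2: "(norm (displacement s t w))\<^sup>2 = (fst w t - fst w s)\<^sup>2 +
      ((fst (snd w) t - fst (snd w) s)\<^sup>2 + (snd (snd w) t - snd (snd w) s)\<^sup>2)" for w
    by (simp add: displacement_def norm_Pair)
  show sq: "integrable (wiener3 B) (\<lambda>w. (norm (displacement s t w))\<^sup>2)"
    unfolding norm2 using I2 by (intro Bochner_Integration.integrable_add)
  show "(\<integral>w. (norm (displacement s t w))\<^sup>2 \<partial>wiener3 B) = 3 * (t - s)"
    unfolding norm2 using I2 increment_moment(3)[OF assms] by simp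
  have [measurable]: "displacement s t \<in> borel_measurable (wiener3 B)" using assms by simp
  have "integrable (wiener3 B) (\<lambda>w. norm (displacement s t w))"
    by (rule B3.expectation_power2_le(1)) (use sq in simp_all)
  then show int: "integrable (wiener3 B) (displacement s t)"
    by (subst (asm) integrable_norm_iff) auto
  have "fst (integral\<^sup>L (wiener3 B) (displacement s t)) = (\<integral>w. fst (displacement s t w) \<partial>wiener3 B)"
    by (rule integral_bounded_linear[OF bounded_linear_fst int, symmetric])
  moreover have "fst (snd (integral\<^sup>L (wiener3 B) (displacement s t))) = (\<integral>w. fst (snd (displacement s t w)) \<partial>wiener3 B)"
    by (rule integral_bounded_linear[OF bounded_linear_compose[OF bounded_linear_fst bounded_linear_snd] int, symmetric])
  moreover have "snd (snd (integral\<^sup>L (wiener3 B) (displacement s t))) = (\<integral>w. snd (snd (displacement s t w)) \<partial>wiener3 B)"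
    by (rule integral_bounded_linear[OF bounded_linear_compose[OF bounded_linear_snd bounded_linear_snd] int, symmetric])
  ultimately show "integral\<^sup>L (wiener3 B) (displacement s t) = 0"
    using I1 increment_moment(2)[OF assms] by (simp add: displacement_def prod_eq_iff)
qed

lemma displacement_indep:
  assumes t: "0 \<le> t 0" "\<And>k. k < n \<Longrightarrow> t k < t (Suc k)" and k: "k < n"
  shows "indep_pair (wiener3 B) (\<Pi>\<^sub>M i\<in>{..<k}. borel) (\<lambda>w. \<lambda>i\<in>{..<k}. displacement (t i) (t (Suc i)) w)
     borel (displacement (t k) (t (Suc k)))"
proof -
  note ind = increments_indep_pair[OF t k]
  have P2: "prob_space (B \<Otimes>\<^sub>M B)" by (intro prob_space_pair prob_space_axioms)
  note ind2 = indep_pair_pair_measure[OF prob_space_axioms prob_space_axioms ind ind]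
  note ind3 = indep_pair_pair_measure[OF prob_space_axioms P2 ind ind2]
  \<comment> \<open>Transposes a triple of sequences into a sequence of triples, turning three
    histories into one history of vectors.\<close>
  define f where "f p = (\<lambda>i\<in>{..<k}. (fst p i, fst (snd p) i, snd (snd p) i))"
    for p :: "(nat \<Rightarrow> real) \<times> (nat \<Rightarrow> real) \<times> (nat \<Rightarrow> real)"
  have f: "f \<in> (\<Pi>\<^sub>M i\<in>{..<k}. borel) \<Otimes>\<^sub>M (\<Pi>\<^sub>M i\<in>{..<k}. borel) \<Otimes>\<^sub>M (\<Pi>\<^sub>M i\<in>{..<k}. borel)
      \<rightarrow>\<^sub>M (\<Pi>\<^sub>M i\<in>{..<k}. borel)"
    unfolding f_def borel_prod[symmetric] by (intro measurable_restrict) measurable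
  have g: "(\<lambda>x. x) \<in> borel \<Otimes>\<^sub>M borel \<Otimes>\<^sub>M borel \<rightarrow>\<^sub>M (borel :: (real \<times> real \<times> real) measure)"
    by (simp add: borel_prod)
  from indep_pair_compose[OF _ ind3 f g] prob_space_wiener3
  have "indep_pair (wiener3 B) (\<Pi>\<^sub>M i\<in>{..<k}. borel)
      (\<lambda>w. f (\<lambda>i\<in>{..<k}. fst w (t (Suc i)) - fst w (t i),
        \<lambda>i\<in>{..<k}. fst (snd w) (t (Suc i)) - fst (snd w) (t i),
        \<lambda>i\<in>{..<k}. snd (snd w) (t (Suc i)) - snd (snd w) (t i)))
      borel (\<lambda>w. (fst w (t (Suc k)) - fst w (t k),
        fst (snd w) (t (Suc k)) - fst (snd w) (t k), snd (snd w) (t (Suc k)) - snd (snd w) (t k)))"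
    by (simp add: wiener3_def)
  moreover have "f (\<lambda>i\<in>{..<k}. fst w (t (Suc i)) - fst w (t i),
        \<lambda>i\<in>{..<k}. fst (snd w) (t (Suc i)) - fst (snd w) (t i),
        \<lambda>i\<in>{..<k}. snd (snd w) (t (Suc i)) - snd (snd w) (t i)) =
      (\<lambda>i\<in>{..<k}. displacement (t i) (t (Suc i)) w)" for w
    by (auto simp: f_def displacement_def fun_eq_iff)
  ultimately show ?thesis by (simp add: displacement_def[abs_def])
qed

text \<open>The mean length of a standard Gaussian vector in three dimensions, that is 2 sqrt(2/pi).
  Its value does not enter the proof.\<close>

definition mean_norm :: real where
  "mean_norm = (\<integral>w. norm (displacement 0 1 w) \<partial>wiener3 B)"

lemma mean_norm_nonneg: "0 \<le> mean_norm"
  unfolding mean_norm_def by simp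

text \<open>Brownian scaling. The rescaled coordinates all have the standard normal law
  \<open>N s\<close>, whatever \<open>s\<close> is, so the mean of the rescaled norm, an integral
  against the threefold product of \<open>N s\<close>, is the same at times \<open>t\<close> and
  1.\<close>

lemma displacement_mean_norm:
  assumes "0 \<le> t"
  shows "(\<integral>w. norm (displacement 0 t w) \<partial>wiener3 B) = mean_norm * sqrt t"
proof (cases "t = 0")
  case True
  then show ?thesis by (simp add: displacement_def norm_Pair)
next
  case False
  then have t: "0 < t" using assms by simp
  define N where "N s = distr B borel (\<lambda>\<omega>. (\<omega> s - \<omega> 0) / sqrt s)" for s
  have normal: "N s = density lborel (normal_density 0 1)" if s: "0 < s" for s
  proof -
    have "distributed B lborel (\<lambda>\<omega>. 0 + (1 / sqrt s) * (\<omega> s - \<omega> 0))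
       (normal_density (0 + (1 / sqrt s) * 0) (\<bar>1 / sqrt s\<bar> * sqrt (s - 0)))"
      using s by (intro normal_density_affine increment_normal) auto
    then have "distributed B lborel (\<lambda>\<omega>. (\<omega> s - \<omega> 0) / sqrt s) (normal_density 0 1)"
      using s by simp
    then have "distr B lborel (\<lambda>\<omega>. (\<omega> s - \<omega> 0) / sqrt s) = density lborel (normal_density 0 1)"
      by (rule distributed_distr_eq_density)
    then show ?thesis unfolding N_def by (simp cong: distr_cong)
  qed
  have N3: "(\<integral>w. norm ((1 / sqrt s) *\<^sub>R displacement 0 s w) \<partial>wiener3 B) =
      (\<integral>x. norm x \<partial>(N s \<Otimes>\<^sub>M N s \<Otimes>\<^sub>M N s))" if s: "0 < s" for s
  proof -
    define h where "h \<omega> = (\<omega> s - \<omega> 0) / sqrt s" for \<omega> :: "real \<Rightarrow> real"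
    have [measurable]: "h \<in> borel_measurable B" unfolding h_def
      using s by (intro borel_measurable_divide borel_measurable_diff measurable_component borel_measurable_const) auto
    interpret N: prob_space "N s" unfolding N_def h_def[symmetric] by (rule prob_space_distr) simp
    have NN: "prob_space (N s \<Otimes>\<^sub>M N s)" by (intro prob_space_pair N.prob_space_axioms)
    interpret NN: prob_space "N s \<Otimes>\<^sub>M N s" by (rule NN)
    have e2: "N s \<Otimes>\<^sub>M N s = distr (B \<Otimes>\<^sub>M B) (borel \<Otimes>\<^sub>M borel) (\<lambda>(x, y). (h x, h y))"
      using N.sigma_finite_measure_axioms unfolding N_def h_def[symmetric]
      by (intro pair_measure_distr) auto
    have "N s \<Otimes>\<^sub>M N s \<Otimes>\<^sub>M N s = distr (wiener3 B) (borel \<Otimes>\<^sub>M (borel \<Otimes>\<^sub>M borel)) (\<lambda>(x, y). (h x, (\<lambda>(x, y). (h x, h y)) y))"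
      using NN.sigma_finite_measure_axioms
      unfolding e2 wiener3_def unfolding N_def h_def[symmetric] by (intro pair_measure_distr) auto
    then have "(\<integral>x. norm x \<partial>(N s \<Otimes>\<^sub>M N s \<Otimes>\<^sub>M N s)) =
        (\<integral>w. norm ((\<lambda>(x, y). (h x, (\<lambda>(x, y). (h x, h y)) y)) w) \<partial>wiener3 B)"
      by (simp add: integral_distr wiener3_def borel_prod)
    also have "\<dots> = (\<integral>w. norm ((1 / sqrt s) *\<^sub>R displacement 0 s w) \<partial>wiener3 B)"
      by (intro Bochner_Integration.integral_cong) (auto simp: displacement_def h_def)
    finally show ?thesis by simp
  qed
  have "(\<integral>w. norm ((1 / sqrt t) *\<^sub>R displacement 0 t w) \<partial>wiener3 B) =
      (\<integral>w. norm ((1 / sqrt 1) *\<^sub>R displacement 0 1 w) \<partial>wiener3 B)"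
    using N3[OF t] N3[of 1] normal[OF t] normal[of 1] by simp
  then have "(\<integral>w. norm (displacement 0 t w) \<partial>wiener3 B) / sqrt t = mean_norm"
    using t by (simp add: mean_norm_def)
  then show ?thesis using t by (simp add: field_simps)
qed

text \<open>The transform bound with \<open>V\<close> the norm, which is 1-Lipschitz. The factor 3
  is the dimension, and by scaling the drift has mean \<open>mean_norm\<close> times the increment
  of the square root.\<close>

lemma norm_sum_bound:
  fixes \<tau> c :: "nat \<Rightarrow> real"
  assumes "\<tau> 0 = 0" "\<And>k. k < n \<Longrightarrow> \<tau> k \<le> \<tau> (Suc k)"
  defines "S \<equiv> \<lambda>w. \<Sum>k<n. c k * (norm (displacement 0 (\<tau> (Suc k)) w) - norm (displacement 0 (\<tau> k) w))"
  shows "integrable (wiener3 B) S"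
    and "(\<integral>w. \<bar>S w\<bar> \<partial>wiener3 B) \<le> 2 * sqrt (3 * (\<Sum>k<n. (c k)\<^sup>2 * (\<tau> (Suc k) - \<tau> k))) +
       mean_norm * (\<Sum>k<n. \<bar>c k\<bar> * (sqrt (\<tau> (Suc k)) - sqrt (\<tau> k)))"
proof -
  obtain n' t d where t0: "t 0 = \<tau> 0" and "t n' = \<tau> n" and t: "\<And>k. k < n' \<Longrightarrow> t k < t (Suc k)" and
    eq: "\<And>\<phi> F :: real \<Rightarrow> real. (\<Sum>k<n. \<phi> (c k) * (F (\<tau> (Suc k)) - F (\<tau> k))) =
       (\<Sum>k<n'. \<phi> (d k) * (F (t (Suc k)) - F (t k)))"
    by (rule drop_trivial_increments[of n \<tau> c, OF assms(2)], assumption, rule that)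
  have t0': "0 \<le> t 0" "t 0 = 0" using t0 assms(1) by simp_all
  have pos: "0 \<le> t k" if "k \<le> n'" for k
    using that
  proof (induction k)
    case (Suc k)
    then show ?case using t[of k] by simp
  qed (use t0' in simp)
  define \<xi> where "\<xi> k = displacement (t k) (t (Suc k))" for k
  have \<xi>: "integrable (wiener3 B) (\<xi> k)" "integrable (wiener3 B) (\<lambda>w. (norm (\<xi> k w))\<^sup>2)"
      "integral\<^sup>L (wiener3 B) (\<xi> k) = 0"
      "(\<integral>w. (norm (\<xi> k w))\<^sup>2 \<partial>wiener3 B) = 3 * (t (Suc k) - t k)" if "k < n'" for k
    unfolding \<xi>_def using displacement_moment[of "t k" "t (Suc k)"] t[OF that] pos[of k] that by auto
  have X: "(\<Sum>i<k. \<xi> i w) = displacement 0 (t k) w" for k w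
    by (induction k) (auto simp: \<xi>_def displacement_def t0'(2) zero_prod_def)
  have S: "S w = (\<Sum>k<n'. d k * (norm (\<Sum>i<Suc k. \<xi> i w) - norm (\<Sum>i<k. \<xi> i w)))" for w
    unfolding S_def X using eq[of "\<lambda>x. x" "\<lambda>s. norm (displacement 0 s w)"] .
  have "3 * (\<Sum>k<n. (c k)\<^sup>2 * (\<tau> (Suc k) - \<tau> k)) = (\<Sum>k<n'. (d k)\<^sup>2 * (3 * (t (Suc k) - t k)))"
    using eq[of "\<lambda>x. x\<^sup>2" "\<lambda>x. x"] by (simp add: sum_distrib_left algebra_simps)
  also have "\<dots> = (\<Sum>k<n'. (d k)\<^sup>2 * (\<integral>w. (norm (\<xi> k w))\<^sup>2 \<partial>wiener3 B))"
    using \<xi> by (intro sum.cong) auto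
  finally have Q: "3 * (\<Sum>k<n. (c k)\<^sup>2 * (\<tau> (Suc k) - \<tau> k)) =
      (\<Sum>k<n'. (d k)\<^sup>2 * (\<integral>w. (norm (\<xi> k w))\<^sup>2 \<partial>wiener3 B))" .
  have "mean_norm * (\<Sum>k<n. \<bar>c k\<bar> * (sqrt (\<tau> (Suc k)) - sqrt (\<tau> k))) =
      (\<Sum>k<n'. \<bar>d k\<bar> * (mean_norm * sqrt (t (Suc k)) - mean_norm * sqrt (t k)))"
    using eq[of abs sqrt] by (simp add: sum_distrib_left algebra_simps)
  also have "\<dots> = (\<Sum>k<n'. \<bar>d k\<bar> * ((\<integral>w. norm (\<Sum>i<Suc k. \<xi> i w) \<partial>wiener3 B) -
      (\<integral>w. norm (\<Sum>i<k. \<xi> i w) \<partial>wiener3 B)))"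
    unfolding X using displacement_mean_norm pos by (intro sum.cong) auto
  finally have R: "mean_norm * (\<Sum>k<n. \<bar>c k\<bar> * (sqrt (\<tau> (Suc k)) - sqrt (\<tau> k))) =
      (\<Sum>k<n'. \<bar>d k\<bar> * ((\<integral>w. norm (\<Sum>i<Suc k. \<xi> i w) \<partial>wiener3 B) -
      (\<integral>w. norm (\<Sum>i<k. \<xi> i w) \<partial>wiener3 B)))" .
  have indep: "indep_pair (wiener3 B) (\<Pi>\<^sub>M i\<in>{..<k}. borel) (\<lambda>w. \<lambda>i\<in>{..<k}. \<xi> i w) borel (\<xi> k)" if "k < n'" for k
    unfolding \<xi>_def using t0'(1) t that by (rule displacement_indep)
  have lip: "\<bar>norm x - norm y\<bar> \<le> norm (x - y)" for x y :: "real \<times> real \<times> real"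
    by (rule norm_triangle_ineq3)
  \<comment> \<open>Jensen's inequality for the norm: the step is centred, so \<open>x\<close> is
    the mean of \<open>x + \<xi> k\<close>.\<close>
  have drift: "0 \<le> (\<integral>w. norm (x + \<xi> k w) - norm x \<partial>wiener3 B)" if "k < n'" for k x
  proof -
    have int: "integrable (wiener3 B) (\<lambda>w. x + \<xi> k w)" using \<xi>[OF that] by simp
    have "norm x = norm (\<integral>w. x + \<xi> k w \<partial>wiener3 B)" using \<xi>[OF that] by (simp add: B3.prob_space)
    also have "\<dots> \<le> (\<integral>w. norm (x + \<xi> k w) \<partial>wiener3 B)" by (rule integral_norm_bound)
    finally show ?thesis using integrable_norm[OF int] by (simp add: B3.prob_space)
  qed
  note bound = B3.transform_integral_bound[where V = norm and \<xi> = \<xi> and n = n' and c = d,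
      OF indep \<xi>(2) lip drift]
  show "integrable (wiener3 B) S" unfolding S[abs_def] by (rule bound(1))
  show "(\<integral>w. \<bar>S w\<bar> \<partial>wiener3 B) \<le> 2 * sqrt (3 * (\<Sum>k<n. (c k)\<^sup>2 * (\<tau> (Suc k) - \<tau> k))) +
       mean_norm * (\<Sum>k<n. \<bar>c k\<bar> * (sqrt (\<tau> (Suc k)) - sqrt (\<tau> k)))"
    unfolding S Q R by (rule bound(2))
qed

end


section \<open>The Bessel law and the mixture over the gluing time\<close>

text \<open>Evaluation of a random path at a random time. The time is rounded down to a multiple of
  1/(n+1), which leaves countably many values, and continuity of the path gives the limit. Needed
  because the gluing time is itself an integration variable.\<close>

lemma measurable_path_eval:
  assumes F: "F \<in> M \<rightarrow>\<^sub>M path_space_inf" and [measurable]: "g \<in> borel_measurable M"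
    and g: "\<And>x. x \<in> space M \<Longrightarrow> 0 \<le> g x"
  shows "(\<lambda>x. F x (g x)) \<in> borel_measurable M"
proof (rule borel_measurable_LIMSEQ_real)
  define j where "j n x = nat \<lfloor>g x * real (Suc n)\<rfloor>" for n x
  show "(\<lambda>x. F x (real (j n x) / real (Suc n))) \<in> borel_measurable M" for n
  proof (rule measurable_compose_countable[where f = "\<lambda>i x. F x (real i / real (Suc n))"])
    show "(\<lambda>x. F x (real i / real (Suc n))) \<in> borel_measurable M" for i
      by (rule measurable_compose[OF F measurable_path_space_component]) simp
    show "j n \<in> M \<rightarrow>\<^sub>M count_space UNIV" unfolding j_def by measurable
  qed
  fix x assume x: "x \<in> space M"
  have cont: "continuous_on {0..} (F x)"
    using measurable_space[OF F x] by (simp add: space_path_space)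
  have "(\<lambda>n. real (j n x) / real (Suc n)) \<longlonglongrightarrow> g x"
  proof (rule tendsto_sandwich)
    have j: "g x * real (Suc n) - 1 \<le> real (j n x) \<and> real (j n x) \<le> g x * real (Suc n)" for n
      using g[OF x] unfolding j_def by (simp add: of_nat_nat)
    show "\<forall>\<^sub>F n in sequentially. g x - 1 / real (Suc n) \<le> real (j n x) / real (Suc n)"
    proof (intro always_eventually allI)
      fix n
      have "g x - 1 / real (Suc n) = (g x * real (Suc n) - 1) / real (Suc n)"
        by (simp add: diff_divide_distrib del: of_nat_Suc)
      then show "g x - 1 / real (Suc n) \<le> real (j n x) / real (Suc n)"
        using j[of n] by (simp add: divide_right_mono del: of_nat_Suc)
    qed
    show "\<forall>\<^sub>F n in sequentially. real (j n x) / real (Suc n) \<le> g x"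
      using j by (intro always_eventually allI) (simp add: pos_divide_le_eq del: of_nat_Suc)
    show "(\<lambda>n. g x - 1 / real (Suc n)) \<longlonglongrightarrow> g x"
      using tendsto_diff[OF tendsto_const LIMSEQ_inverse_real_of_nat, of "g x"] by (simp add: inverse_eq_divide)
  qed simp
  then show "(\<lambda>n. F x (real (j n x) / real (Suc n))) \<longlonglongrightarrow> F x (g x)"
    using g[OF x] by (intro continuous_on_tendsto_compose[OF cont]) (auto intro!: always_eventually)
qed

context wiener
begin

abbreviation "S \<equiv> sym_bessel3_law B"

lemma bessel3_map_measurable:
  "(\<lambda>(x, y, z). \<lambda>t\<in>{0..}. sqrt ((x t)\<^sup>2 + (y t)\<^sup>2 + (z t)\<^sup>2)) \<in> wiener3 B \<rightarrow>\<^sub>M path_space_inf"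
  unfolding wiener3_def by (rule measurable_bessel3[OF sets_B])

lemma bessel3_law_eq: "bessel3_law B = distr (wiener3 B) path_space_inf
     (\<lambda>(x, y, z). \<lambda>t\<in>{0..}. sqrt ((x t)\<^sup>2 + (y t)\<^sup>2 + (z t)\<^sup>2))"
  by (simp add: bessel3_law_def wiener3_def)

lemma prob_space_bessel3: "prob_space (bessel3_law B)"
  unfolding bessel3_law_eq by (intro B3.prob_space_distr bessel3_map_measurable)

lemma sets_bessel3[measurable_cong]: "sets (bessel3_law B) = sets path_space_inf"
  by (simp add: bessel3_law_eq)

lemma sets_S[measurable_cong]: "sets S = sets path_space_inf"
  unfolding sym_bessel3_law_def by (simp add: sets.sigma_sets_eq)

lemma AE_start: "AE w in wiener3 B. fst w 0 = 0 \<and> fst (snd w) 0 = 0 \<and> snd (snd w) 0 = 0"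
proof -
  have 0: "AE \<omega> in B. \<omega> 0 = 0" using wiener by (simp add: wiener_measure_def)
  have "AE w in wiener3 B. fst w 0 = 0"
    by (rule AE_distrD[OF measurable_coordinates(1)]) (unfold distr_coordinates, rule 0)
  moreover have "AE w in wiener3 B. fst (snd w) 0 = 0"
    by (rule AE_distrD[OF measurable_coordinates(2)]) (unfold distr_coordinates, rule 0)
  moreover have "AE w in wiener3 B. snd (snd w) 0 = 0"
    by (rule AE_distrD[OF measurable_coordinates(3)]) (unfold distr_coordinates, rule 0)
  ultimately show ?thesis by eventually_elim simp
qed

lemma emeasure_S_symmetric:
  assumes A: "A \<in> sets path_space_inf"
    and sym: "\<And>y. y \<in> space path_space_inf \<Longrightarrow> (\<lambda>t\<in>{0..}. - y t) \<in> A \<longleftrightarrow> y \<in> A"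
  shows "emeasure S A = emeasure (bessel3_law B) A"
proof -
  have sp: "space (bessel3_law B) = space path_space_inf" by (simp add: bessel3_law_eq)
  have m: "(\<lambda>\<omega>. \<lambda>t\<in>{0..}. - \<omega> t) \<in> bessel3_law B \<rightarrow>\<^sub>M path_space_inf"
    using measurable_neg_path by (simp cong: measurable_cong_sets add: sets_bessel3)
  have "(\<lambda>\<omega>. \<lambda>t\<in>{0..}. - \<omega> t) -` A \<inter> space (bessel3_law B) = A"
    using sym sets.sets_into_space[OF A] by (auto simp: sp)
  then have "emeasure (neg_bessel3_law B) A = emeasure (bessel3_law B) A"
    unfolding neg_bessel3_law_def using A m by (simp add: emeasure_distr)
  then show ?thesis
    by (simp add: emeasure_sym_bessel3_law[OF A] mult_2[symmetric] mult.commute[of 2] mult_divide_eq_ennreal)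
qed

lemma prob_space_S: "prob_space S"
proof
  have sp: "space S = space path_space_inf" "space (bessel3_law B) = space path_space_inf"
    by (rule sets_eq_imp_space_eq[OF sets_S], rule sets_eq_imp_space_eq[OF sets_bessel3])
  have "emeasure S (space S) = emeasure (bessel3_law B) (space (bessel3_law B))"
    unfolding sp using measurable_space[OF measurable_neg_path] by (intro emeasure_S_symmetric) auto
  then show "emeasure S (space S) = 1" using prob_space.emeasure_space_1[OF prob_space_bessel3] by simp
qed

sublocale S: prob_space S
  by (rule prob_space_S)

text \<open>On functionals blind to the sign of the path the two halves of the symmetrized law
  agree, so integrals under \<open>S\<close> become integrals under the Bessel law, which is an
  explicit image of \<open>wiener3 B\<close>.\<close>

lemma nn_integral_S_symmetric:
  assumes f: "f \<in> borel_measurable path_space_inf"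
    and sym: "\<And>y. y \<in> space path_space_inf \<Longrightarrow> f (\<lambda>t\<in>{0..}. - y t) = f y"
  shows "(\<integral>\<^sup>+y. f y \<partial>S) = (\<integral>\<^sup>+y. f y \<partial>bessel3_law B)"
proof -
  have fS: "f \<in> borel_measurable S" and fb: "f \<in> borel_measurable (bessel3_law B)"
    using f by (simp_all cong: measurable_cong_sets add: sets_S sets_bessel3)
  have sp: "space S = space path_space_inf" "space (bessel3_law B) = space path_space_inf"
    by (rule sets_eq_imp_space_eq[OF sets_S], rule sets_eq_imp_space_eq[OF sets_bessel3])
  have "distr S borel f = distr (bessel3_law B) borel f"
  proof (rule measure_eqI)
    fix E assume "E \<in> sets (distr S borel f)"
    then have E: "E \<in> sets borel" by simp
    have "emeasure S (f -` E \<inter> space path_space_inf) = emeasure (bessel3_law B) (f -` E \<inter> space path_space_inf)"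
      using measurable_sets[OF f E] sym measurable_space[OF measurable_neg_path]
      by (intro emeasure_S_symmetric) auto
    then show "emeasure (distr S borel f) E = emeasure (distr (bessel3_law B) borel f) E"
      using E by (simp add: emeasure_distr fS fb sp)
  qed simp
  then have "(\<integral>\<^sup>+x. x \<partial>distr S borel f) = (\<integral>\<^sup>+x. x \<partial>distr (bessel3_law B) borel f)" by simp
  then show ?thesis by (simp add: nn_integral_distr fS fb)
qed

lemma component_path_measurable: "0 \<le> s \<Longrightarrow> (\<lambda>\<omega>. \<omega> s) \<in> borel_measurable path_space_inf"
  by (rule measurable_path_space_component) simp

text \<open>Since the bridge ends at 0, this makes the matching condition in the concatenation hold
  almost surely.\<close>

lemma AE_S_start: "AE y in S. y 0 = 0"
proof -
  have [measurable]: "(\<lambda>y. y 0) \<in> borel_measurable path_space_inf" by (rule component_path_measurable) simp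
  define f :: "(real \<Rightarrow> real) \<Rightarrow> ennreal" where "f y = (if y 0 = 0 then 0 else 1)" for y
  have f: "f \<in> borel_measurable path_space_inf" unfolding f_def by measurable
  have "(\<integral>\<^sup>+y. f y \<partial>S) = (\<integral>\<^sup>+y. f y \<partial>bessel3_law B)"
    using f by (rule nn_integral_S_symmetric) (simp add: f_def)
  also have "\<dots> = (\<integral>\<^sup>+w. f ((\<lambda>(x, y, z). \<lambda>t\<in>{0..}. sqrt ((x t)\<^sup>2 + (y t)\<^sup>2 + (z t)\<^sup>2)) w) \<partial>wiener3 B)"
    unfolding bessel3_law_eq by (rule nn_integral_distr[OF bessel3_map_measurable]) (simp add: f)
  also have "\<dots> = (\<integral>\<^sup>+w. 0 \<partial>wiener3 B)"
    by (rule nn_integral_cong_AE) (use AE_start in eventually_elim, auto simp: f_def split: prod.splits)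
  finally have "(\<integral>\<^sup>+y. f y \<partial>S) = 0" by simp
  then have "AE y in S. f y = 0"
    by (subst (asm) nn_integral_0_iff_AE) (use f in \<open>simp_all cong: measurable_cong_sets add: sets_S\<close>)
  then show ?thesis by eventually_elim (simp add: f_def split: if_splits)
qed

lemma bessel3_map_eq:
  assumes "fst w 0 = 0 \<and> fst (snd w) 0 = 0 \<and> snd (snd w) 0 = 0" "0 \<le> t"
  shows "(\<lambda>(x, y, z). \<lambda>t\<in>{0..}. sqrt ((x t)\<^sup>2 + (y t)\<^sup>2 + (z t)\<^sup>2)) w t = norm (displacement 0 t w)"
  using assms by (auto simp: displacement_def norm_Pair add.assoc split: prod.splits)

lemma S_sum_bound:
  fixes \<tau> c :: "nat \<Rightarrow> real"
  assumes \<tau>: "\<tau> 0 = 0" "\<And>k. k < n \<Longrightarrow> \<tau> k \<le> \<tau> (Suc k)"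
  shows "(\<integral>\<^sup>+y. ennreal \<bar>\<Sum>k<n. c k * (y (\<tau> (Suc k)) - y (\<tau> k))\<bar> \<partial>S) \<le>
     ennreal (2 * sqrt (3 * (\<Sum>k<n. (c k)\<^sup>2 * (\<tau> (Suc k) - \<tau> k))) +
       mean_norm * (\<Sum>k<n. \<bar>c k\<bar> * (sqrt (\<tau> (Suc k)) - sqrt (\<tau> k))))"
proof -
  have pos: "0 \<le> \<tau> k" if "k \<le> n" for k
    using monotone_time_nonneg[of \<tau> n k] \<tau> that by simp
  let ?b = "\<lambda>(x, y, z). \<lambda>t\<in>{0..}. sqrt ((x t)\<^sup>2 + (y t)\<^sup>2 + (z t)\<^sup>2)"
  define f where "f y = ennreal \<bar>\<Sum>k<n. c k * (y (\<tau> (Suc k)) - y (\<tau> k))\<bar>" for y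
  have f: "f \<in> borel_measurable path_space_inf"
    unfolding f_def using pos
    by (intro measurable_compose[OF _ measurable_ennreal] borel_measurable_abs borel_measurable_sum
        borel_measurable_times borel_measurable_diff borel_measurable_const component_path_measurable) auto
  define R where "R w = (\<Sum>k<n. c k * (norm (displacement 0 (\<tau> (Suc k)) w) - norm (displacement 0 (\<tau> k) w)))" for w
  note R = norm_sum_bound[where \<tau> = \<tau> and n = n and c = c, OF \<tau>, folded R_def]
  have "(\<integral>\<^sup>+y. f y \<partial>S) = (\<integral>\<^sup>+y. f y \<partial>bessel3_law B)"
  proof (rule nn_integral_S_symmetric[OF f])
    fix y :: "real \<Rightarrow> real"
    have "(\<Sum>k<n. c k * ((\<lambda>t\<in>{0..}. - y t) (\<tau> (Suc k)) - (\<lambda>t\<in>{0..}. - y t) (\<tau> k))) =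
        - (\<Sum>k<n. c k * (y (\<tau> (Suc k)) - y (\<tau> k)))"
      using pos by (subst sum_negf[symmetric], intro sum.cong) (auto simp: algebra_simps)
    then show "f (\<lambda>t\<in>{0..}. - y t) = f y" unfolding f_def by (simp only: abs_minus_cancel)
  qed
  also have "\<dots> = (\<integral>\<^sup>+w. f (?b w) \<partial>wiener3 B)"
    unfolding bessel3_law_eq by (rule nn_integral_distr[OF bessel3_map_measurable]) (simp add: f)
  also have "\<dots> = (\<integral>\<^sup>+w. ennreal \<bar>R w\<bar> \<partial>wiener3 B)"
  proof (rule nn_integral_cong_AE)
    show "AE w in wiener3 B. f (?b w) = ennreal \<bar>R w\<bar>"
      using AE_start
    proof eventually_elim
      case (elim w)
      have "(\<Sum>k<n. c k * (?b w (\<tau> (Suc k)) - ?b w (\<tau> k))) = R w"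
        unfolding R_def using pos bessel3_map_eq[OF elim] by (intro sum.cong) auto
      then show ?case by (simp only: f_def)
    qed
  qed
  also have "\<dots> = ennreal (\<integral>w. \<bar>R w\<bar> \<partial>wiener3 B)"
    using R(1) by (intro nn_integral_eq_integral) (auto simp: R_def[abs_def])
  also have "\<dots> \<le> ennreal (2 * sqrt (3 * (\<Sum>k<n. (c k)\<^sup>2 * (\<tau> (Suc k) - \<tau> k))) +
       mean_norm * (\<Sum>k<n. \<bar>c k\<bar> * (sqrt (\<tau> (Suc k)) - sqrt (\<tau> k))))"
    using R(2) by (intro ennreal_leI) (simp add: R_def)
  finally show ?thesis by (simp add: f_def)
qed

section \<open>The gluing map and the mixtures of its image laws\<close>

text \<open>The value at \<open>u \<le> 0\<close> is immaterial; it only has to be a continuous path.\<close>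
definition glue :: "real \<times> (real \<Rightarrow> real) \<times> (real \<Rightarrow> real) \<Rightarrow> real \<Rightarrow> real" where
  "glue = (\<lambda>(u, \<omega>, y). let v = (if 0 < u then u else 1) in
     path_concat v (\<lambda>t\<in>{0..v}. \<omega> t - t / v * \<omega> v) y)"

text \<open>Measurability is joint, including the gluing time; this is what allows the integral over
  \<open>u\<close> of the concatenated laws to be a single image measure.\<close>

lemma measurable_glue: "glue \<in> borel \<Otimes>\<^sub>M B \<Otimes>\<^sub>M S \<rightarrow>\<^sub>M path_space_inf"
proof -
  let ?M = "borel \<Otimes>\<^sub>M B \<Otimes>\<^sub>M S :: (real \<times> (real \<Rightarrow> real) \<times> (real \<Rightarrow> real)) measure"
  define v where "v p = (if 0 < fst p then fst p else 1 :: real)"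
    for p :: "real \<times> (real \<Rightarrow> real) \<times> (real \<Rightarrow> real)"
  have vpos: "0 < v p" for p by (simp add: v_def)
  have [measurable]: "v \<in> borel_measurable ?M" unfolding v_def by measurable
  have \<omega>: "(\<lambda>p. fst (snd p)) \<in> ?M \<rightarrow>\<^sub>M path_space_inf"
    by (simp cong: measurable_cong_sets add: sets_B[symmetric])
  have y: "(\<lambda>p. snd (snd p)) \<in> ?M \<rightarrow>\<^sub>M path_space_inf"
    by (simp cong: measurable_cong_sets add: sets_S[symmetric])
  define F where "F p t = (if t < v p then (\<lambda>t\<in>{0..v p}. fst (snd p) t - t / v p * fst (snd p) (v p)) t
     else if (\<lambda>t\<in>{0..v p}. fst (snd p) t - t / v p * fst (snd p) (v p)) (v p) = snd (snd p) 0
       then snd (snd p) (t - v p)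
     else (\<lambda>t\<in>{0..v p}. fst (snd p) t - t / v p * fst (snd p) (v p)) (v p))" for p t
  have "(\<lambda>p. \<lambda>t\<in>{0..}. F p t) \<in> ?M \<rightarrow>\<^sub>M path_space_inf"
  proof (rule measurable_path_spaceI)
    fix p assume p: "p \<in> space ?M"
    have c: "continuous_on {0..} (fst (snd p))" "continuous_on {0..} (snd (snd p))"
      using measurable_space[OF \<omega> p] measurable_space[OF y p] by (auto simp: space_path_space)
    have "continuous_on {0..v p} (\<lambda>t. fst (snd p) t - t / v p * fst (snd p) (v p))"
      using continuous_on_subset[OF c(1), of "{0..v p}"] vpos[of p] by (intro continuous_intros) auto
    then have "continuous_on {0..v p} (\<lambda>t\<in>{0..v p}. fst (snd p) t - t / v p * fst (snd p) (v p))"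
      by (rule continuous_on_cong[THEN iffD1, rotated 2]) auto
    then show "continuous_on {0..} (F p)" unfolding F_def using vpos c(2) by (intro continuous_path_concat) auto
  next
    fix t :: real assume t: "t \<in> {0..}"
    have [measurable]: "(\<lambda>p. fst (snd p) (v p)) \<in> borel_measurable ?M"
      using vpos by (intro measurable_path_eval[OF \<omega>]) (auto simp: less_imp_le)
    have [measurable]: "(\<lambda>p. fst (snd p) t) \<in> borel_measurable ?M" "(\<lambda>p. snd (snd p) 0) \<in> borel_measurable ?M"
      using t by (auto intro!: measurable_path_eval[OF \<omega>] measurable_path_eval[OF y])
    \<comment> \<open>Truncation at 0 makes the evaluation time nonnegative everywhere; on the
      branch where this value is used it changes nothing.\<close>
    have [measurable]: "(\<lambda>p. snd (snd p) (max 0 (t - v p))) \<in> borel_measurable ?M"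
      by (intro measurable_path_eval[OF y]) auto
    have "F p t = (if t < v p then fst (snd p) t - t / v p * fst (snd p) (v p)
      else if fst (snd p) (v p) - v p / v p * fst (snd p) (v p) = snd (snd p) 0
       then snd (snd p) (max 0 (t - v p))
      else fst (snd p) (v p) - v p / v p * fst (snd p) (v p))" for p
      unfolding F_def using vpos[of p] t by (auto simp: max_def)
    then show "(\<lambda>p. F p t) \<in> borel_measurable ?M" by simp
  qed
  moreover have "glue = (\<lambda>p. \<lambda>t\<in>{0..}. F p t)"
  proof
    show "glue p = (\<lambda>t\<in>{0..}. F p t)" for p
      by (cases p) (simp only: glue_def F_def v_def path_concat_def Let_def case_prod_conv fst_conv snd_conv)
  qed
  ultimately show ?thesis by (simp only:)
qed

text \<open>The density is kept general so that one calculus covers \<open>script_W B\<close> itself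
  and the finite measures with Lebesgue measure on (0,T], in which the L1 estimates are
  made.\<close>

definition mixture :: "(real \<Rightarrow> ennreal) \<Rightarrow> (real \<Rightarrow> real) measure" where
  "mixture \<rho> = distr (density lborel \<rho> \<Otimes>\<^sub>M B \<Otimes>\<^sub>M S) path_space_inf glue"

lemma sets_mixture[simp]: "sets (mixture \<rho>) = sets path_space_inf" and
  space_mixture[simp]: "space (mixture \<rho>) = space path_space_inf"
  by (simp_all add: mixture_def)

sublocale BS: pair_prob_space B S ..

lemma measurable_glue': "sets N = sets borel \<Longrightarrow> glue \<in> N \<Otimes>\<^sub>M B \<Otimes>\<^sub>M S \<rightarrow>\<^sub>M path_space_inf"
  using measurable_glue by (simp cong: measurable_cong_sets sets_pair_measure_cong)

lemma nn_integral_mixture: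
  assumes [measurable]: "\<rho> \<in> borel_measurable borel" and h[measurable]: "h \<in> borel_measurable path_space_inf"
  shows "(\<integral>\<^sup>+x. h x \<partial>mixture \<rho>) = (\<integral>\<^sup>+u. \<rho> u * (\<integral>\<^sup>+p. h (glue (u, p)) \<partial>(B \<Otimes>\<^sub>M S)) \<partial>lborel)"
proof -
  have g[measurable]: "glue \<in> density lborel \<rho> \<Otimes>\<^sub>M B \<Otimes>\<^sub>M S \<rightarrow>\<^sub>M path_space_inf"
    "glue \<in> lborel \<Otimes>\<^sub>M B \<Otimes>\<^sub>M S \<rightarrow>\<^sub>M path_space_inf"
    by (auto intro!: measurable_glue')
  have "(\<integral>\<^sup>+x. h x \<partial>mixture \<rho>) = (\<integral>\<^sup>+q. h (glue q) \<partial>(density lborel \<rho> \<Otimes>\<^sub>M B \<Otimes>\<^sub>M S))"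
    unfolding mixture_def by (rule nn_integral_distr) auto
  also have "\<dots> = (\<integral>\<^sup>+u. \<integral>\<^sup>+p. h (glue (u, p)) \<partial>(B \<Otimes>\<^sub>M S) \<partial>density lborel \<rho>)"
    by (rule BS.nn_integral_fst[symmetric]) simp
  also have "\<dots> = (\<integral>\<^sup>+u. \<rho> u * (\<integral>\<^sup>+p. h (glue (u, p)) \<partial>(B \<Otimes>\<^sub>M S)) \<partial>lborel)"
    by (rule nn_integral_density) auto
  finally show ?thesis .
qed

lemma bridge_bessel_law_eq:
  assumes u: "0 < u"
  shows "bridge_bessel_law B u = distr (B \<Otimes>\<^sub>M S) path_space_inf (\<lambda>p. glue (u, p))"
proof -
  note br = measurable_bridge[OF sets_B u]
  have "bridge_law B u \<Otimes>\<^sub>M S = distr B (path_space {0..u}) (\<lambda>\<omega>. \<lambda>t\<in>{0..u}. \<omega> t - t / u * \<omega> u) \<Otimes>\<^sub>M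
      distr S S (\<lambda>x. x)"
    by (simp add: bridge_law_def)
  also have "\<dots> = distr (B \<Otimes>\<^sub>M S) (path_space {0..u} \<Otimes>\<^sub>M S) (\<lambda>(x, y). ((\<lambda>t\<in>{0..u}. x t - t / u * x u), y))"
    by (rule pair_measure_distr[OF br]) (simp_all add: S.sigma_finite_measure_axioms)
  finally have eq: "bridge_law B u \<Otimes>\<^sub>M S = \<dots>" .
  have m1: "(\<lambda>(x, y). path_concat u x y) \<in> path_space {0..u} \<Otimes>\<^sub>M S \<rightarrow>\<^sub>M path_space_inf"
    using measurable_path_concat[OF u] by (simp cong: measurable_cong_sets sets_pair_measure_cong add: sets_S)
  have m2: "(\<lambda>(x, y). ((\<lambda>t\<in>{0..u}. x t - t / u * x u), y)) \<in> B \<Otimes>\<^sub>M S \<rightarrow>\<^sub>M path_space {0..u} \<Otimes>\<^sub>M S"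
    using br by measurable
  show ?thesis
    unfolding bridge_bessel_law_def eq distr_distr[OF m1 m2]
    by (intro distr_cong) (auto simp: glue_def u)
qed

definition W_density :: "real \<Rightarrow> ennreal" where
  "W_density u = indicator {0<..} u * ennreal (1 / sqrt (2 * pi * u))"

lemma W_density_measurable[measurable]: "W_density \<in> borel_measurable borel"
  unfolding W_density_def by measurable

text \<open>\<open>script_W\<close> is specified by a set function through
  \<open>measure_of\<close>. That function agrees on the sigma-algebra with the values of an image
  measure, so it is countably additive and \<open>script_W B\<close> is that measure.\<close>

lemma script_W_eq: "script_W B = mixture W_density"
proof -
  have "script_W B = measure_of (space path_space_inf) (sets path_space_inf) (emeasure (mixture W_density))"
    unfolding script_W_def
  proof (rule measure_of_eq)
    show "sets path_space_inf \<subseteq> Pow (space path_space_inf)" by (rule sets.space_closed)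
    fix A assume "A \<in> sigma_sets (space path_space_inf) (sets path_space_inf)"
    then have A[measurable]: "A \<in> sets path_space_inf" by (simp add: sets.sigma_sets_eq)
    have "emeasure (mixture W_density) A = (\<integral>\<^sup>+x. indicator A x \<partial>mixture W_density)"
      by (rule nn_integral_indicator[symmetric]) simp
    also have "\<dots> = (\<integral>\<^sup>+u. W_density u * (\<integral>\<^sup>+p. indicator A (glue (u, p)) \<partial>(B \<Otimes>\<^sub>M S)) \<partial>lborel)"
      by (rule nn_integral_mixture) measurable
    also have "\<dots> = (\<integral>\<^sup>+u\<in>{0<..}. ennreal (1 / sqrt (2 * pi * u)) * emeasure (bridge_bessel_law B u) A \<partial>lborel)"
    proof (rule nn_integral_cong)
      fix u :: real
      have "emeasure (bridge_bessel_law B u) A = (\<integral>\<^sup>+p. indicator A (glue (u, p)) \<partial>(B \<Otimes>\<^sub>M S))" if "0 < u"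
      proof -
        have [measurable]: "(\<lambda>p. glue (u, p)) \<in> B \<Otimes>\<^sub>M S \<rightarrow>\<^sub>M path_space_inf"
          by (rule measurable_compose[OF _ measurable_glue]) simp
        have "emeasure (bridge_bessel_law B u) A = (\<integral>\<^sup>+x. indicator A x \<partial>bridge_bessel_law B u)"
          unfolding bridge_bessel_law_def by (rule nn_integral_indicator[symmetric]) simp
        also have "\<dots> = (\<integral>\<^sup>+p. indicator A (glue (u, p)) \<partial>(B \<Otimes>\<^sub>M S))"
          unfolding bridge_bessel_law_eq[OF that] by (rule nn_integral_distr) simp_all
        finally show ?thesis .
      qed
      then show "W_density u * (\<integral>\<^sup>+p. indicator A (glue (u, p)) \<partial>(B \<Otimes>\<^sub>M S)) =
          ennreal (1 / sqrt (2 * pi * u)) * emeasure (bridge_bessel_law B u) A * indicator {0<..} u"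
        by (cases "0 < u") (simp_all add: W_density_def)
    qed
    finally show "(\<integral>\<^sup>+u\<in>{0<..}. ennreal (1 / sqrt (2 * pi * u)) * emeasure (bridge_bessel_law B u) A \<partial>lborel) =
        emeasure (mixture W_density) A" ..
  qed
  also have "\<dots> = mixture W_density" using measure_of_of_measure[of "mixture W_density"] by simp
  finally show ?thesis .
qed


section \<open>The first moment of a step integral\<close>

lemma AE_pair_snd: "AE y in S. P y \<Longrightarrow> AE p in B \<Otimes>\<^sub>M S. P (snd p)"
  by (rule AE_distrD[of snd "B \<Otimes>\<^sub>M S" S])
    (simp, unfold distr_pair_snd[OF S.sigma_finite_measure_axioms])

text \<open>Almost surely the glued path is the stopped bridge plus a delayed Bessel path: before
  \<open>u\<close> the second summand is \<open>snd p 0\<close> = 0, after \<open>u\<close> the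
  bridge rests at 0. The sum has no case distinction, so linear functionals separate into a function
  of \<open>\<omega>\<close> and one of \<open>y\<close>.\<close>

lemma AE_glue:
  assumes u: "0 < u"
  shows "AE p in B \<Otimes>\<^sub>M S. \<forall>t\<ge>0. glue (u, p) t =
    fst p (min t u) - min t u / u * fst p u + snd p (max (t - u) 0)"
proof -
  show ?thesis
    using AE_pair_snd[OF AE_S_start]
  proof eventually_elim
    case (elim p)
    show ?case
    proof (intro allI impI)
      fix t :: real assume "0 \<le> t"
      then show "glue (u, p) t = fst p (min t u) - min t u / u * fst p u + snd p (max (t - u) 0)"
        using u elim by (cases "t < u") (auto simp: glue_def path_concat_def case_prod_beta min_def max_def)
    qed
  qed
qed

text \<open>The bridge is linear in the Brownian path: the sum is a Wiener integral \<open>A\<close>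
  over the clipped grid minus \<open>K / u\<close> times the increment over [0,u]. The first term
  contributes 2 and the second 1 to the constant 3.\<close>

lemma bridge_sum_bound:
  fixes t c :: "nat \<Rightarrow> real"
  assumes t: "t 0 = 0" "\<And>k. k < n \<Longrightarrow> t k \<le> t (Suc k)" and u: "0 < u"
  defines "br \<equiv> \<lambda>\<omega> s. \<omega> (min s u) - min s u / u * \<omega> u"
  shows "(\<integral>\<^sup>+\<omega>. ennreal \<bar>\<Sum>k<n. c k * (br \<omega> (t (Suc k)) - br \<omega> (t k))\<bar> \<partial>B) \<le>
    ennreal (3 * sqrt (\<Sum>k<n. (c k)\<^sup>2 * (t (Suc k) - t k)))"
proof -
  define \<sigma> where "\<sigma> k = min (t k) u" for k
  define Q where "Q = (\<Sum>k<n. (c k)\<^sup>2 * (t (Suc k) - t k))"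
  have \<sigma>0: "\<sigma> 0 = 0" using t u by (simp add: \<sigma>_def)
  have \<sigma>: "\<sigma> k \<le> \<sigma> (Suc k)" if "k < n" for k using t(2)[OF that] by (auto simp: \<sigma>_def)
  have Q': "(\<Sum>k<n. (c k)\<^sup>2 * (\<sigma> (Suc k) - \<sigma> k)) \<le> Q"
    unfolding Q_def using t(2) by (intro sum_sq_le_time_change) (force simp: \<sigma>_def)
  define A where "A \<omega> = (\<Sum>k<n. c k * (\<omega> (\<sigma> (Suc k)) - \<omega> (\<sigma> k)))" for \<omega> :: "real \<Rightarrow> real"
  define K where "K = (\<Sum>k<n. c k * (\<sigma> (Suc k) - \<sigma> k))"
  note A = wiener_sum_bound[where \<tau> = \<sigma> and n = n and c = c, OF eq_refl[OF \<sigma>0[symmetric]] \<sigma>, folded A_def]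
  \<comment> \<open>\<open>K\<close> is the integral of the step function over [0,u], so this is
    Cauchy-Schwarz, with each weight \<open>\<sigma> (Suc k) - \<sigma> k\<close> split into two
    square roots. Multiplied by the mean of |B_u|, at most sqrt u, and divided by u, it leaves sqrt
    Q.\<close>
  have K2: "K\<^sup>2 \<le> Q * u"
  proof -
    have "K = (\<Sum>k<n. (c k * sqrt (\<sigma> (Suc k) - \<sigma> k)) * sqrt (\<sigma> (Suc k) - \<sigma> k))"
      unfolding K_def using \<sigma> by (intro sum.cong) auto
    then have "K\<^sup>2 \<le> (\<Sum>k<n. (c k * sqrt (\<sigma> (Suc k) - \<sigma> k))\<^sup>2) * (\<Sum>k<n. (sqrt (\<sigma> (Suc k) - \<sigma> k))\<^sup>2)"
      using Cauchy_Schwarz_ineq_sum[of "\<lambda>k. c k * sqrt (\<sigma> (Suc k) - \<sigma> k)" "\<lambda>k. sqrt (\<sigma> (Suc k) - \<sigma> k)" "{..<n}"]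
      by simp
    also have "(\<Sum>k<n. (c k * sqrt (\<sigma> (Suc k) - \<sigma> k))\<^sup>2) = (\<Sum>k<n. (c k)\<^sup>2 * (\<sigma> (Suc k) - \<sigma> k))"
      using \<sigma> by (intro sum.cong) (auto simp: power_mult_distrib)
    also have "(\<Sum>k<n. (sqrt (\<sigma> (Suc k) - \<sigma> k))\<^sup>2) = (\<Sum>k<n. \<sigma> (Suc k) - \<sigma> k)"
      using \<sigma> by (intro sum.cong) auto
    also have "\<dots> = \<sigma> n" by (simp add: sum_lessThan_telescope \<sigma>0)
    also have "(\<Sum>k<n. (c k)\<^sup>2 * (\<sigma> (Suc k) - \<sigma> k)) * \<sigma> n \<le> Q * u"
    proof (rule mult_mono[OF Q'])
      show "0 \<le> Q" using t(2) unfolding Q_def by (intro sum_nonneg) auto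
      show "0 \<le> \<sigma> n" using monotone_time_nonneg[of \<sigma> n n] \<sigma>0 \<sigma> by simp
    qed (simp add: \<sigma>_def)
    finally show ?thesis .
  qed
  have Q0: "0 \<le> Q" using t(2) unfolding Q_def by (intro sum_nonneg) auto
  define Z where "Z \<omega> = \<omega> u - \<omega> 0" for \<omega> :: "real \<Rightarrow> real"
  have Z: "integrable B Z" "expectation (\<lambda>\<omega>. \<bar>Z \<omega>\<bar>) \<le> sqrt u"
  proof -
    show int: "integrable B Z" unfolding Z_def using u by (intro increment_integrable) auto
    have "(expectation (\<lambda>\<omega>. \<bar>Z \<omega>\<bar>))\<^sup>2 \<le> expectation (\<lambda>\<omega>. \<bar>Z \<omega>\<bar>\<^sup>2)"
      using int increment_integrable(2)[of 0 u] u by (intro expectation_power2_le(2)) (auto simp: Z_def)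
    also have "\<dots> = u" unfolding Z_def using increment_moment(3)[of 0 u] u by simp
    finally show "expectation (\<lambda>\<omega>. \<bar>Z \<omega>\<bar>) \<le> sqrt u" by (rule real_le_rsqrt)
  qed
  have "AE \<omega> in B. \<omega> 0 = 0" using wiener by (simp add: wiener_measure_def)
  then have "AE \<omega> in B. ennreal \<bar>\<Sum>k<n. c k * (br \<omega> (t (Suc k)) - br \<omega> (t k))\<bar> = ennreal \<bar>A \<omega> - K / u * Z \<omega>\<bar>"
  proof eventually_elim
    case (elim \<omega>)
    have "(\<Sum>k<n. c k * (br \<omega> (t (Suc k)) - br \<omega> (t k))) = A \<omega> - K / u * Z \<omega>"
    proof -
      have "K / u * Z \<omega> = (\<Sum>k<n. c k * (\<sigma> (Suc k) - \<sigma> k) / u * \<omega> u)"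
        by (simp add: K_def Z_def elim sum_divide_distrib sum_distrib_right)
      then show ?thesis
        unfolding A_def sum_subtractf[symmetric]
        by (simp only: sum_subtractf[symmetric])
          (intro sum.cong refl, simp add: br_def \<sigma>_def algebra_simps diff_divide_distrib)
    qed
    then show ?case by simp
  qed
  then have "(\<integral>\<^sup>+\<omega>. ennreal \<bar>\<Sum>k<n. c k * (br \<omega> (t (Suc k)) - br \<omega> (t k))\<bar> \<partial>B) =
      (\<integral>\<^sup>+\<omega>. ennreal \<bar>A \<omega> - K / u * Z \<omega>\<bar> \<partial>B)"
    by (rule nn_integral_cong_AE)
  also have "\<dots> = ennreal (expectation (\<lambda>\<omega>. \<bar>A \<omega> - K / u * Z \<omega>\<bar>))"
    using A(1) Z(1) by (intro nn_integral_eq_integral) (auto simp: A_def[abs_def])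
  also have "\<dots> \<le> ennreal (3 * sqrt Q)"
  proof (rule ennreal_leI)
    have "expectation (\<lambda>\<omega>. \<bar>A \<omega> - K / u * Z \<omega>\<bar>) \<le> expectation (\<lambda>\<omega>. \<bar>A \<omega>\<bar> + \<bar>K\<bar> / u * \<bar>Z \<omega>\<bar>)"
    proof (rule integral_mono)
      show "\<bar>A \<omega> - K / u * Z \<omega>\<bar> \<le> \<bar>A \<omega>\<bar> + \<bar>K\<bar> / u * \<bar>Z \<omega>\<bar>" for \<omega>
        using abs_triangle_ineq4[of "A \<omega>" "K / u * Z \<omega>"] u by (simp add: abs_mult)
    qed (use A(1) Z(1) in \<open>auto simp: A_def[abs_def]\<close>)
    also have "\<dots> = expectation (\<lambda>\<omega>. \<bar>A \<omega>\<bar>) + \<bar>K\<bar> / u * expectation (\<lambda>\<omega>. \<bar>Z \<omega>\<bar>)"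
      using A(1) Z(1) by (simp add: A_def[abs_def])
    also have "\<dots> \<le> 2 * sqrt Q + \<bar>K\<bar> / u * sqrt u"
    proof (rule add_mono)
      have "expectation (\<lambda>\<omega>. \<bar>A \<omega>\<bar>) \<le> 2 * sqrt (\<Sum>k<n. (c k)\<^sup>2 * (\<sigma> (Suc k) - \<sigma> k))"
        using A(2) .
      then show "expectation (\<lambda>\<omega>. \<bar>A \<omega>\<bar>) \<le> 2 * sqrt Q" using real_sqrt_le_mono[OF Q'] by linarith
      show "\<bar>K\<bar> / u * expectation (\<lambda>\<omega>. \<bar>Z \<omega>\<bar>) \<le> \<bar>K\<bar> / u * sqrt u"
        using Z(2) u by (intro mult_left_mono) auto
    qed
    also have "\<bar>K\<bar> \<le> sqrt Q * sqrt u"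
      using K2 by (simp add: real_sqrt_mult[symmetric] real_le_rsqrt)
    then have "\<bar>K\<bar> / u * sqrt u \<le> (sqrt Q * sqrt u) / u * sqrt u"
      using u by (intro mult_right_mono divide_right_mono) auto
    also have "\<dots> = sqrt Q" using u by (simp add: field_simps)
    finally show "expectation (\<lambda>\<omega>. \<bar>A \<omega> - K / u * Z \<omega>\<bar>) \<le> 3 * sqrt Q" by simp
  qed
  finally show ?thesis by (simp add: Q_def)
qed

lemma glue_step_bound:
  fixes t c :: "nat \<Rightarrow> real"
  assumes t: "t 0 = 0" "\<And>k. k < n \<Longrightarrow> t k \<le> t (Suc k)" and u: "0 < u"
  defines "Q \<equiv> \<Sum>k<n. (c k)\<^sup>2 * (t (Suc k) - t k)"
  shows "(\<integral>\<^sup>+p. ennreal \<bar>\<Sum>k<n. c k * (glue (u, p) (t (Suc k)) - glue (u, p) (t k))\<bar> \<partial>(B \<Otimes>\<^sub>M S)) \<le>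
    ennreal (3 * sqrt Q + 2 * sqrt (3 * Q) +
      mean_norm * (\<Sum>k<n. \<bar>c k\<bar> * (sqrt (max (t (Suc k) - u) 0) - sqrt (max (t k - u) 0))))"
proof -
  have pos: "0 \<le> t k" if "k \<le> n" for k
    using monotone_time_nonneg[of t n k] t that by simp
  define br where "br \<omega> s = \<omega> (min s u) - min s u / u * \<omega> u" for \<omega> :: "real \<Rightarrow> real" and s
  define \<tau> where "\<tau> k = max (t k - u) 0" for k
  define a where "a \<omega> = (\<Sum>k<n. c k * (br \<omega> (t (Suc k)) - br \<omega> (t k)))" for \<omega>
  define b where "b y = (\<Sum>k<n. c k * (y (\<tau> (Suc k)) - y (\<tau> k)))" for y :: "real \<Rightarrow> real"
  have Q0: "0 \<le> Q" using t(2) unfolding Q_def by (intro sum_nonneg) auto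
  have \<tau>0: "\<tau> 0 = 0" using t u by (simp add: \<tau>_def)
  have \<tau>: "\<tau> k \<le> \<tau> (Suc k)" if "k < n" for k using t(2)[OF that] by (auto simp: \<tau>_def)
  have "(\<lambda>y. y (\<tau> k)) \<in> borel_measurable S" for k
    using component_path_measurable[of "\<tau> k"] by (simp cong: measurable_cong_sets add: sets_S \<tau>_def)
  then have [measurable]: "b \<in> borel_measurable S"
    unfolding b_def by (intro borel_measurable_sum borel_measurable_times borel_measurable_diff) auto
  have "(\<lambda>\<omega>. br \<omega> (t k)) \<in> borel_measurable B" if "k \<le> n" for k
    unfolding br_def using pos[OF that] u
    by (intro borel_measurable_diff borel_measurable_times measurable_component borel_measurable_const) auto
  then have [measurable]: "a \<in> borel_measurable B"
    unfolding a_def by (intro borel_measurable_sum borel_measurable_times borel_measurable_diff) auto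
  have "AE p in B \<Otimes>\<^sub>M S. ennreal \<bar>\<Sum>k<n. c k * (glue (u, p) (t (Suc k)) - glue (u, p) (t k))\<bar> =
      ennreal \<bar>a (fst p) + b (snd p)\<bar>"
    using AE_glue[OF u]
  proof eventually_elim
    case (elim p)
    have "c k * (glue (u, p) (t (Suc k)) - glue (u, p) (t k)) =
        c k * (br (fst p) (t (Suc k)) - br (fst p) (t k)) + c k * (snd p (\<tau> (Suc k)) - snd p (\<tau> k))"
      if "k < n" for k
    proof -
      have "glue (u, p) (t j) = br (fst p) (t j) + snd p (\<tau> j)" if "j \<le> n" for j
        using elim pos[OF that] unfolding br_def \<tau>_def by blast
      from this[of k] this[of "Suc k"] show ?thesis using that by (simp add: algebra_simps)
    qed
    then have "(\<Sum>k<n. c k * (glue (u, p) (t (Suc k)) - glue (u, p) (t k))) = a (fst p) + b (snd p)"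
      unfolding a_def b_def sum.distrib[symmetric] by (intro sum.cong) auto
    then show ?case by simp
  qed
  then have "(\<integral>\<^sup>+p. ennreal \<bar>\<Sum>k<n. c k * (glue (u, p) (t (Suc k)) - glue (u, p) (t k))\<bar> \<partial>(B \<Otimes>\<^sub>M S)) =
      (\<integral>\<^sup>+p. ennreal \<bar>a (fst p) + b (snd p)\<bar> \<partial>(B \<Otimes>\<^sub>M S))"
    by (rule nn_integral_cong_AE)
  also have "\<dots> \<le> (\<integral>\<^sup>+p. ennreal \<bar>a (fst p)\<bar> + ennreal \<bar>b (snd p)\<bar> \<partial>(B \<Otimes>\<^sub>M S))"
    by (intro nn_integral_mono) (simp add: ennreal_plus[symmetric] abs_triangle_ineq del: ennreal_plus)
  also have "\<dots> = (\<integral>\<^sup>+\<omega>. \<integral>\<^sup>+y. ennreal \<bar>a \<omega>\<bar> + ennreal \<bar>b y\<bar> \<partial>S \<partial>B)"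
    by (subst S.nn_integral_fst[symmetric]) simp_all
  also have "\<dots> = (\<integral>\<^sup>+\<omega>. ennreal \<bar>a \<omega>\<bar> \<partial>B) + (\<integral>\<^sup>+y. ennreal \<bar>b y\<bar> \<partial>S)"
    by (simp add: nn_integral_add emeasure_space_1 S.emeasure_space_1)
  also have "\<dots> \<le> ennreal (3 * sqrt Q) + ennreal (2 * sqrt (3 * (\<Sum>k<n. (c k)\<^sup>2 * (\<tau> (Suc k) - \<tau> k))) +
       mean_norm * (\<Sum>k<n. \<bar>c k\<bar> * (sqrt (\<tau> (Suc k)) - sqrt (\<tau> k))))"
    unfolding a_def b_def br_def Q_def
    by (intro add_mono bridge_sum_bound[OF t u] S_sum_bound[OF \<tau>0 \<tau>])
  also have "\<dots> \<le> ennreal (3 * sqrt Q) + ennreal (2 * sqrt (3 * Q) +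
       mean_norm * (\<Sum>k<n. \<bar>c k\<bar> * (sqrt (\<tau> (Suc k)) - sqrt (\<tau> k))))"
  proof (intro add_mono order_refl ennreal_leI mult_left_mono real_sqrt_le_mono)
    show "(\<Sum>k<n. (c k)\<^sup>2 * (\<tau> (Suc k) - \<tau> k)) \<le> Q"
      unfolding Q_def using t(2) by (intro sum_sq_le_time_change) (force simp: \<tau>_def)
  qed auto
  also have "\<dots> = ennreal (3 * sqrt Q + (2 * sqrt (3 * Q) +
       mean_norm * (\<Sum>k<n. \<bar>c k\<bar> * (sqrt (\<tau> (Suc k)) - sqrt (\<tau> k)))))"
    using Q0 mean_norm_nonneg \<tau>
    by (intro ennreal_plus[symmetric] add_nonneg_nonneg mult_nonneg_nonneg sum_nonneg) auto
  finally show ?thesis by (simp add: \<tau>_def add.assoc)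
qed

text \<open>The first summand collects the two L2 contributions, bridge and Bessel martingale,
  integrated over (0,T]; the second is the drift after integration in \<open>u\<close>.\<close>

definition norm_const :: "real \<Rightarrow> real" where
  "norm_const T = T * (3 + 2 * sqrt 3) + mean_norm * (T + sqrt T)"

text \<open>The central estimate. The slice bound of \<open>glue_step_bound\<close> is integrated in
  \<open>u\<close>, where \<open>integral_sqrt_increment_le\<close> turns the drift into the
  weighted L1 norm. The square root of \<open>x\<close> appears because \<open>x\<close> dominates
  the square of the L2 norm.\<close>

lemma step_integral_mixture_bound:
  assumes g: "step_function g" and T: "0 < T" and x: "0 \<le> x"
    and N: "(\<integral>\<^sup>+s. ennreal (\<bar>g s\<bar>\<^sup>2) \<partial>lebesgue_on {0..}) +
      (\<integral>\<^sup>+s. ennreal (\<bar>g s\<bar> / (1 + sqrt s)) \<partial>lebesgue_on {0..}) \<le> ennreal x"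
  shows "(\<integral>\<^sup>+\<omega>. ennreal \<bar>step_integral g \<omega>\<bar> \<partial>mixture (indicator {0<..T})) \<le>
    ennreal (norm_const T * (sqrt x + x))"
proof -
  obtain n c t where t0: "t 0 = 0" and t: "\<And>k. k < n \<Longrightarrow> t k < t (Suc k)"
    and I: "\<And>\<omega>. step_integral g \<omega> = (\<Sum>k<n. c k * (\<omega> (t (Suc k)) - \<omega> (t k)))"
    and gv: "\<And>k s. k < n \<Longrightarrow> t k \<le> s \<Longrightarrow> s < t (Suc k) \<Longrightarrow> g s = c k"
    and pos: "\<And>k. k \<le> n \<Longrightarrow> 0 \<le> t k"
    by (rule step_function_shifted_rep[OF g]) blast
  have t': "t k \<le> t (Suc k)" if "k < n" for k using t[OF that] by simp
  define Q where "Q = (\<Sum>k<n. (c k)\<^sup>2 * (t (Suc k) - t k))"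
  define L where "L = (\<Sum>k<n. \<bar>c k\<bar> * integral {t k..t (Suc k)} (\<lambda>x. 1 / (1 + sqrt x)))"
  have "ennreal (\<Sum>k<n. \<bar>c k\<bar>\<^sup>2 * integral {t k..t (Suc k)} (\<lambda>_. 1)) \<le>
      (\<integral>\<^sup>+s. ennreal (\<bar>g s\<bar>\<^sup>2 * 1) \<partial>lebesgue_on {0..})"
    by (rule nn_integral_step_function_ge[where \<psi> = "\<lambda>x. \<bar>x\<bar>\<^sup>2" and f = g and h = "\<lambda>_. 1" and c = c and t = t and m = n, OF pos t gv]) auto
  also have "(\<Sum>k<n. \<bar>c k\<bar>\<^sup>2 * integral {t k..t (Suc k)} (\<lambda>_. 1)) = Q"
    unfolding Q_def using t' by (intro sum.cong) auto
  finally have "ennreal Q \<le> ennreal x" using order_trans[OF add_increasing2[OF zero_le order_refl] N] by simp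
  then have Qx: "Q \<le> x" using x by simp
  have "ennreal L \<le> (\<integral>\<^sup>+s. ennreal (\<bar>g s\<bar> * (1 / (1 + sqrt s))) \<partial>lebesgue_on {0..})"
    unfolding L_def
  proof (rule nn_integral_step_function_ge[where \<psi> = abs and f = g and h = "\<lambda>x. 1 / (1 + sqrt x)"
        and c = c and t = t and m = n, OF pos t gv])
    show "(\<lambda>x. 1 / (1 + sqrt x)) integrable_on {t k..t (Suc k)}" if "k < n" for k
    proof (intro integrable_continuous_real continuous_intros ballI)
      fix s assume "s \<in> {t k..t (Suc k)}"
      then have "0 \<le> sqrt s" using pos[of k] that by simp
      then show "1 + sqrt s \<noteq> 0" by linarith
    qed
  qed (auto simp: add_nonneg_nonneg)
  also have "\<dots> \<le> ennreal x" using order_trans[OF add_increasing[OF zero_le order_refl] N] by simp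
  finally have Lx: "L \<le> x" using x by simp
  have Q0: "0 \<le> Q" using t' unfolding Q_def by (intro sum_nonneg) auto
  define E where "E = 3 * sqrt Q + 2 * sqrt (3 * Q)"
  have E0: "0 \<le> E" using Q0 by (simp add: E_def)
  define f where "f u = E + mean_norm * (\<Sum>k<n. \<bar>c k\<bar> * (sqrt (max (t (Suc k) - u) 0) - sqrt (max (t k - u) 0)))" for u
  have f0: "0 \<le> f u" for u
  proof -
    have "sqrt (max (t k - u) 0) \<le> sqrt (max (t (Suc k) - u) 0)" if "k < n" for k
      using t'[OF that] by (intro real_sqrt_le_mono max.mono) auto
    then show ?thesis
      unfolding f_def using E0 mean_norm_nonneg
      by (intro add_nonneg_nonneg mult_nonneg_nonneg sum_nonneg) (auto simp del: real_sqrt_le_iff)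
  qed
  have fint: "f integrable_on {0..T}"
    unfolding f_def by (intro integrable_continuous_real continuous_intros)
  have "(\<lambda>\<omega>. ennreal \<bar>step_integral g \<omega>\<bar>) \<in> borel_measurable path_space_inf"
    using step_integral_measurable[OF g] by measurable
  then have "(\<integral>\<^sup>+\<omega>. ennreal \<bar>step_integral g \<omega>\<bar> \<partial>mixture (indicator {0<..T})) =
      (\<integral>\<^sup>+u. indicator {0<..T} u * (\<integral>\<^sup>+p. ennreal \<bar>step_integral g (glue (u, p))\<bar> \<partial>(B \<Otimes>\<^sub>M S)) \<partial>lborel)"
    by (intro nn_integral_mixture) auto
  also have "\<dots> \<le> (\<integral>\<^sup>+u\<in>{0..T}. ennreal (f u) \<partial>lborel)"
  proof (rule nn_integral_mono)
    fix u
    show "indicator {0<..T} u * (\<integral>\<^sup>+p. ennreal \<bar>step_integral g (glue (u, p))\<bar> \<partial>(B \<Otimes>\<^sub>M S)) \<le> ennreal (f u) * indicator {0..T} u"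
    proof (cases "u \<in> {0<..T}")
      case True
      then show ?thesis
        using glue_step_bound[where t = t and n = n and c = c and u = u, OF t0 t'] by (simp add: I f_def E_def Q_def)
    qed simp
  qed
  also have "\<dots> = ennreal (integral {0..T} f)"
    using f0 fint by (intro nn_integral_has_integral_lebesgue' integrable_integral) auto
  also have "\<dots> \<le> ennreal (norm_const T * (sqrt x + x))"
  proof (rule ennreal_leI)
    have i: "(\<lambda>u. sqrt (max (t (Suc k) - u) 0) - sqrt (max (t k - u) 0)) integrable_on {0..T}" for k
      by (intro integrable_continuous_real continuous_intros)
    have "integral {0..T} f = T * E + mean_norm * (\<Sum>k<n. \<bar>c k\<bar> *
        integral {0..T} (\<lambda>u. sqrt (max (t (Suc k) - u) 0) - sqrt (max (t k - u) 0)))"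
      unfolding f_def using T i
      by (subst Henstock_Kurzweil_Integration.integral_add)
        (auto intro!: integrable_continuous_real continuous_intros simp: integral_sum integrable_on_mult_right)
    also have "\<dots> \<le> T * E + mean_norm * (\<Sum>k<n. \<bar>c k\<bar> *
        ((T + sqrt T) * integral {t k..t (Suc k)} (\<lambda>x. 1 / (1 + sqrt x))))"
      using mean_norm_nonneg T pos t'
      by (intro add_mono mult_left_mono sum_mono order_refl integral_sqrt_increment_le) auto
    also have "\<dots> = T * E + mean_norm * ((T + sqrt T) * L)"
      by (simp add: L_def sum_distrib_left mult_ac)
    also have "E = (3 + 2 * sqrt 3) * sqrt Q" by (simp add: E_def real_sqrt_mult algebra_simps)
    also have "T * ((3 + 2 * sqrt 3) * sqrt Q) + mean_norm * ((T + sqrt T) * L) \<le>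
        T * ((3 + 2 * sqrt 3) * sqrt x) + mean_norm * ((T + sqrt T) * x)"
      using Qx Lx T mean_norm_nonneg by (intro add_mono mult_left_mono) auto
    \<comment> \<open>Two nonnegative cross terms are added so that a common factor can be taken
      out.\<close>
    also have "\<dots> \<le> norm_const T * (sqrt x + x)"
    proof -
      have "0 \<le> T * (3 + 2 * sqrt 3) * x" "0 \<le> mean_norm * (T + sqrt T) * sqrt x"
        using T x mean_norm_nonneg by auto
      then show ?thesis unfolding norm_const_def by (simp add: algebra_simps)
    qed
    finally show "integral {0..T} f \<le> norm_const T * (sqrt x + x)" .
  qed
  finally show ?thesis .
qed


section \<open>Existence of the limit\<close>

lemma emeasure_mixture:
  assumes [measurable]: "\<rho> \<in> borel_measurable borel" "A \<in> sets path_space_inf"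
  shows "emeasure (mixture \<rho>) A = (\<integral>\<^sup>+u. \<rho> u * (\<integral>\<^sup>+p. indicator A (glue (u, p)) \<partial>(B \<Otimes>\<^sub>M S)) \<partial>lborel)"
proof -
  have "emeasure (mixture \<rho>) A = (\<integral>\<^sup>+x. indicator A x \<partial>mixture \<rho>)"
    by (rule nn_integral_indicator[symmetric]) simp
  also have "\<dots> = (\<integral>\<^sup>+u. \<rho> u * (\<integral>\<^sup>+p. indicator A (glue (u, p)) \<partial>(B \<Otimes>\<^sub>M S)) \<partial>lborel)"
    by (rule nn_integral_mixture) measurable
  finally show ?thesis .
qed

lemma borel_measurable_glue_integral:
  assumes [measurable]: "h \<in> borel_measurable path_space_inf"
  shows "(\<lambda>u. \<integral>\<^sup>+p. h (glue (u, p)) \<partial>(B \<Otimes>\<^sub>M S)) \<in> borel_measurable borel"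
proof -
  note measurable_glue[measurable]
  have "(\<lambda>(u, p). h (glue (u, p))) \<in> borel_measurable (borel \<Otimes>\<^sub>M B \<Otimes>\<^sub>M S)" by measurable
  then show ?thesis by (rule BS.borel_measurable_nn_integral)
qed

lemma measurable_glue_section[measurable]: "(\<lambda>p. glue (u, p)) \<in> B \<Otimes>\<^sub>M S \<rightarrow>\<^sub>M path_space_inf"
  by (rule measurable_compose[OF _ measurable_glue]) simp

text \<open>Gluing times outside \<open>{r..1 / r}\<close> are charged to \<open>A\<close> alone.
  Inside, the density of \<open>script_W\<close> is at most 1 / sqrt(2 pi r), and Markov's
  inequality is applied on each slice.\<close>

lemma W_local_bound:
  fixes h :: "(real \<Rightarrow> real) \<Rightarrow> real"
  assumes h[measurable]: "h \<in> borel_measurable path_space_inf" and A[measurable]: "A \<in> sets path_space_inf"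
    and e: "0 < e" and r: "0 < r"
  shows "emeasure (mixture W_density) (A \<inter> {x \<in> space path_space_inf. e \<le> \<bar>h x\<bar>}) \<le>
     (\<integral>\<^sup>+u. W_density u * (\<integral>\<^sup>+p. indicator A (glue (u, p)) \<partial>(B \<Otimes>\<^sub>M S)) * indicator (- {r..1 / r}) u \<partial>lborel) +
     ennreal (1 / sqrt (2 * pi * r) / e) * (\<integral>\<^sup>+x. ennreal \<bar>h x\<bar> \<partial>mixture (indicator {0<..1 / r}))"
proof -
  let ?E = "{x \<in> space path_space_inf. e \<le> \<bar>h x\<bar>}"
  define pr where "pr D u = (\<integral>\<^sup>+p. indicator D (glue (u, p)) \<partial>(B \<Otimes>\<^sub>M S))" for D u
  define G where "G u = (\<integral>\<^sup>+p. ennreal \<bar>h (glue (u, p))\<bar> \<partial>(B \<Otimes>\<^sub>M S))" for u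
  have [measurable]: "G \<in> borel_measurable borel"
    unfolding G_def by (rule borel_measurable_glue_integral[where h = "\<lambda>x. ennreal \<bar>h x\<bar>"]) measurable
  have [measurable]: "pr D \<in> borel_measurable borel" if "D \<in> sets path_space_inf" for D
    unfolding pr_def using that by (intro borel_measurable_glue_integral) simp
  have "emeasure (mixture W_density) (A \<inter> ?E) = (\<integral>\<^sup>+u. W_density u * pr (A \<inter> ?E) u \<partial>lborel)"
    unfolding pr_def by (rule emeasure_mixture) measurable
  also have "\<dots> \<le> (\<integral>\<^sup>+u. W_density u * pr A u * indicator (- {r..1 / r}) u +
      ennreal (1 / sqrt (2 * pi * r) / e) * (indicator {0<..1 / r} u * G u) \<partial>lborel)"
  proof (rule nn_integral_mono)
    fix u
    have 1: "pr (A \<inter> ?E) u \<le> pr A u"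
      unfolding pr_def by (intro nn_integral_mono) (auto simp: indicator_def)
    have 2: "pr (A \<inter> ?E) u \<le> ennreal (1 / e) * G u"
    proof -
      have "pr (A \<inter> ?E) u \<le> (\<integral>\<^sup>+p. ennreal (1 / e) * ennreal \<bar>h (glue (u, p))\<bar> \<partial>(B \<Otimes>\<^sub>M S))"
        unfolding pr_def
      proof (rule nn_integral_mono)
        fix p
        show "indicator (A \<inter> ?E) (glue (u, p)) \<le> ennreal (1 / e) * ennreal \<bar>h (glue (u, p))\<bar>"
        proof (cases "glue (u, p) \<in> A \<inter> ?E")
          case True
          then have "1 \<le> 1 / e * \<bar>h (glue (u, p))\<bar>" using e by (simp add: field_simps)
          then show ?thesis using True e by (simp add: ennreal_mult'[symmetric] ennreal_1[symmetric] del: ennreal_1)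
        qed simp
      qed
      also have "\<dots> = ennreal (1 / e) * G u" unfolding G_def by (rule nn_integral_cmult) measurable
      finally show ?thesis .
    qed
    show "W_density u * pr (A \<inter> ?E) u \<le> W_density u * pr A u * indicator (- {r..1 / r}) u +
      ennreal (1 / sqrt (2 * pi * r) / e) * (indicator {0<..1 / r} u * G u)"
    proof (cases "u \<in> {r..1 / r}")
      case False
      then show ?thesis using mult_left_mono[OF 1, of "W_density u"] by (auto intro: add_increasing2)
    next
      case True
      then have u: "0 < u" "r \<le> u" using r by auto
      have "W_density u \<le> ennreal (1 / sqrt (2 * pi * r))"
        using u r unfolding W_density_def by (auto intro!: ennreal_leI divide_left_mono)
      then have "W_density u * pr (A \<inter> ?E) u \<le> ennreal (1 / sqrt (2 * pi * r)) * (ennreal (1 / e) * G u)"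
        using 2 by (rule mult_mono) auto
      also have "\<dots> = ennreal (1 / sqrt (2 * pi * r) / e) * G u"
        using e r by (simp add: mult.assoc[symmetric] ennreal_mult'[symmetric])
      finally show ?thesis using True u by simp
    qed
  qed
  also have "\<dots> = (\<integral>\<^sup>+u. W_density u * pr A u * indicator (- {r..1 / r}) u \<partial>lborel) +
      ennreal (1 / sqrt (2 * pi * r) / e) * (\<integral>\<^sup>+u. indicator {0<..1 / r} u * G u \<partial>lborel)"
    by (subst nn_integral_add) (auto simp: nn_integral_cmult)
  also have "(\<integral>\<^sup>+u. indicator {0<..1 / r} u * G u \<partial>lborel) = (\<integral>\<^sup>+x. ennreal \<bar>h x\<bar> \<partial>mixture (indicator {0<..1 / r}))"
    unfolding G_def by (subst nn_integral_mixture) auto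
  finally show ?thesis by (simp add: pr_def)
qed

text \<open>Continuity from above for the finite measure with density \<open>F\<close> on the time
  axis. The sets decrease to the nonpositive half-line, where \<open>W_density\<close>
  vanishes.\<close>

lemma W_tail_tendsto:
  assumes A[measurable]: "A \<in> sets path_space_inf" and fin: "emeasure (mixture W_density) A < \<infinity>"
  shows "(\<lambda>j. \<integral>\<^sup>+u. W_density u * (\<integral>\<^sup>+p. indicator A (glue (u, p)) \<partial>(B \<Otimes>\<^sub>M S)) *
    indicator (- {1 / real (Suc j)..real (Suc j)}) u \<partial>lborel) \<longlonglongrightarrow> 0"
proof -
  define F where "F u = W_density u * (\<integral>\<^sup>+p. indicator A (glue (u, p)) \<partial>(B \<Otimes>\<^sub>M S))" for u
  have [measurable]: "(\<lambda>u. \<integral>\<^sup>+p. indicator A (glue (u, p)) \<partial>(B \<Otimes>\<^sub>M S) :: ennreal) \<in> borel_measurable borel"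
    by (rule borel_measurable_glue_integral) simp
  have [measurable]: "F \<in> borel_measurable borel"
    unfolding F_def by measurable
  define J where "J j = - {1 / real (Suc j)..real (Suc j)}" for j
  have F: "(\<integral>\<^sup>+u. F u \<partial>lborel) < \<infinity>" using fin by (simp add: emeasure_mixture F_def)
  have em: "emeasure (density lborel F) D = (\<integral>\<^sup>+u. F u * indicator D u \<partial>lborel)" if "D \<in> sets borel" for D
    using that by (simp add: emeasure_density)
  have "(\<lambda>j. emeasure (density lborel F) (J j)) \<longlonglongrightarrow> emeasure (density lborel F) (\<Inter>j. J j)"
  proof (rule Lim_emeasure_decseq)
    show "range J \<subseteq> sets (density lborel F)" by (auto simp: J_def)
    show "decseq J"
    proof (rule decseq_SucI)
      fix j
      have "1 / real (Suc (Suc j)) \<le> 1 / real (Suc j)" by (intro divide_left_mono) auto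
      then show "J (Suc j) \<subseteq> J j" unfolding J_def by (auto simp del: of_nat_Suc)
    qed
    fix j
    have "emeasure (density lborel F) (J j) \<le> (\<integral>\<^sup>+u. F u \<partial>lborel)"
      unfolding J_def by (subst em) (auto intro!: nn_integral_mono simp: indicator_def)
    then show "emeasure (density lborel F) (J j) \<noteq> \<infinity>" using F by auto
  qed
  moreover have "emeasure (density lborel F) (\<Inter>j. J j) = 0"
  proof -
    have zero: "F u * indicator (\<Inter>j. J j) u = 0" for u
    proof (cases "0 < u")
      case True
      obtain j1 where j1: "1 / u < real j1" using reals_Archimedean2 by blast
      obtain j2 where j2: "u < real j2" using reals_Archimedean2 by blast
      have "1 / real (Suc (max j1 j2)) \<le> u"
      proof -
        have "1 / u \<le> real (Suc (max j1 j2))" using j1 by simp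
        then show ?thesis using True by (simp add: field_simps)
      qed
      moreover have "u \<le> real (Suc (max j1 j2))" using j2 by simp
      ultimately have "u \<notin> J (max j1 j2)" unfolding J_def by simp
      then have "u \<notin> (\<Inter>j. J j)" by blast
      then show ?thesis by (simp add: indicator_def)
    next
      case False
      then show ?thesis by (simp add: F_def W_density_def)
    qed
    have "(\<Inter>j. J j) \<in> sets borel" unfolding J_def by measurable
    then show ?thesis by (simp only: em zero nn_integral_const) simp
  qed
  ultimately show ?thesis
    by (subst (asm) em) (auto simp: J_def F_def)
qed

text \<open>For fixed \<open>j\<close> the Markov term tends to 0 with \<open>n\<close>, so the
  limit superior is at most the tail \<open>d j\<close>; finiteness of the measure of
  \<open>A\<close> then lets \<open>j\<close> tend to infinity.\<close>

lemma L1_imp_locally_in_measure: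
  fixes h :: "nat \<Rightarrow> (real \<Rightarrow> real) \<Rightarrow> real"
  assumes h: "\<And>n. h n \<in> borel_measurable path_space_inf" and A: "A \<in> sets path_space_inf"
    and fin: "emeasure (mixture W_density) A < \<infinity>" and e: "0 < e"
    and lim: "\<And>T. 0 < T \<Longrightarrow> (\<lambda>n. \<integral>\<^sup>+x. ennreal \<bar>h n x\<bar> \<partial>mixture (indicator {0<..T})) \<longlonglongrightarrow> 0"
  shows "(\<lambda>n. emeasure (mixture W_density) (A \<inter> {x \<in> space path_space_inf. e \<le> \<bar>h n x\<bar>})) \<longlonglongrightarrow> 0"
proof (rule tendsto_0_if_Limsup_eq_0_ennreal)
  define d where "d j = (\<integral>\<^sup>+u. W_density u * (\<integral>\<^sup>+p. indicator A (glue (u, p)) \<partial>(B \<Otimes>\<^sub>M S)) *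
    indicator (- {1 / real (Suc j)..real (Suc j)}) u \<partial>lborel)" for j
  let ?f = "\<lambda>n. emeasure (mixture W_density) (A \<inter> {x \<in> space path_space_inf. e \<le> \<bar>h n x\<bar>})"
  have "limsup ?f \<le> d j" for j
  proof -
    define r where "r = 1 / real (Suc j)"
    have r: "0 < r" "1 / r = real (Suc j)" by (auto simp: r_def)
    define b where "b n = d j + ennreal (1 / sqrt (2 * pi * r) / e) *
       (\<integral>\<^sup>+x. ennreal \<bar>h n x\<bar> \<partial>mixture (indicator {0<..1 / r}))" for n
    have "b \<longlonglongrightarrow> d j + ennreal (1 / sqrt (2 * pi * r) / e) * 0"
      unfolding b_def using r by (intro tendsto_add tendsto_const ennreal_tendsto_cmult lim) auto
    then have "limsup b = d j" by (simp add: lim_imp_Limsup)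
    moreover have "limsup ?f \<le> limsup b"
      unfolding b_def d_def using W_local_bound[OF h A e r(1)] 
      by (intro Limsup_mono always_eventually allI) (simp add: r_def)
    ultimately show ?thesis by simp
  qed
  moreover have "d \<longlonglongrightarrow> 0" unfolding d_def using A fin by (rule W_tail_tendsto)
  ultimately have "limsup ?f \<le> 0" by (intro LIMSEQ_le_const) auto
  then show "limsup ?f = 0" by simp
qed

end

section \<open>The approximation distance and convergence in L1 of the mixtures\<close>

definition step_norm :: "(real \<Rightarrow> real) \<Rightarrow> ennreal" where
  "step_norm g = (\<integral>\<^sup>+s. ennreal (\<bar>g s\<bar>\<^sup>2) \<partial>lebesgue_on {0..}) +
      (\<integral>\<^sup>+s. ennreal (\<bar>g s\<bar> / (1 + sqrt s)) \<partial>lebesgue_on {0..})"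

lemma approximates_iff: "approximates fn f \<longleftrightarrow> (\<lambda>n. step_norm (\<lambda>s. fn n s - f s)) \<longlonglongrightarrow> 0"
  by (simp add: approximates_def step_norm_def)

text \<open>A triangle inequality up to the factor 2, which is needed because the first summand of
  \<open>step_norm\<close> is the square of a norm.\<close>

lemma step_norm_diff_le:
  assumes [measurable]: "f \<in> borel_measurable (lebesgue_on {0..})"
    "g \<in> borel_measurable (lebesgue_on {0..})" "h \<in> borel_measurable (lebesgue_on {0..})"
  shows "step_norm (\<lambda>s. g s - h s) \<le> 2 * (step_norm (\<lambda>s. g s - f s) + step_norm (\<lambda>s. h s - f s))"
proof -
  let ?L = "lebesgue_on {0..} :: real measure"
  have nonneg: "0 \<le> s" if "s \<in> space ?L" for s using that by (simp add: space_restrict_space)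
  have [measurable]: "(\<lambda>s. s) \<in> borel_measurable ?L"
    by (rule measurable_restrict_space1) (simp add: measurable_completion)
  have twice: "ennreal (2 * (a + b)) = 2 * (ennreal a + ennreal b)" if "0 \<le> a" "0 \<le> b" for a b
    using that by (simp add: ennreal_mult ennreal_plus del: distrib_left_numeral)
  have diff_sq: "(a - b)\<^sup>2 \<le> 2 * (a\<^sup>2 + b\<^sup>2)" for a b :: real
    using zero_le_power2[of "a + b"] by (simp add: power2_eq_square algebra_simps)
  have "(\<integral>\<^sup>+s. ennreal (\<bar>g s - h s\<bar>\<^sup>2) \<partial>?L) \<le>
      (\<integral>\<^sup>+s. 2 * (ennreal (\<bar>g s - f s\<bar>\<^sup>2) + ennreal (\<bar>h s - f s\<bar>\<^sup>2)) \<partial>?L)"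
  proof (rule nn_integral_mono)
    fix s
    have "\<bar>g s - h s\<bar>\<^sup>2 = ((g s - f s) - (h s - f s))\<^sup>2" by simp
    also have "\<dots> \<le> 2 * (\<bar>g s - f s\<bar>\<^sup>2 + \<bar>h s - f s\<bar>\<^sup>2)"
      unfolding power2_abs by (rule diff_sq)
    finally have "ennreal (\<bar>g s - h s\<bar>\<^sup>2) \<le> ennreal (2 * (\<bar>g s - f s\<bar>\<^sup>2 + \<bar>h s - f s\<bar>\<^sup>2))"
      by (rule ennreal_leI)
    then show "ennreal (\<bar>g s - h s\<bar>\<^sup>2) \<le> 2 * (ennreal (\<bar>g s - f s\<bar>\<^sup>2) + ennreal (\<bar>h s - f s\<bar>\<^sup>2))"
      by (subst (asm) twice) auto
  qed
  also have "\<dots> = 2 * ((\<integral>\<^sup>+s. ennreal (\<bar>g s - f s\<bar>\<^sup>2) \<partial>?L) + (\<integral>\<^sup>+s. ennreal (\<bar>h s - f s\<bar>\<^sup>2) \<partial>?L))"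
    by (simp add: nn_integral_cmult nn_integral_add)
  finally have 1: "(\<integral>\<^sup>+s. ennreal (\<bar>g s - h s\<bar>\<^sup>2) \<partial>?L) \<le> \<dots>" .
  have "(\<integral>\<^sup>+s. ennreal (\<bar>g s - h s\<bar> / (1 + sqrt s)) \<partial>?L) \<le>
      (\<integral>\<^sup>+s. 2 * (ennreal (\<bar>g s - f s\<bar> / (1 + sqrt s)) + ennreal (\<bar>h s - f s\<bar> / (1 + sqrt s))) \<partial>?L)"
  proof (rule nn_integral_mono)
    fix s assume "s \<in> space ?L"
    then have s: "0 < 1 + sqrt s" using nonneg[of s] by (simp add: add_pos_nonneg)
    have "\<bar>g s - h s\<bar> / (1 + sqrt s) \<le> (2 * (\<bar>g s - f s\<bar> + \<bar>h s - f s\<bar>)) / (1 + sqrt s)"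
    proof (rule divide_right_mono)
      have "\<bar>g s - h s\<bar> \<le> \<bar>g s - f s\<bar> + \<bar>h s - f s\<bar>"
        using abs_triangle_ineq4[of "g s - f s" "h s - f s"] by simp
      moreover have "0 \<le> \<bar>g s - f s\<bar> + \<bar>h s - f s\<bar>" by simp
      ultimately show "\<bar>g s - h s\<bar> \<le> 2 * (\<bar>g s - f s\<bar> + \<bar>h s - f s\<bar>)" by argo
    qed (use s in simp)
    also have "\<dots> = 2 * (\<bar>g s - f s\<bar> / (1 + sqrt s) + \<bar>h s - f s\<bar> / (1 + sqrt s))"
      by (simp add: add_divide_distrib)
    finally have "ennreal (\<bar>g s - h s\<bar> / (1 + sqrt s)) \<le>
        ennreal (2 * (\<bar>g s - f s\<bar> / (1 + sqrt s) + \<bar>h s - f s\<bar> / (1 + sqrt s)))"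
      by (rule ennreal_leI)
    then show "ennreal (\<bar>g s - h s\<bar> / (1 + sqrt s)) \<le>
        2 * (ennreal (\<bar>g s - f s\<bar> / (1 + sqrt s)) + ennreal (\<bar>h s - f s\<bar> / (1 + sqrt s)))"
      using s by (subst (asm) twice) auto
  qed
  also have "\<dots> = 2 * ((\<integral>\<^sup>+s. ennreal (\<bar>g s - f s\<bar> / (1 + sqrt s)) \<partial>?L) +
      (\<integral>\<^sup>+s. ennreal (\<bar>h s - f s\<bar> / (1 + sqrt s)) \<partial>?L))"
    by (simp add: nn_integral_cmult nn_integral_add)
  finally have 2: "(\<integral>\<^sup>+s. ennreal (\<bar>g s - h s\<bar> / (1 + sqrt s)) \<partial>?L) \<le> \<dots>" .
  show ?thesis
    using add_mono[OF 1 2] unfolding step_norm_def by (simp add: distrib_left add_ac)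
qed


context wiener
begin

lemma norm_const_nonneg: "0 < T \<Longrightarrow> 0 \<le> norm_const T"
  unfolding norm_const_def using mean_norm_nonneg by simp

text \<open>Used within one approximating sequence to show that it is Cauchy, and across two
  sequences for uniqueness.\<close>

lemma step_diff_L1_le:
  assumes f: "f \<in> borel_measurable (lebesgue_on {0..})" and g: "step_function g" and h: "step_function h"
    and a: "step_norm (\<lambda>s. g s - f s) \<le> ennreal a" "0 \<le> a"
    and b: "step_norm (\<lambda>s. h s - f s) \<le> ennreal b" "0 \<le> b" and T: "0 < T"
    and x: "2 * (a + b) \<le> x"
  shows "(\<integral>\<^sup>+\<omega>. ennreal \<bar>step_integral g \<omega> - step_integral h \<omega>\<bar> \<partial>mixture (indicator {0<..T})) \<le>
    ennreal (norm_const T * (sqrt x + x))"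
proof -
  have "step_norm (\<lambda>s. g s - h s) \<le> 2 * (step_norm (\<lambda>s. g s - f s) + step_norm (\<lambda>s. h s - f s))"
    by (intro step_norm_diff_le f step_function_measurable g h)
  also have "\<dots> \<le> 2 * (ennreal a + ennreal b)" using a b by (intro mult_left_mono add_mono) auto
  also have "\<dots> = ennreal (2 * (a + b))"
    using a b by (simp add: ennreal_mult ennreal_plus del: distrib_left_numeral)
  also have "\<dots> \<le> ennreal x" using x by (rule ennreal_leI)
  finally have "step_norm (\<lambda>s. g s - h s) \<le> ennreal x" .
  then show ?thesis
    using step_integral_mixture_bound[OF step_function_diff(1)[OF g h] T, of x] a b x
    by (simp add: step_norm_def step_function_diff(2)[OF g h])
qed

lemma step_diff_L1_tendsto:
  assumes f: "f \<in> borel_measurable (lebesgue_on {0..})"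
    and g: "\<And>n. step_function (gn n)" and h: "\<And>n. step_function (hn n)"
    and lim: "approximates gn f" "approximates hn f" and T: "0 < T"
  shows "(\<lambda>n. \<integral>\<^sup>+\<omega>. ennreal \<bar>step_integral (gn n) \<omega> - step_integral (hn n) \<omega>\<bar>
    \<partial>mixture (indicator {0<..T})) \<longlonglongrightarrow> 0"
proof -
  define a where "a n = step_norm (\<lambda>s. gn n s - f s)" for n
  define b where "b n = step_norm (\<lambda>s. hn n s - f s)" for n
  have a: "a \<longlonglongrightarrow> 0" and b: "b \<longlonglongrightarrow> 0"
    using lim by (simp_all add: approximates_iff a_def[abs_def] b_def[abs_def])
  \<comment> \<open>\<open>enn2real\<close> sends infinity to 0, so the bound by \<open>x n\<close>
    is claimed only from the point on where both distances are below 1.\<close>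
  define x where "x n = 2 * (enn2real (a n) + enn2real (b n))" for n
  have "x \<longlonglongrightarrow> 2 * (0 + 0)"
    unfolding x_def using a b by (intro tendsto_intros tendsto_enn2real) auto
  then have "(\<lambda>n. ennreal (norm_const T * (sqrt (x n) + x n))) \<longlonglongrightarrow> ennreal (norm_const T * (sqrt 0 + 0))"
    by (intro tendsto_intros) auto
  then have lim0: "(\<lambda>n. ennreal (norm_const T * (sqrt (x n) + x n))) \<longlonglongrightarrow> 0" by simp
  have "eventually (\<lambda>n. a n < 1) sequentially" "eventually (\<lambda>n. b n < 1) sequentially"
    using order_tendstoD(2)[OF a, of 1] order_tendstoD(2)[OF b, of 1] by simp_all
  then have "eventually (\<lambda>n. (\<integral>\<^sup>+\<omega>. ennreal \<bar>step_integral (gn n) \<omega> - step_integral (hn n) \<omega>\<bar>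
    \<partial>mixture (indicator {0<..T})) \<le> ennreal (norm_const T * (sqrt (x n) + x n))) sequentially"
  proof eventually_elim
    case (elim n)
    then have "a n < top" "b n < top" by (auto intro: less_trans[OF _ ennreal_one_less_top])
    then have "a n = ennreal (enn2real (a n))" "b n = ennreal (enn2real (b n))" by simp_all
    then show ?case
      by (intro step_diff_L1_le[OF f g h, where a = "enn2real (a n)" and b = "enn2real (b n)"] T)
        (simp_all add: x_def a_def b_def)
  qed
  then show ?thesis by (intro tendsto_sandwich[OF _ _ tendsto_const lim0]) auto
qed

text \<open>Completeness of L1 is carried out by hand because one and the same \<open>Z\<close> must
  serve all \<open>T\<close>: a pointwise limit along well-chosen indices makes no reference to
  \<open>T\<close>, and only the exceptional null set depends on it.\<close>

lemma step_integral_limit_exists: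
  assumes f: "f \<in> borel_measurable (lebesgue_on {0..})"
    and g: "\<And>n. step_function (fn n)" and lim: "approximates fn f"
  shows "\<exists>Z \<in> borel_measurable path_space_inf. \<forall>T>0.
    (\<lambda>n. \<integral>\<^sup>+\<omega>. ennreal \<bar>step_integral (fn n) \<omega> - Z \<omega>\<bar> \<partial>mixture (indicator {0<..T})) \<longlonglongrightarrow> 0"
proof -
  define a where "a n = step_norm (\<lambda>s. fn n s - f s)" for n
  have a: "a \<longlonglongrightarrow> 0" using lim by (simp add: approximates_iff a_def[abs_def])
  \<comment> \<open>The rate 1/4 compensates the square root in the L1 bound: consecutive chosen
    integrals then differ by a multiple of (1/2)^k, which is summable. The indices
    \<open>r k\<close> need not increase; only their closeness to \<open>f\<close> is used.\<close>
  have "\<exists>n. a n < ennreal ((1 / 4) ^ Suc k)" for k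
  proof -
    have "eventually (\<lambda>n. a n < ennreal ((1 / 4) ^ Suc k)) sequentially"
      by (rule order_tendstoD(2)[OF a]) simp
    then show ?thesis by (auto simp: eventually_sequentially)
  qed
  then obtain r where r: "\<And>k. a (r k) < ennreal ((1 / 4) ^ Suc k)" by metis
  define I where "I n = step_integral (fn n)" for n
  have I[measurable]: "I n \<in> borel_measurable path_space_inf" for n
    unfolding I_def using g by (rule step_integral_measurable)
  \<comment> \<open>Where the sequence diverges, \<open>lim\<close> is some default value; this
    happens on a null set for every mixture, and measurability holds regardless.\<close>
  define Z where "Z \<omega> = lim (\<lambda>k. I (r k) \<omega>)" for \<omega>
  have Z[measurable]: "Z \<in> borel_measurable path_space_inf"
    unfolding Z_def by (rule borel_measurable_lim_metric) simp
  have AE_lim: "AE \<omega> in mixture (indicator {0<..T}). (\<lambda>k. I (r k) \<omega>) \<longlonglongrightarrow> Z \<omega>" if T: "0 < T" for T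
  proof -
    let ?M = "mixture (indicator {0<..T})"
    have m: "J \<in> borel_measurable ?M" if "J \<in> borel_measurable path_space_inf" for J :: "_ \<Rightarrow> ennreal"
      using that by (simp cong: measurable_cong_sets)
    have "(\<integral>\<^sup>+\<omega>. (\<Sum>k. ennreal \<bar>I (r (Suc k)) \<omega> - I (r k) \<omega>\<bar>) \<partial>?M) =
        (\<Sum>k. \<integral>\<^sup>+\<omega>. ennreal \<bar>I (r (Suc k)) \<omega> - I (r k) \<omega>\<bar> \<partial>?M)"
      by (rule nn_integral_suminf) (rule m, measurable)
    also have "\<dots> \<le> (\<Sum>k. ennreal (norm_const T * (2 * (1 / 2) ^ k)))"
    proof (rule suminf_le)
      fix k
      have "(\<integral>\<^sup>+\<omega>. ennreal \<bar>I (r (Suc k)) \<omega> - I (r k) \<omega>\<bar> \<partial>?M) \<le>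
          ennreal (norm_const T * (sqrt ((1 / 4) ^ k) + (1 / 4) ^ k))"
        unfolding I_def using less_imp_le[OF r[of k]] less_imp_le[OF r[of "Suc k"]]
        by (intro step_diff_L1_le[OF f g g, where a = "(1 / 4) ^ Suc (Suc k)" and b = "(1 / 4) ^ Suc k"] T)
          (simp_all add: a_def)
      also have "\<dots> \<le> ennreal (norm_const T * (2 * (1 / 2) ^ k))"
      proof (intro ennreal_leI mult_left_mono norm_const_nonneg T)
        have "(1 / 4 :: real) ^ k = ((1 / 2) ^ k)\<^sup>2" by (simp add: power2_eq_square power_mult_distrib[symmetric])
        then have "sqrt ((1 / 4) ^ k) = (1 / 2) ^ k" by simp
        moreover have "(1 / 4 :: real) ^ k \<le> (1 / 2) ^ k" by (rule power_mono) auto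
        ultimately show "sqrt ((1 / 4) ^ k) + (1 / 4) ^ k \<le> 2 * (1 / 2) ^ k" by simp
      qed
      finally show "(\<integral>\<^sup>+\<omega>. ennreal \<bar>I (r (Suc k)) \<omega> - I (r k) \<omega>\<bar> \<partial>?M) \<le> \<dots>" .
    qed auto
    also have "\<dots> = ennreal (\<Sum>k. norm_const T * (2 * (1 / 2) ^ k))"
      using norm_const_nonneg[OF T] by (intro suminf_ennreal2 summable_mult summable_geometric) auto
    finally have "(\<integral>\<^sup>+\<omega>. (\<Sum>k. ennreal \<bar>I (r (Suc k)) \<omega> - I (r k) \<omega>\<bar>) \<partial>?M) \<noteq> \<infinity>"
      by (auto simp: top_unique)
    then have "AE \<omega> in ?M. (\<Sum>k. ennreal \<bar>I (r (Suc k)) \<omega> - I (r k) \<omega>\<bar>) \<noteq> \<infinity>"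
      by (intro nn_integral_PInf_AE m) measurable
    then show ?thesis
    proof eventually_elim
      case (elim \<omega>)
      then have "summable (\<lambda>k. \<bar>I (r (Suc k)) \<omega> - I (r k) \<omega>\<bar>)"
        by (intro summable_suminf_not_top) auto
      then have "summable (\<lambda>k. I (r (Suc k)) \<omega> - I (r k) \<omega>)" by (rule summable_rabs_cancel)
      then have "convergent (\<lambda>n. \<Sum>k<n. I (r (Suc k)) \<omega> - I (r k) \<omega>)"
        by (simp add: summable_iff_convergent)
      then have "convergent (\<lambda>n. I (r n) \<omega> - I (r 0) \<omega>)" by (simp add: sum_lessThan_telescope[of "\<lambda>k. I (r k) \<omega>"])
      from convergent_add[OF this convergent_const[of "I (r 0) \<omega>"]] have "convergent (\<lambda>n. I (r n) \<omega>)" by simp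
      then show ?case unfolding Z_def by (simp add: convergent_LIMSEQ_iff)
    qed
  qed
  \<comment> \<open>Fatou's lemma along the indices \<open>r k\<close>. The constant 4 is 2 (x + x),
    both \<open>fn n\<close> and \<open>fn (r k)\<close> being within \<open>x\<close> of
    \<open>f\<close> for large \<open>k\<close>.\<close>
  have bound: "(\<integral>\<^sup>+\<omega>. ennreal \<bar>I n \<omega> - Z \<omega>\<bar> \<partial>mixture (indicator {0<..T})) \<le>
      ennreal (norm_const T * (sqrt (4 * x) + 4 * x))" if T: "0 < T" and x: "0 < x" "a n \<le> ennreal x" for T n x
  proof -
    let ?M = "mixture (indicator {0<..T})"
    have m: "J \<in> borel_measurable ?M" if "J \<in> borel_measurable path_space_inf" for J :: "_ \<Rightarrow> ennreal"
      using that by (simp cong: measurable_cong_sets)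
    have "(\<integral>\<^sup>+\<omega>. ennreal \<bar>I n \<omega> - Z \<omega>\<bar> \<partial>?M) = (\<integral>\<^sup>+\<omega>. liminf (\<lambda>k. ennreal \<bar>I n \<omega> - I (r k) \<omega>\<bar>) \<partial>?M)"
    proof (rule nn_integral_cong_AE)
      show "AE \<omega> in ?M. ennreal \<bar>I n \<omega> - Z \<omega>\<bar> = liminf (\<lambda>k. ennreal \<bar>I n \<omega> - I (r k) \<omega>\<bar>)"
        using AE_lim[OF T]
      proof eventually_elim
        case (elim \<omega>)
        then have "(\<lambda>k. ennreal \<bar>I n \<omega> - I (r k) \<omega>\<bar>) \<longlonglongrightarrow> ennreal \<bar>I n \<omega> - Z \<omega>\<bar>"
          by (intro tendsto_intros)
        then show ?case by (rule lim_imp_Liminf[OF trivial_limit_sequentially, symmetric])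
      qed
    qed
    also have "\<dots> \<le> liminf (\<lambda>k. \<integral>\<^sup>+\<omega>. ennreal \<bar>I n \<omega> - I (r k) \<omega>\<bar> \<partial>?M)"
      by (rule nn_integral_liminf) (rule m, measurable)
    also have "\<dots> \<le> liminf (\<lambda>k :: nat. ennreal (norm_const T * (sqrt (4 * x) + 4 * x)))"
    proof (rule Liminf_mono)
      have "(\<lambda>k. (1 / 4 :: real) ^ k) \<longlonglongrightarrow> 0" by (rule LIMSEQ_realpow_zero) auto
      then have "eventually (\<lambda>k. (1 / 4) ^ k < x) sequentially" using x(1) by (rule order_tendstoD(2))
      then show "eventually (\<lambda>k. (\<integral>\<^sup>+\<omega>. ennreal \<bar>I n \<omega> - I (r k) \<omega>\<bar> \<partial>?M) \<le>
          ennreal (norm_const T * (sqrt (4 * x) + 4 * x))) sequentially"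
      proof eventually_elim
        case (elim k)
        have "(1 / 4 :: real) ^ Suc k \<le> (1 / 4) ^ k" by simp
        with elim have k: "(1 / 4) ^ Suc k \<le> x" by linarith
        then have "a (r k) \<le> ennreal x" using r[of k] by (meson ennreal_leI less_imp_le order_trans)
        then show ?case
          unfolding I_def using x by (intro step_diff_L1_le[OF f g g, where a = x and b = x] T) (simp_all add: a_def)
      qed
    qed
    finally show ?thesis by (simp add: Liminf_const)
  qed
  have "(\<lambda>n. \<integral>\<^sup>+\<omega>. ennreal \<bar>step_integral (fn n) \<omega> - Z \<omega>\<bar> \<partial>mixture (indicator {0<..T})) \<longlonglongrightarrow> 0"
    if T: "0 < T" for T
  proof -
    \<comment> \<open>The added 1/(n+1) keeps \<open>x n\<close> positive, as \<open>bound\<close>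
      requires, even if the distance is 0.\<close>
    define x where "x n = enn2real (a n) + 1 / real (Suc n)" for n
    have "x \<longlonglongrightarrow> 0 + 0"
      unfolding x_def using a LIMSEQ_inverse_real_of_nat
      by (intro tendsto_add tendsto_enn2real) (auto simp: inverse_eq_divide)
    then have "(\<lambda>n. ennreal (norm_const T * (sqrt (4 * x n) + 4 * x n))) \<longlonglongrightarrow>
        ennreal (norm_const T * (sqrt (4 * (0 + 0)) + 4 * (0 + 0)))"
      by (intro tendsto_intros) auto
    then have lim0: "(\<lambda>n. ennreal (norm_const T * (sqrt (4 * x n) + 4 * x n))) \<longlonglongrightarrow> 0" by simp
    have "eventually (\<lambda>n. a n < 1) sequentially"
      using order_tendstoD(2)[OF a, of 1] by simp
    then have "eventually (\<lambda>n. (\<integral>\<^sup>+\<omega>. ennreal \<bar>I n \<omega> - Z \<omega>\<bar> \<partial>mixture (indicator {0<..T})) \<le>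
        ennreal (norm_const T * (sqrt (4 * x n) + 4 * x n))) sequentially"
    proof eventually_elim
      case (elim n)
      then have "a n < top" by (auto intro: less_trans[OF _ ennreal_one_less_top])
      then have "a n = ennreal (enn2real (a n))" by simp
      also have "\<dots> \<le> ennreal (x n)" by (intro ennreal_leI) (simp add: x_def)
      finally show ?case by (intro bound T) (auto simp: x_def intro: add_nonneg_pos)
    qed
    then show ?thesis unfolding I_def by (intro tendsto_sandwich[OF _ _ tendsto_const lim0]) auto
  qed
  then show ?thesis using Z by blast
qed

lemma step_integral_converges_locally:
  assumes f: "f \<in> borel_measurable (lebesgue_on {0..})"
    and g: "\<And>n. step_function (fn n)" and lim: "approximates fn f"
  shows "\<exists>Z \<in> borel_measurable path_space_inf.
    converges_locally_in_measure (script_W B) (\<lambda>n. step_integral (fn n)) Z"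
proof -
  obtain Z where Z: "Z \<in> borel_measurable path_space_inf" and L1: "\<And>T. 0 < T \<Longrightarrow>
    (\<lambda>n. \<integral>\<^sup>+\<omega>. ennreal \<bar>step_integral (fn n) \<omega> - Z \<omega>\<bar> \<partial>mixture (indicator {0<..T})) \<longlonglongrightarrow> 0"
    using step_integral_limit_exists[OF f g lim] by auto
  have I: "step_integral (fn n) \<in> borel_measurable path_space_inf" for n
    using g by (rule step_integral_measurable)
  have "converges_locally_in_measure (script_W B) (\<lambda>n. step_integral (fn n)) Z"
    unfolding converges_locally_in_measure_def script_W_eq space_mixture sets_mixture
      measurable_cong_sets[OF sets_mixture refl]
  proof (intro conjI allI ballI impI I Z)
    fix e :: real and A
    assume "0 < e" "A \<in> sets path_space_inf" "emeasure (mixture W_density) A < \<infinity>"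
    then show "(\<lambda>n. emeasure (mixture W_density)
        (A \<inter> {x \<in> space path_space_inf. e \<le> \<bar>step_integral (fn n) x - Z x\<bar>})) \<longlonglongrightarrow> 0"
      using I Z L1 by (intro L1_imp_locally_in_measure) auto
  qed
  then show ?thesis using Z by blast
qed


section \<open>Sigma-finiteness and uniqueness\<close>

text \<open>The normal density is at most 1 / (2 sqrt s), as sqrt(2 pi) >= 2, and the interval has
  length 2 \<rho>.\<close>

lemma increment_small_prob:
  assumes s: "0 < s" and \<rho>: "0 \<le> \<rho>"
  shows "(\<integral>\<^sup>+\<omega>. indicator {-\<rho>..\<rho>} (\<omega> s - \<omega> 0) \<partial>B) \<le> ennreal (\<rho> / sqrt s)"
proof -
  have "(\<integral>\<^sup>+\<omega>. indicator {-\<rho>..\<rho>} (\<omega> s - \<omega> 0) \<partial>B) =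
      (\<integral>\<^sup>+x. ennreal (normal_density 0 (sqrt (s - 0)) x) * indicator {-\<rho>..\<rho>} x \<partial>lborel)"
    using s by (intro distributed_nn_integral[symmetric] increment_normal) auto
  also have "\<dots> \<le> (\<integral>\<^sup>+x. ennreal (1 / (2 * sqrt s)) * indicator {-\<rho>..\<rho>} x \<partial>lborel)"
  proof (intro nn_integral_mono mult_right_mono ennreal_leI)
    fix x
    have "2 \<le> sqrt (2 * pi)" using pi_gt3 by (intro real_le_rsqrt) auto
    then have "2 * sqrt s \<le> sqrt (2 * pi) * sqrt s" using s by (intro mult_right_mono) auto
    moreover have "exp (- x\<^sup>2 / (2 * s)) \<le> 1" using s by simp
    ultimately have "1 / sqrt (2 * pi * s) * exp (- x\<^sup>2 / (2 * s)) \<le> 1 / (2 * sqrt s) * 1"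
      using s by (intro mult_mono divide_left_mono) (auto simp: real_sqrt_mult)
    then show "normal_density 0 (sqrt (s - 0)) x \<le> 1 / (2 * sqrt s)"
      using s by (simp add: normal_density_def)
  qed auto
  also have "\<dots> = ennreal (1 / (2 * sqrt s)) * ennreal (2 * \<rho>)"
    using \<rho> by (simp add: nn_integral_cmult)
  also have "\<dots> = ennreal (\<rho> / sqrt s)"
    using s \<rho> by (subst ennreal_mult[symmetric]) auto
  finally show ?thesis .
qed

text \<open>A vector of norm at most \<rho> has all three coordinates in [-\<rho>,\<rho>], and these
  are independent, hence the third power. This quantifies transience in dimension three.\<close>

lemma S_small_prob:
  assumes s: "0 < s" and \<rho>: "0 \<le> \<rho>"
  shows "emeasure S {y \<in> space S. \<bar>y s\<bar> \<le> \<rho>} \<le> ennreal ((\<rho> / sqrt s) ^ 3)"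
proof -
  let ?b = "\<lambda>(x, y, z). \<lambda>t\<in>{0..}. sqrt ((x t)\<^sup>2 + (y t)\<^sup>2 + (z t)\<^sup>2)"
  have cm[measurable]: "(\<lambda>y. y s) \<in> borel_measurable path_space_inf"
    using s by (intro component_path_measurable) simp
  define f :: "(real \<Rightarrow> real) \<Rightarrow> ennreal" where "f y = indicator {-\<rho>..\<rho>} (y s)" for y
  have f[measurable]: "f \<in> borel_measurable path_space_inf" unfolding f_def by measurable
  define i :: "(real \<Rightarrow> real) \<Rightarrow> ennreal" where "i \<omega> = indicator {-\<rho>..\<rho>} (\<omega> s - \<omega> 0)" for \<omega>
  have [measurable]: "(\<lambda>\<omega>. \<omega> s) \<in> borel_measurable B" "(\<lambda>\<omega>. \<omega> 0) \<in> borel_measurable B"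
    using s by (auto intro!: measurable_component)
  have i[measurable]: "i \<in> borel_measurable B" unfolding i_def by measurable
  have "{y \<in> space S. \<bar>y s\<bar> \<le> \<rho>} \<in> sets S" by measurable
  then have "emeasure S {y \<in> space S. \<bar>y s\<bar> \<le> \<rho>} = (\<integral>\<^sup>+y. indicator {y \<in> space S. \<bar>y s\<bar> \<le> \<rho>} y \<partial>S)"
    by simp
  also have "\<dots> = (\<integral>\<^sup>+y. f y \<partial>S)"
    by (rule nn_integral_cong) (auto simp: f_def indicator_def)
  also have "\<dots> = (\<integral>\<^sup>+y. f y \<partial>bessel3_law B)"
    using f s by (intro nn_integral_S_symmetric) (auto simp: f_def indicator_def)
  also have "\<dots> = (\<integral>\<^sup>+w. f (?b w) \<partial>wiener3 B)"
    unfolding bessel3_law_eq by (rule nn_integral_distr[OF bessel3_map_measurable]) (simp add: f)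
  also have "\<dots> \<le> (\<integral>\<^sup>+w. i (fst w) * (i (fst (snd w)) * i (snd (snd w))) \<partial>wiener3 B)"
  proof (rule nn_integral_mono_AE)
    show "AE w in wiener3 B. f (?b w) \<le> i (fst w) * (i (fst (snd w)) * i (snd (snd w)))"
      using AE_start
    proof eventually_elim
      case (elim w)
      show ?case
      proof (cases "\<bar>norm (displacement 0 s w)\<bar> \<le> \<rho>")
        case True
        have "\<bar>fst w s - fst w 0\<bar> \<le> norm (displacement 0 s w)"
          using norm_fst_le[of "fst (displacement 0 s w)" "snd (displacement 0 s w)"]
          by (simp add: displacement_def)
        moreover have "\<bar>fst (snd w) s - fst (snd w) 0\<bar> \<le> norm (snd (displacement 0 s w))"
          using norm_fst_le[of "fst (snd (displacement 0 s w))" "snd (snd (displacement 0 s w))"]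
          by (simp add: displacement_def)
        moreover have "\<bar>snd (snd w) s - snd (snd w) 0\<bar> \<le> norm (snd (displacement 0 s w))"
          using norm_snd_le[of "snd (snd (displacement 0 s w))" "fst (snd (displacement 0 s w))"]
          by (simp add: displacement_def)
        moreover have "norm (snd (displacement 0 s w)) \<le> norm (displacement 0 s w)"
          using norm_snd_le[of "snd (displacement 0 s w)" "fst (displacement 0 s w)"] by simp
        ultimately have "fst w s - fst w 0 \<in> {-\<rho>..\<rho>}" "fst (snd w) s - fst (snd w) 0 \<in> {-\<rho>..\<rho>}"
            "snd (snd w) s - snd (snd w) 0 \<in> {-\<rho>..\<rho>}"
          using True by (auto simp: abs_le_iff)
        then have "i (fst w) * (i (fst (snd w)) * i (snd (snd w))) = 1" by (simp add: i_def)
        moreover have "f (?b w) \<le> 1" by (simp add: f_def indicator_def)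
        ultimately show ?thesis by simp
      next
        case False
        have "?b w s = norm (displacement 0 s w)" by (rule bessel3_map_eq[OF elim]) (use s in simp)
        then have "f (?b w) = 0" using False unfolding f_def by (simp only:) (auto simp: indicator_def)
        then show ?thesis by simp
      qed
    qed
  qed
  also have "\<dots> = (\<integral>\<^sup>+x. \<integral>\<^sup>+v. i x * (i (fst v) * i (snd v)) \<partial>(B \<Otimes>\<^sub>M B) \<partial>B)"
  proof -
    interpret BB: prob_space "B \<Otimes>\<^sub>M B" by (intro prob_space_pair prob_space_axioms)
    show ?thesis unfolding wiener3_def by (subst BB.nn_integral_fst[symmetric]) simp_all
  qed
  also have "\<dots> = (\<integral>\<^sup>+x. i x \<partial>B) * (\<integral>\<^sup>+v. i (fst v) * i (snd v) \<partial>(B \<Otimes>\<^sub>M B))"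
    by (simp add: nn_integral_cmult nn_integral_multc)
  also have "(\<integral>\<^sup>+v. i (fst v) * i (snd v) \<partial>(B \<Otimes>\<^sub>M B)) = (\<integral>\<^sup>+x. \<integral>\<^sup>+y. i x * i y \<partial>B \<partial>B)"
    by (subst nn_integral_fst[symmetric]) simp_all
  also have "\<dots> = (\<integral>\<^sup>+x. i x \<partial>B) * (\<integral>\<^sup>+x. i x \<partial>B)"
    by (simp add: nn_integral_cmult nn_integral_multc)
  also have "(\<integral>\<^sup>+x. i x \<partial>B) * ((\<integral>\<^sup>+x. i x \<partial>B) * (\<integral>\<^sup>+x. i x \<partial>B)) \<le>
      ennreal (\<rho> / sqrt s) * (ennreal (\<rho> / sqrt s) * ennreal (\<rho> / sqrt s))"
    using increment_small_prob[OF s \<rho>] unfolding i_def by (intro mult_mono) auto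
  also have "\<dots> = ennreal ((\<rho> / sqrt s) ^ 3)"
    using s \<rho> by (simp add: ennreal_mult[symmetric] power3_eq_cube mult.assoc)
  finally show ?thesis .
qed

text \<open>With \<omega>(0) = 0, the bridge at time n is X - Y, a small multiple of the increment
  over [0,n] minus at most the increment over [n,u]. Since u - n < 1, each has fourth moment at most
  3, and (a - b)^4 <= 8 (a^4 + b^4) gives 8 (3 + 3) = 48. Second moments would not do: they would
  require an exponent above 1/4 in \<open>escaping\<close>, against the bound 1/6 from the Bessel
  side.\<close>

lemma bridge_tail_prob:
  fixes n :: nat
  assumes n: "1 \<le> n" "real n \<le> u" "u < real n + 1" and \<theta>: "0 < \<theta>"
  shows "(\<integral>\<^sup>+\<omega>. indicator {\<omega>. \<theta> \<le> \<bar>\<omega> (real n) - real n / u * \<omega> u\<bar>} \<omega> \<partial>B) \<le> ennreal (48 / \<theta> ^ 4)"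
proof -
  have u: "0 < u" using n by simp
  define X where "X \<omega> = (1 - real n / u) * (\<omega> (real n) - \<omega> 0)" for \<omega> :: "real \<Rightarrow> real"
  define Y where "Y \<omega> = (real n / u) * (\<omega> u - \<omega> (real n))" for \<omega> :: "real \<Rightarrow> real"
  note mX = increment_moment[of 0 "real n"] and mY = increment_moment[of "real n" u]
  have int: "integrable B (\<lambda>\<omega>. (X \<omega>) ^ 4)" "integrable B (\<lambda>\<omega>. (Y \<omega>) ^ 4)"
    unfolding X_def Y_def power_mult_distrib using mX(1)[of 4] mY(1)[of 4] n by auto
  have nu: "0 \<le> 1 - real n / u" "1 - real n / u \<le> 1 / real n" "0 \<le> real n / u" "real n / u \<le> 1"
  proof -
    have "1 - real n / u = (u - real n) / u" using u by (simp add: diff_divide_distrib)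
    also have "\<dots> \<le> 1 / u" using n u by (intro divide_right_mono) auto
    also have "\<dots> \<le> 1 / real n" using n u by (intro divide_left_mono) auto
    finally show "1 - real n / u \<le> 1 / real n" .
  qed (use n u in auto)
  have EX: "expectation (\<lambda>\<omega>. (X \<omega>) ^ 4) \<le> 3"
  proof -
    have "expectation (\<lambda>\<omega>. (X \<omega>) ^ 4) = (1 - real n / u) ^ 4 * (3 * (real n)\<^sup>2)"
      unfolding X_def power_mult_distrib using mX by simp
    also have "\<dots> \<le> (1 / real n) ^ 4 * (3 * (real n)\<^sup>2)"
      using nu by (intro mult_right_mono power_mono) auto
    also have "\<dots> = 3 / (real n)\<^sup>2" using n by (simp add: field_simps power2_eq_square power4_eq_xxxx)
    also have "\<dots> \<le> 3 / 1" using n by (intro divide_left_mono) auto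
    finally show ?thesis by simp
  qed
  have EY: "expectation (\<lambda>\<omega>. (Y \<omega>) ^ 4) \<le> 3"
  proof -
    have "expectation (\<lambda>\<omega>. (Y \<omega>) ^ 4) = (real n / u) ^ 4 * (3 * (u - real n)\<^sup>2)"
      unfolding Y_def power_mult_distrib using mY n by simp
    also have "\<dots> \<le> 1 * (3 * 1)"
      using nu n by (intro mult_mono power_le_one) (auto simp: abs_square_le_1)
    finally show ?thesis by simp
  qed
  have fourth: "(a - b) ^ 4 \<le> 8 * (a ^ 4 + b ^ 4)" for a b :: real
  proof -
    have "(a - b)\<^sup>2 \<le> 2 * (a\<^sup>2 + b\<^sup>2)" using zero_le_power2[of "a + b"] by (simp add: power2_eq_square algebra_simps)
    then have "((a - b)\<^sup>2)\<^sup>2 \<le> (2 * (a\<^sup>2 + b\<^sup>2))\<^sup>2" by (intro power_mono) auto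
    also have "\<dots> = 4 * (a\<^sup>2 + b\<^sup>2)\<^sup>2"
      by (simp add: power_mult_distrib del: distrib_left_numeral)
    also have "(a\<^sup>2 + b\<^sup>2)\<^sup>2 \<le> 2 * ((a\<^sup>2)\<^sup>2 + (b\<^sup>2)\<^sup>2)"
      using zero_le_power2[of "a\<^sup>2 - b\<^sup>2"] by (simp add: power2_sum power2_diff)
    finally show ?thesis by simp
  qed
  have "AE \<omega> in B. \<omega> 0 = 0" using wiener by (simp add: wiener_measure_def)
  then have "AE \<omega> in B. indicator {\<omega>. \<theta> \<le> \<bar>\<omega> (real n) - real n / u * \<omega> u\<bar>} \<omega> \<le>
      ennreal (8 / \<theta> ^ 4 * (X \<omega> ^ 4 + Y \<omega> ^ 4))"
  proof eventually_elim
    case (elim \<omega>)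
    have eq: "\<omega> (real n) - real n / u * \<omega> u = X \<omega> - Y \<omega>"
      by (simp add: X_def Y_def elim algebra_simps)
    show ?case
      unfolding indicator_def mem_Collect_eq eq
    proof (cases "\<theta> \<le> \<bar>X \<omega> - Y \<omega>\<bar>")
      case True
      then have "\<theta> ^ 4 \<le> \<bar>X \<omega> - Y \<omega>\<bar> ^ 4" using \<theta> by (intro power_mono) auto
      also have "\<dots> = (X \<omega> - Y \<omega>) ^ 4" by (simp add: power_even_abs)
      also have "\<dots> \<le> 8 * (X \<omega> ^ 4 + Y \<omega> ^ 4)" by (rule fourth)
      finally have "1 \<le> 8 / \<theta> ^ 4 * (X \<omega> ^ 4 + Y \<omega> ^ 4)" using \<theta> by (simp add: pos_le_divide_eq)
      from ennreal_leI[OF this] show "of_bool (\<theta> \<le> \<bar>X \<omega> - Y \<omega>\<bar>) \<le> ennreal (8 / \<theta> ^ 4 * (X \<omega> ^ 4 + Y \<omega> ^ 4))"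
        using True by (simp only: ennreal_1 of_bool_eq)
    qed simp
  qed
  then have "(\<integral>\<^sup>+\<omega>. indicator {\<omega>. \<theta> \<le> \<bar>\<omega> (real n) - real n / u * \<omega> u\<bar>} \<omega> \<partial>B) \<le>
      (\<integral>\<^sup>+\<omega>. ennreal (8 / \<theta> ^ 4 * (X \<omega> ^ 4 + Y \<omega> ^ 4)) \<partial>B)"
    by (rule nn_integral_mono_AE)
  also have "\<dots> = ennreal (expectation (\<lambda>\<omega>. 8 / \<theta> ^ 4 * (X \<omega> ^ 4 + Y \<omega> ^ 4)))"
    using int \<theta> by (intro nn_integral_eq_integral) auto
  also have "\<dots> \<le> ennreal (8 / \<theta> ^ 4 * 6)"
    using int \<theta> EX EY by (intro ennreal_leI) (auto intro!: divide_right_mono)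
  finally show ?thesis by simp
qed

text \<open>The exponent must lie strictly between 1/8, for \<open>escaping_finite\<close>, and 1/6, for \<open>AE_escaping\<close>.\<close>
definition escaping :: "nat \<Rightarrow> (real \<Rightarrow> real) set" where
  "escaping N = {x \<in> space path_space_inf. \<forall>n\<ge>N. real n powr (1 / 7) \<le> \<bar>x (real n)\<bar>}"

lemma sets_escaping[measurable]: "escaping N \<in> sets path_space_inf"
proof -
  have [measurable]: "(\<lambda>x. x (real n)) \<in> borel_measurable path_space_inf" for n
    by (intro component_path_measurable) simp
  show ?thesis unfolding escaping_def by measurable
qed

text \<open>The condition is tested at the single time n, the integer part of \<open>u\<close>: it
  is at least \<open>N\<close>, and the path is still in its bridge phase, less than 1 before
  returning to 0.\<close>

lemma escaping_prob_le:
  assumes u: "real N \<le> u" "1 \<le> u"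
  shows "(\<integral>\<^sup>+p. indicator (escaping N) (glue (u, p)) \<partial>(B \<Otimes>\<^sub>M S)) \<le> ennreal (96 * u powr (-4 / 7))"
proof -
  have u0: "0 < u" using u by simp
  define n where "n = nat \<lfloor>u\<rfloor>"
  have n: "1 \<le> n" "real n \<le> u" "u < real n + 1" "N \<le> n"
    using u unfolding n_def by linarith+
  define \<theta> where "\<theta> = real n powr (1 / 7)"
  have \<theta>: "0 < \<theta>" using n by (simp add: \<theta>_def)
  have [measurable]: "(\<lambda>\<omega>. \<omega> u) \<in> borel_measurable B" "(\<lambda>\<omega>. \<omega> (real n)) \<in> borel_measurable B"
    using u by (auto intro!: measurable_component)
  define E where "E = {\<omega>. \<theta> \<le> \<bar>\<omega> (real n) - real n / u * \<omega> u\<bar>}"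
  have [measurable]: "(\<lambda>\<omega>. indicator E \<omega> :: ennreal) \<in> borel_measurable B"
    unfolding E_def indicator_def mem_Collect_eq by measurable
  have "AE p in B \<Otimes>\<^sub>M S. indicator (escaping N) (glue (u, p)) \<le> (indicator E (fst p) :: ennreal)"
    using AE_glue[OF u0] AE_pair_snd[OF AE_S_start]
  proof eventually_elim
    case (elim p)
    have "glue (u, p) (real n) = fst p (min (real n) u) - min (real n) u / u * fst p u + snd p (max (real n - u) 0)"
      using elim(1) by auto
    then have "glue (u, p) (real n) = fst p (real n) - real n / u * fst p u"
      using n elim(2) by (simp add: min_def max_def split: if_splits)
    then show ?case using n(4) by (auto simp: escaping_def E_def \<theta>_def indicator_def)
  qed
  then have "(\<integral>\<^sup>+p. indicator (escaping N) (glue (u, p)) \<partial>(B \<Otimes>\<^sub>M S)) \<le> (\<integral>\<^sup>+p. indicator E (fst p) \<partial>(B \<Otimes>\<^sub>M S))"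
    by (rule nn_integral_mono_AE)
  also have "\<dots> = (\<integral>\<^sup>+\<omega>. indicator E \<omega> \<partial>B)"
    by (subst S.nn_integral_fst[symmetric]) (simp_all add: S.emeasure_space_1)
  also have "\<dots> \<le> ennreal (48 / \<theta> ^ 4)"
    unfolding E_def using n \<theta> by (intro bridge_tail_prob) auto
  also have "\<dots> \<le> ennreal (96 * u powr (-4 / 7))"
  proof (rule ennreal_leI)
    have "\<theta> ^ 4 = real n powr (4 / 7)" using n by (simp add: \<theta>_def powr_power)
    moreover have "(u / 2) powr (4 / 7) \<le> real n powr (4 / 7)" using n by (intro powr_mono2) auto
    \<comment> \<open>Since n >= 1 and u < n + 1, n is at least u/2; bounding 2^(4/7) by 2 doubles
      the constant 48 to 96.\<close>
    moreover have "u powr (4 / 7) / 2 \<le> (u / 2) powr (4 / 7)"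
    proof -
      have "(2 :: real) powr (4 / 7) \<le> 2 powr 1" by (intro powr_mono) auto
      then have "u powr (4 / 7) / 2 \<le> u powr (4 / 7) / 2 powr (4 / 7)" by (intro divide_left_mono) auto
      then show ?thesis using u by (simp add: powr_divide)
    qed
    ultimately have "u powr (4 / 7) / 2 \<le> \<theta> ^ 4" by linarith
    moreover have "0 < u powr (4 / 7)" using u by simp
    ultimately have "48 / \<theta> ^ 4 \<le> 48 / (u powr (4 / 7) / 2)" using \<theta> by (intro divide_left_mono) auto
    also have "\<dots> = 96 * u powr (-4 / 7)" by (simp add: powr_minus_divide)
    finally show "48 / \<theta> ^ 4 \<le> 96 * u powr (-4 / 7)" .
  qed
  finally show ?thesis .
qed

text \<open>Near 0 the density is at most u^(-1/2), which is integrable. At infinity the slice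
  probability improves the exponent to -1/2 - 4/7 = -15/14, below -1.\<close>

lemma escaping_finite: "emeasure (mixture W_density) (escaping N) < \<infinity>"
proof -
  define a where "a = real N + 1"
  have a: "1 \<le> a" "0 < a" "real N \<le> a" by (auto simp: a_def)
  have i1: "((\<lambda>u. u powr (-1 / 2)) has_integral (a powr (-1 / 2 + 1) / (-1 / 2 + 1))) {0..a}"
    using has_integral_powr_from_0[of "-1 / 2" a] a by simp
  have i2: "((\<lambda>u. 96 * u powr (-15 / 14)) has_integral 96 * (- (a powr (-15 / 14 + 1)) / (-15 / 14 + 1))) {a..}"
    using has_integral_mult_right[OF has_integral_powr_to_inf[of "-15 / 14" a], of 96] a by simp
  have W: "W_density u \<le> ennreal (u powr (-1 / 2))" if "0 < u" for u
  proof -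
    have "1 / sqrt (2 * pi * u) \<le> 1 / sqrt u"
      using that pi_gt3 by (intro divide_left_mono) (auto intro!: mult_right_mono)
    also have "\<dots> = u powr (-1 / 2)" using that by (simp add: powr_minus_divide powr_half_sqrt)
    finally show ?thesis using that by (simp add: W_density_def ennreal_leI)
  qed
  have "emeasure (mixture W_density) (escaping N) =
      (\<integral>\<^sup>+u. W_density u * (\<integral>\<^sup>+p. indicator (escaping N) (glue (u, p)) \<partial>(B \<Otimes>\<^sub>M S)) \<partial>lborel)"
    by (rule emeasure_mixture) measurable
  also have "\<dots> \<le> (\<integral>\<^sup>+u. ennreal (u powr (-1 / 2)) * indicator {0..a} u +
      ennreal (96 * u powr (-15 / 14)) * indicator {a..} u \<partial>lborel)"
  proof (rule nn_integral_mono)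
    fix u :: real
    let ?p = "\<integral>\<^sup>+p. indicator (escaping N) (glue (u, p)) \<partial>(B \<Otimes>\<^sub>M S)"
    consider "u \<le> 0" | "0 < u" "u < a" | "a \<le> u" by linarith
    then show "W_density u * ?p \<le> ennreal (u powr (-1 / 2)) * indicator {0..a} u +
      ennreal (96 * u powr (-15 / 14)) * indicator {a..} u"
    proof cases
      case 1
      then show ?thesis by (simp add: W_density_def)
    next
      case 2
      have "?p \<le> (\<integral>\<^sup>+p. 1 \<partial>(B \<Otimes>\<^sub>M S))" by (intro nn_integral_mono) (simp add: indicator_def)
      then have "?p \<le> 1" by (simp add: BS.P.emeasure_space_1)
      then have "W_density u * ?p \<le> ennreal (u powr (-1 / 2)) * 1"
        using W[OF 2(1)] by (intro mult_mono) auto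
      then show ?thesis using 2 by simp
    next
      case 3
      then have u: "0 < u" "real N \<le> u" "1 \<le> u" using a by auto
      have "W_density u * ?p \<le> ennreal (u powr (-1 / 2)) * ennreal (96 * u powr (-4 / 7))"
        using W[OF u(1)] escaping_prob_le[OF u(2,3)] by (intro mult_mono) auto
      also have "\<dots> = ennreal (96 * u powr (-15 / 14))"
      proof -
        have "u powr (-1 / 2) * (96 * u powr (-4 / 7)) = 96 * u powr (-15 / 14)"
          by (simp add: powr_add[symmetric])
        then show ?thesis by (simp add: ennreal_mult[symmetric])
      qed
      finally show ?thesis using 3 by (simp add: add_increasing)
    qed
  qed
  also have "\<dots> = (\<integral>\<^sup>+u\<in>{0..a}. ennreal (u powr (-1 / 2)) \<partial>lborel) + (\<integral>\<^sup>+u\<in>{a..}. ennreal (96 * u powr (-15 / 14)) \<partial>lborel)"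
  proof (rule nn_integral_add)
    note [measurable del] = measurable_component
    show "(\<lambda>u. ennreal (u powr (-1 / 2)) * indicator {0..a} u) \<in> borel_measurable lborel"
      "(\<lambda>u. ennreal (96 * u powr (-15 / 14)) * indicator {a..} u) \<in> borel_measurable lborel"
      by measurable
  qed
  also have "(\<integral>\<^sup>+u\<in>{0..a}. ennreal (u powr (-1 / 2)) \<partial>lborel) = ennreal (a powr (-1 / 2 + 1) / (-1 / 2 + 1))"
    by (rule nn_integral_has_integral_lebesgue'[OF _ i1]) simp
  also have "(\<integral>\<^sup>+u\<in>{a..}. ennreal (96 * u powr (-15 / 14)) \<partial>lborel) = ennreal (96 * (- (a powr (-15 / 14 + 1)) / (-15 / 14 + 1)))"
    by (rule nn_integral_has_integral_lebesgue'[OF _ i2]) simp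
  also have "\<dots> < \<infinity>" by simp
  finally show ?thesis by simp
qed

text \<open>Borel-Cantelli with \<open>S_small_prob\<close>. For n >= 2 u the elapsed time n - u is
  at least n/2, so the probabilities are at most (sqrt 2)^3 <= 3 times n^(3/7 - 3/2) =
  n^(-15/14).\<close>

lemma AE_S_eventually_large:
  assumes u: "0 < u"
  shows "AE y in S. \<forall>\<^sub>F n in sequentially. real n powr (1 / 7) \<le> \<bar>y (max (real n - u) 0)\<bar>"
proof -
  define E where "E n = {y \<in> space S. \<bar>y (max (real n - u) 0)\<bar> \<le> real n powr (1 / 7)}" for n
  have [measurable]: "(\<lambda>y. y (max (real n - u) 0)) \<in> borel_measurable path_space_inf" for n
    by (intro component_path_measurable) simp
  have E: "E n \<in> sets S" for n unfolding E_def by measurable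
  have "summable (\<lambda>n. measure S (E n))"
  proof (rule summable_comparison_test_ev)
    show "summable (\<lambda>n. 3 * real n powr (-15 / 14))"
      by (intro summable_mult) (simp add: summable_real_powr_iff)
    have "eventually (\<lambda>n. max 1 (2 * u) \<le> real n) sequentially"
      by (rule filterlim_real_sequentially[unfolded filterlim_at_top, rule_format])
    then show "\<forall>\<^sub>F n in sequentially. norm (measure S (E n)) \<le> 3 * real n powr (-15 / 14)"
    proof eventually_elim
      case (elim n)
      then have n: "1 \<le> real n" "real n / 2 \<le> real n - u" "0 < real n - u" using u by auto
      have "emeasure S (E n) \<le> ennreal ((real n powr (1 / 7) / sqrt (real n - u)) ^ 3)"
        using S_small_prob[of "real n - u" "real n powr (1 / 7)"] n unfolding E_def by (simp add: max_def)
      then have "measure S (E n) \<le> (real n powr (1 / 7) / sqrt (real n - u)) ^ 3"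
        using n by (simp add: S.emeasure_eq_measure)
      also have "\<dots> \<le> (real n powr (1 / 7) / sqrt (real n / 2)) ^ 3"
        using n by (intro power_mono divide_left_mono) auto
      also have "\<dots> = (real n powr (1 / 7)) ^ 3 / (sqrt (real n)) ^ 3 * (sqrt 2) ^ 3"
        by (simp add: real_sqrt_divide power_divide power_mult_distrib)
      also have "(real n powr (1 / 7)) ^ 3 / (sqrt (real n)) ^ 3 = real n powr (-15 / 14)"
      proof -
        have "(real n powr (1 / 7)) ^ 3 / (sqrt (real n)) ^ 3 = real n powr (3 / 7) / real n powr (3 / 2)"
          using n by (simp add: powr_half_sqrt[symmetric] powr_power)
        also have "\<dots> = real n powr (-15 / 14)" by (simp add: powr_diff[symmetric])
        finally show ?thesis .
      qed
      also have "real n powr (-15 / 14) * (sqrt 2) ^ 3 \<le> real n powr (-15 / 14) * 3"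
      proof (rule mult_left_mono)
        have "(sqrt 2) ^ 3 = 2 * sqrt 2" by (simp add: power3_eq_cube)
        moreover have "sqrt 2 \<le> 3 / 2" by (rule real_le_lsqrt) (auto simp: power2_eq_square)
        ultimately show "(sqrt 2) ^ 3 \<le> 3" by linarith
      qed simp
      finally show ?case by simp
    qed
  qed
  then have "AE y in S. \<forall>\<^sub>F n in sequentially. y \<in> space S - E n"
    using E by (intro borel_cantelli_AE1) (auto simp: S.emeasure_eq_measure)
  then show ?thesis
  proof eventually_elim
    case (elim y)
    then show ?case by eventually_elim (auto simp: E_def)
  qed
qed

text \<open>On each slice the path after \<open>u\<close> is the Bessel path delayed by
  \<open>u\<close>, which almost surely exceeds the threshold at all large integers; the exceptional
  set is thus null slice by slice.\<close>

lemma escaping_exhausts: "emeasure (mixture W_density) (space path_space_inf - (\<Union>N. escaping N)) = 0"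
proof -
  let ?D = "space path_space_inf - (\<Union>N. escaping N)"
  have D: "?D \<in> sets path_space_inf" by measurable
  have "W_density u * (\<integral>\<^sup>+p. indicator ?D (glue (u, p)) \<partial>(B \<Otimes>\<^sub>M S)) = 0" for u
  proof (cases "0 < u")
    case True
    have "AE p in B \<Otimes>\<^sub>M S. \<forall>\<^sub>F n in sequentially. real n powr (1 / 7) \<le> \<bar>snd p (max (real n - u) 0)\<bar>"
      using True by (intro AE_pair_snd AE_S_eventually_large)
    then have "AE p in B \<Otimes>\<^sub>M S. indicator ?D (glue (u, p)) = (0 :: ennreal)"
      using AE_glue[OF True] AE_space
    proof eventually_elim
      case (elim p)
      have sp: "glue (u, p) \<in> space path_space_inf"
        using measurable_space[OF measurable_glue_section elim(3)] .
      have "eventually (\<lambda>n. u \<le> real n) sequentially"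
        by (rule filterlim_real_sequentially[unfolded filterlim_at_top, rule_format])
      with elim(1) have "\<forall>\<^sub>F n in sequentially. real n powr (1 / 7) \<le> \<bar>glue (u, p) (real n)\<bar>"
      proof eventually_elim
        case (elim n)
        have "glue (u, p) (real n) = fst p (min (real n) u) - min (real n) u / u * fst p u + snd p (max (real n - u) 0)"
          using \<open>\<forall>t\<ge>0. glue (u, p) t = _ t\<close> by auto
        moreover have "min (real n) u = u" using elim by simp
        ultimately show ?case using elim True by simp
      qed
      then obtain N where "\<forall>n\<ge>N. real n powr (1 / 7) \<le> \<bar>glue (u, p) (real n)\<bar>"
        by (auto simp: eventually_sequentially)
      then have "glue (u, p) \<in> escaping N" using sp by (simp add: escaping_def)
      then show ?case by (auto simp: indicator_def)
    qed
    then have "(\<integral>\<^sup>+p. indicator ?D (glue (u, p)) \<partial>(B \<Otimes>\<^sub>M S)) = (\<integral>\<^sup>+p. 0 \<partial>(B \<Otimes>\<^sub>M S))"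
      by (rule nn_integral_cong_AE)
    then show ?thesis by simp
  qed (simp add: W_density_def)
  then show ?thesis using D by (simp only: emeasure_mixture[OF W_density_measurable D] nn_integral_const) simp
qed


section \<open>Uniqueness of the limit on a sigma-finite measure\<close>

text \<open>Convergence is known on sets of finite measure only, so Z and Z' are compared on each
  \<open>escaping N\<close>, and the countable exhaustion makes the agreement global.\<close>

lemma locally_in_measure_limit_unique:
  fixes F G :: "nat \<Rightarrow> (real \<Rightarrow> real) \<Rightarrow> real"
  assumes F: "converges_locally_in_measure (script_W B) F Z"
    and G: "converges_locally_in_measure (script_W B) G Z'"
    and FG: "\<And>T. 0 < T \<Longrightarrow> (\<lambda>n. \<integral>\<^sup>+\<omega>. ennreal \<bar>F n \<omega> - G n \<omega>\<bar> \<partial>mixture (indicator {0<..T})) \<longlonglongrightarrow> 0"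
  shows "AE \<omega> in script_W B. Z \<omega> = Z' \<omega>"
proof -
  let ?W = "mixture W_density" and ?\<Omega> = "space path_space_inf"
  note [simp] = measurable_cong_sets[OF sets_mixture refl]
  have meas[measurable]: "F n \<in> borel_measurable path_space_inf" "G n \<in> borel_measurable path_space_inf"
    "Z \<in> borel_measurable path_space_inf" "Z' \<in> borel_measurable path_space_inf" for n
    using F G by (simp_all add: converges_locally_in_measure_def script_W_eq)
  \<comment> \<open>The factor 3 matches the three differences F - Z, F - G and G - Z': if |Z - Z'|
    >= 3 e, one of them is at least \<open>e\<close>.\<close>
  define D where "D e = {x \<in> ?\<Omega>. 3 * e \<le> \<bar>Z x - Z' x\<bar>}" for e
  have D[measurable]: "D e \<in> sets path_space_inf" for e unfolding D_def by measurable
  have null: "emeasure ?W (escaping N \<inter> D e) = 0" if e: "0 < e" for N e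
  proof -
    let ?A = "escaping N"
    let ?E = "\<lambda>H :: (real \<Rightarrow> real) \<Rightarrow> real. ?A \<inter> {x \<in> ?\<Omega>. e \<le> \<bar>H x\<bar>}"
    define b where "b n = emeasure ?W (?E (\<lambda>x. F n x - Z x)) + emeasure ?W (?E (\<lambda>x. F n x - G n x)) +
        emeasure ?W (?E (\<lambda>x. G n x - Z' x))" for n
    have "(\<lambda>n. emeasure ?W (?E (\<lambda>x. F n x - Z x))) \<longlonglongrightarrow> 0" "(\<lambda>n. emeasure ?W (?E (\<lambda>x. G n x - Z' x))) \<longlonglongrightarrow> 0"
      using F G e sets_escaping[of N] escaping_finite[of N]
      unfolding converges_locally_in_measure_def script_W_eq sets_mixture space_mixture by blast+
    moreover have "(\<lambda>n. emeasure ?W (?E (\<lambda>x. F n x - G n x))) \<longlonglongrightarrow> 0"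
      by (rule L1_imp_locally_in_measure) (use e escaping_finite FG in auto)
    ultimately have "b \<longlonglongrightarrow> 0 + 0 + 0" unfolding b_def by (intro tendsto_add)
    moreover have "emeasure ?W (?A \<inter> D e) \<le> b n" for n
    proof -
      have "?A \<inter> D e \<subseteq> ?E (\<lambda>x. F n x - Z x) \<union> ?E (\<lambda>x. F n x - G n x) \<union> ?E (\<lambda>x. G n x - Z' x)"
      proof
        fix x assume "x \<in> ?A \<inter> D e"
        then have x: "x \<in> ?A" "x \<in> ?\<Omega>" "3 * e \<le> \<bar>Z x - Z' x\<bar>" by (auto simp: D_def)
        then have "e \<le> \<bar>F n x - Z x\<bar> \<or> e \<le> \<bar>F n x - G n x\<bar> \<or> e \<le> \<bar>G n x - Z' x\<bar>" by linarith
        then show "x \<in> ?E (\<lambda>x. F n x - Z x) \<union> ?E (\<lambda>x. F n x - G n x) \<union> ?E (\<lambda>x. G n x - Z' x)"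
          using x by blast
      qed
      then have "emeasure ?W (?A \<inter> D e) \<le>
          emeasure ?W (?E (\<lambda>x. F n x - Z x) \<union> ?E (\<lambda>x. F n x - G n x) \<union> ?E (\<lambda>x. G n x - Z' x))"
        by (rule emeasure_mono) (simp, measurable)
      also have "\<dots> \<le> emeasure ?W (?E (\<lambda>x. F n x - Z x) \<union> ?E (\<lambda>x. F n x - G n x)) + emeasure ?W (?E (\<lambda>x. G n x - Z' x))"
        by (rule emeasure_subadditive) (simp, measurable)+
      also have "\<dots> \<le> b n"
        unfolding b_def by (intro add_right_mono emeasure_subadditive) (simp, measurable)+
      finally show ?thesis .
    qed
    ultimately have "emeasure ?W (?A \<inter> D e) \<le> 0" by (intro LIMSEQ_le_const) auto
    then show ?thesis by simp
  qed
  have "AE \<omega> in ?W. \<omega> \<notin> escaping N \<inter> D (1 / real (Suc k))" for N k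
    using null[of "1 / real (Suc k)" N] by (intro AE_not_in null_setsI) auto
  then have "AE \<omega> in ?W. \<forall>N k. \<omega> \<notin> escaping N \<inter> D (1 / real (Suc k))"
    unfolding AE_all_countable by blast
  moreover have "AE \<omega> in ?W. \<omega> \<notin> ?\<Omega> - (\<Union>N. escaping N)"
    using escaping_exhausts by (intro AE_not_in null_setsI) auto
  ultimately have "AE \<omega> in ?W. Z \<omega> = Z' \<omega>"
    using AE_space
  proof eventually_elim
    case (elim \<omega>)
    then have sp: "\<omega> \<in> ?\<Omega>" by simp
    then obtain N where N: "\<omega> \<in> escaping N" using elim(2) by auto
    show ?case
    proof (rule ccontr)
      assume "Z \<omega> \<noteq> Z' \<omega>"
      then obtain k where k: "inverse (real (Suc k)) < \<bar>Z \<omega> - Z' \<omega>\<bar> / 3"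
        using reals_Archimedean[of "\<bar>Z \<omega> - Z' \<omega>\<bar> / 3"] by auto
      then have "\<omega> \<in> D (1 / real (Suc k))" using sp unfolding D_def inverse_eq_divide by simp
      then show False using elim(1) N by blast
    qed
  qed
  then show ?thesis unfolding script_W_eq .
qed

end

theorem theorem1p1:
  fixes B :: "(real \<Rightarrow> real) measure"
    and f :: "real \<Rightarrow> real"
    and fn :: "nat \<Rightarrow> real \<Rightarrow> real"
  assumes "wiener_measure B"
    and "f \<in> borel_measurable (lebesgue_on {0..})"
    and "integrable (lebesgue_on {0..}) (\<lambda>s. (f s)\<^sup>2)"
    and "integrable (lebesgue_on {0..}) (\<lambda>s. \<bar>f s\<bar> / (1 + sqrt s))"
    and "\<forall>n. step_function (fn n)"
    and "approximates fn f"
  shows "(\<exists>Z \<in> borel_measurable path_space_inf.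
            converges_locally_in_measure (script_W B) (\<lambda>n. step_integral (fn n)) Z) \<and>
         (\<forall>gn Z Z'. (\<forall>n. step_function (gn n)) \<and> approximates gn f \<and>
            converges_locally_in_measure (script_W B) (\<lambda>n. step_integral (fn n)) Z \<and>
            converges_locally_in_measure (script_W B) (\<lambda>n. step_integral (gn n)) Z' \<longrightarrow>
            (AE \<omega> in script_W B. Z \<omega> = Z' \<omega>))"
proof -
  interpret wiener B by (rule wiener.intro) (rule assms(1))
  have fn: "step_function (fn n)" for n using assms(5) by simp
  show ?thesis
  proof (intro conjI allI impI, goal_cases)
    case 1
    show ?case by (rule step_integral_converges_locally[OF assms(2) fn assms(6)])
  next
    case (2 gn Z Z')
    then have gn: "\<And>n. step_function (gn n)" "approximates gn f"
      and conv: "converges_locally_in_measure (script_W B) (\<lambda>n. step_integral (fn n)) Z"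
        "converges_locally_in_measure (script_W B) (\<lambda>n. step_integral (gn n)) Z'"
      by auto
    show ?case
      by (rule locally_in_measure_limit_unique[OF conv])
        (rule step_diff_L1_tendsto[OF assms(2) fn gn(1) assms(6) gn(2)])
  qed
qed

end
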